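(* Let $\lambda=1$, $\beta>0$, $c>0$, $b>1$ and $a=3/2$. Let $\{P_t\}_{t\ge0}$ be the semigroup generated by the infinitesimal generator $$\mathbb L=-\frac1{\sqrt2}\Big((-\Delta)^{3/4}-\nabla(-\Delta)^{1/4}\Big).$$ Then, for all $f,h\in\mathcal S(\mathbb R)$ and all $t>0$, $$\lim_{n\to\infty}\sigma^n_t(f,h)=\frac{2}{\beta^2}\iint_{\mathbb R^2}f(u)\,h(v)\,P_t(u-v)\,du\,dv .$$
   Context: $\mathcal S(\mathbb R)$ is the Schwartz space. On $\mathbb R$, $\nabla=d/dx$, $\Delta=d^2/dx^2$, and fractional powers of $-\Delta$ are defined by Fourier multipliers: $(-\Delta)^s e^{ikx}=|k|^{2s}e^{ikx}$. Thus $\mathbb L e^{ikx}=-\frac{1}{\sqrt2}|k|^{3/2}(1-i\,\mathrm{sgn}(k))e^{ikx}$. The kernel $P_t(\cdot)$ is the transition density of the semigroup $e^{t\mathbb L}$, i.e. $(e^{t\mathbb L}f)(v)=\int_{\mathbb R}f(u)P_t(u-v)\,du$. For an integer $n\ge 1$ put $\gamma_n=c\,n^{-b}$. The configuration space is $\Omega=\mathbb R^{\mathbb Z}$, with elements $\omega=(\omega_x)_{x\in\mathbb Z}$. The Markov process $\{\omega(t)\}_{t\ge0}$ (which depends on $n$) has generator $\mathcal L_n=\mathcal A+\gamma_n\mathcal S^{\rm flip}+\lambda\,\mathcal S^{\rm exch}$, with $\lambda=1$, acting on smooth local bounded functions $f:\Omega\to\mathbb R$ by $$\mathcal A f=\sum_{x\in\mathbb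 Z}(\omega_{x+1}-\omega_{x-1})\,\partial_{\omega_x}f,\quad \mathcal S^{\rm flip}f(\omega)=\sum_{x\in\mathbb Z}\big(f(\omega^x)-f(\omega)\big),\quad \mathcal S^{\rm exch}f(\omega)=\sum_{x\in\mathbb Z}\big(f(\omega^{x,x+1})-f(\omega)\big),$$ where $\omega^x$ is $\omega$ with $\omega_x$ replaced by $-\omega_x$, and $\omega^{x,x+1}$ is $\omega$ with $\omega_x$ and $\omega_{x+1}$ exchanged. The Gaussian product measure $\mu_\beta(d\omega)=\prod_{x\in\mathbb Z}\sqrt{\beta/(2\pi)}\,e^{-\beta\omega_x^2/2}\,d\omega_x$ is invariant, and the process is started from $\mu_\beta$; $\langle\cdot\rangle_\beta$ denotes expectation for this stationary process. The space-time correlation function of the energy fluctuation field in the time scale $tn^a$ is $$\sigma^n_t(f,h)=\frac1n\sum_{x,y\in\mathbb Z}f\big(\tfrac xn\big)\,h\big(\tfrac yn\big)\,\Big\langle\big(\omega_x^2(tn^a)-\beta^{-1}\big)\big(\omega_y^2(0)-\beta^{-1}\big)\Big\rangle_\beta .$$ *)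

theory Defs
  imports "HOL-Probability.Probability"
begin

section \<open>Configurations and the generator\<close>

type_synonym config = "int \<Rightarrow> real"

definition config_space :: "config measure" where
  "config_space = (\<Pi>\<^sub>M x\<in>UNIV. borel)"

definition gibbs :: "real \<Rightarrow> config measure" where
  "gibbs \<beta> = (\<Pi>\<^sub>M x\<in>UNIV. density lborel
     (\<lambda>s. ennreal (sqrt (\<beta> / (2 * pi)) * exp (- \<beta> * s\<^sup>2 / 2))))"

definition partial_deriv :: "int \<Rightarrow> (config \<Rightarrow> real) \<Rightarrow> config \<Rightarrow> real" where
  "partial_deriv x f \<eta> = deriv (\<lambda>s. f (\<eta>(x := s))) (\<eta> x)"

definition local_fun :: "(config \<Rightarrow> real) \<Rightarrow> bool" where
  "local_fun f \<longleftrightarrow>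
     (\<exists>\<Lambda>. finite \<Lambda> \<and> (\<forall>\<eta> \<zeta>. (\<forall>x\<in>\<Lambda>. \<eta> x = \<zeta> x) \<longrightarrow> f \<eta> = f \<zeta>))"

text \<open>Continuity refers to the product topology; for a local function, depending on the
  coordinates in a finite set \<open>\<Lambda>\<close> only, this is ordinary smoothness on \<open>\<real>\<^sup>\<Lambda>\<close>.\<close>

definition smooth_fun :: "(config \<Rightarrow> real) \<Rightarrow> bool" where
  "smooth_fun f \<longleftrightarrow>
     (\<forall>xs. continuous_on UNIV (foldr partial_deriv xs f) \<and>
       (\<forall>x \<eta>. (\<lambda>s. foldr partial_deriv xs f (\<eta>(x := s))) differentiable (at (\<eta> x))))"

definition smooth_local_bounded :: "(config \<Rightarrow> real) set" where
  "smooth_local_bounded = {f. smooth_fun f \<and> local_fun f \<and> bounded (range f)}"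

text \<open>Applied to local functions, all but finitely many terms of the following sums vanish.\<close>

definition A_gen :: "(config \<Rightarrow> real) \<Rightarrow> config \<Rightarrow> real" where
  "A_gen f \<eta> = (\<Sum>\<^sub>\<infinity>x::int. (\<eta> (x + 1) - \<eta> (x - 1)) * partial_deriv x f \<eta>)"

definition S_flip :: "(config \<Rightarrow> real) \<Rightarrow> config \<Rightarrow> real" where
  "S_flip f \<eta> = (\<Sum>\<^sub>\<infinity>x::int. f (\<eta>(x := - \<eta> x)) - f \<eta>)"

definition S_exch :: "(config \<Rightarrow> real) \<Rightarrow> config \<Rightarrow> real" where
  "S_exch f \<eta> = (\<Sum>\<^sub>\<infinity>x::int. f (\<eta>(x := \<eta> (x + 1), x + 1 := \<eta> x)) - f \<eta>)"

definition generator :: "real \<Rightarrow> real \<Rightarrow> (config \<Rightarrow> real) \<Rightarrow> config \<Rightarrow> real" where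
  "generator \<gamma> lam f \<eta> = A_gen f \<eta> + \<gamma> * S_flip f \<eta> + lam * S_exch f \<eta>"


section \<open>The stationary Markov process\<close>

definition transition_semigroup :: "'a measure \<Rightarrow> (real \<Rightarrow> 'a \<Rightarrow> 'a measure) \<Rightarrow> bool" where
  "transition_semigroup E K \<longleftrightarrow>
     (\<forall>t\<ge>0. K t \<in> E \<rightarrow>\<^sub>M prob_algebra E) \<and>
     (\<forall>x\<in>space E. K 0 x = return E x) \<and>
     (\<forall>s\<ge>0. \<forall>t\<ge>0. \<forall>x\<in>space E. K (s + t) x = K s x \<bind> K t)"

definition past :: "'m measure \<Rightarrow> 'a measure \<Rightarrow> (real \<Rightarrow> 'm \<Rightarrow> 'a) \<Rightarrow> real \<Rightarrow> 'm measure" where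
  "past M E X s = sigma (space M) {X r -` B \<inter> space M | r B. 0 \<le> r \<and> r \<le> s \<and> B \<in> sets E}"

definition markov_process ::
    "'m measure \<Rightarrow> 'a measure \<Rightarrow> (real \<Rightarrow> 'a \<Rightarrow> 'a measure) \<Rightarrow> (real \<Rightarrow> 'm \<Rightarrow> 'a) \<Rightarrow> bool" where
  "markov_process M E K X \<longleftrightarrow>
     prob_space M \<and> (\<forall>t\<ge>0. X t \<in> M \<rightarrow>\<^sub>M E) \<and>
     (\<forall>s\<ge>0. \<forall>t\<ge>0. \<forall>B\<in>sets E.
        AE w in M. real_cond_exp M (past M E X s) (\<lambda>w. indicator B (X (s + t) w)) w
                   = measure (K t (X s w)) B)"

text \<open>On the functions \<open>f \<in> D\<close> for which \<open>L f\<close> is square integrable, \<open>L\<close> is the derivative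
  at time \<open>0\<close> of the semigroup \<open>K\<close> in \<open>L\<^sup>2(\<mu>)\<close>.  Square integrability has to be asked for:
  for a smooth local bounded \<open>f\<close> with rapidly growing derivatives, \<open>A_gen f\<close> need not even
  be integrable.\<close>

definition has_L2_generator_on ::
    "'a measure \<Rightarrow> (real \<Rightarrow> 'a \<Rightarrow> 'a measure) \<Rightarrow> (('a \<Rightarrow> real) \<Rightarrow> 'a \<Rightarrow> real) \<Rightarrow> ('a \<Rightarrow> real) set \<Rightarrow> bool"
  where
  "has_L2_generator_on \<mu> K L D \<longleftrightarrow>
     (\<forall>f\<in>D. L f \<in> borel_measurable \<mu> \<and> integrable \<mu> (\<lambda>x. (L f x)\<^sup>2) \<longrightarrow>
        ((\<lambda>t. \<integral>\<^sup>+x. ennreal ((((\<integral>y. f y \<partial>(K t x)) - f x) / t - L f x)\<^sup>2) \<partial>\<mu>) \<longlongrightarrow> 0) (at_right 0))"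

definition stationary_dynamics ::
    "real \<Rightarrow> real \<Rightarrow> real \<Rightarrow> 'm measure \<Rightarrow> (real \<Rightarrow> 'm \<Rightarrow> config) \<Rightarrow> bool" where
  "stationary_dynamics \<gamma> lam \<beta> M X \<longleftrightarrow>
     (\<exists>K. transition_semigroup config_space K \<and>
          markov_process M config_space K X \<and>
          distr M config_space (X 0) = gibbs \<beta> \<and>
          (\<forall>t\<ge>0. gibbs \<beta> \<bind> K t = gibbs \<beta>) \<and>
          has_L2_generator_on (gibbs \<beta>) K (generator \<gamma> lam) smooth_local_bounded)"

text \<open>The time scale is \<open>t n\<^sup>a\<close>; \<open>M\<close> and \<open>X\<close> are the realization of the process for the given \<open>n\<close>.\<close>

definition correlation ::
    "'m measure \<Rightarrow> (real \<Rightarrow> 'm \<Rightarrow> config) \<Rightarrow> real \<Rightarrow> real \<Rightarrow> nat \<Rightarrow> real \<Rightarrow>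
     (real \<Rightarrow> complex) \<Rightarrow> (real \<Rightarrow> complex) \<Rightarrow> complex" where
  "correlation M X \<beta> a n t f h =
     1 / of_nat n * (\<Sum>\<^sub>\<infinity>(x, y)\<in>(UNIV :: (int \<times> int) set).
        f (of_int x / real n) * h (of_int y / real n) *
        complex_of_real (\<integral>w. ((X (t * real n powr a) w x)\<^sup>2 - 1 / \<beta>) * ((X 0 w y)\<^sup>2 - 1 / \<beta>) \<partial>M))"


section \<open>Schwartz functions and the fractional semigroup\<close>

definition nabla :: "(real \<Rightarrow> complex) \<Rightarrow> real \<Rightarrow> complex" where
  "nabla f x = vector_derivative f (at x)"

definition schwartz :: "(real \<Rightarrow> complex) \<Rightarrow> bool" where
  "schwartz f \<longleftrightarrow>
     (\<forall>k x. (nabla ^^ k) f differentiable (at x)) \<and>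
     (\<forall>m k. bounded (range (\<lambda>x. complex_of_real (x ^ m) * (nabla ^^ k) f x)))"

definition fourier :: "(real \<Rightarrow> complex) \<Rightarrow> real \<Rightarrow> complex" where
  "fourier f k = (\<integral>x. f x * cis (- k * x) \<partial>lborel)"

text \<open>\<open>(-\<Delta>)\<^sup>s\<close>, the Fourier multiplier with \<open>e\<^sup>i\<^sup>k\<^sup>x \<mapsto> \<bar>k\<bar>\<^sup>2\<^sup>s e\<^sup>i\<^sup>k\<^sup>x\<close>\<close>

definition frac_laplacian :: "real \<Rightarrow> (real \<Rightarrow> complex) \<Rightarrow> real \<Rightarrow> complex" where
  "frac_laplacian s f x =
     1 / (2 * complex_of_real pi) *
     (\<integral>k. complex_of_real (\<bar>k\<bar> powr (2 * s)) * fourier f k * cis (k * x) \<partial>lborel)"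

definition L_op :: "(real \<Rightarrow> complex) \<Rightarrow> real \<Rightarrow> complex" where
  "L_op f x = - complex_of_real (1 / sqrt 2) *
     (frac_laplacian (3 / 4) f x - nabla (frac_laplacian (1 / 4) f) x)"

definition kernel_op :: "(real \<Rightarrow> real) \<Rightarrow> (real \<Rightarrow> complex) \<Rightarrow> real \<Rightarrow> complex" where
  "kernel_op p f v = (\<integral>u. f u * complex_of_real (p (u - v)) \<partial>lborel)"

text \<open>\<open>P t\<close>, \<open>t > 0\<close>, are the transition densities of a semigroup (which is the identity at
  \<open>t = 0\<close> and therefore has no density there) whose generator, in the supremum norm, is \<open>L\<close>
  on the Schwartz space.\<close>

definition transition_density_generated_by ::
    "(real \<Rightarrow> real \<Rightarrow> real) \<Rightarrow> ((real \<Rightarrow> complex) \<Rightarrow> real \<Rightarrow> complex) \<Rightarrow> bool" where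
  "transition_density_generated_by P L \<longleftrightarrow>
     (\<forall>t>0. P t \<in> borel_measurable borel \<and> (\<forall>x. P t x \<ge> 0) \<and>
            integrable lborel (P t) \<and> (\<integral>x. P t x \<partial>lborel) = 1) \<and>
     (\<forall>s>0. \<forall>t>0. \<forall>f. schwartz f \<longrightarrow>
            kernel_op (P (s + t)) f = kernel_op (P s) (kernel_op (P t) f)) \<and>
     (\<forall>f. schwartz f \<longrightarrow>
        uniform_limit UNIV (\<lambda>t v. (kernel_op (P t) f v - f v) / complex_of_real t) (L f) (at_right 0))"

end

theory Submission
  imports Defs "HOL-Real_Asymp.Real_Asymp"
begin

text \<open>
  The generator maps the span of the products \<open>\<xi> x * \<xi> y\<close> into itself.  By the Markov property the
  correlations of \<open>\<xi> x * \<xi> y\<close> at time \<open>t\<close> with the energy at one site at time \<open>0\<close> therefore solve a closed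
  linear system on \<open>\<int>\<^sup>2\<close> whose operator is bounded and has finite range.  A Fourier transform in the
  centre of mass splits it into tridiagonal systems in the distance \<open>d = \<bar>x - y\<bar>\<close>, indexed by a
  momentum \<open>\<theta>\<close>; they contract a weighted \<open>\<ell>\<^sup>2\<close> norm.

  For \<open>d > 0\<close> the tridiagonal operator has constant coefficients, so the decaying solution that
  extends the value \<open>1\<close> at \<open>d = 0\<close> is explicit.  It is an approximate eigenvector with eigenvalue
  \<open>\<lambda> = - \<sigma>\<^sup>2 - \<sigma>\<^sup>2 / (\<gamma> + q)\<close>, where \<open>\<sigma> = 2 sin (\<theta> / 2)\<close> and \<open>q\<^sup>2 = (1 + \<gamma>)\<^sup>2 - exp (\<i> \<theta>)\<close>.  For
  \<open>\<theta> = k / n\<close> and \<open>\<gamma> = c / n\<^sup>b\<close> with \<open>b > 1\<close> the term \<open>\<gamma>\<close> is negligible against \<open>\<theta>\<close>, hence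
  \<open>n powr (3 / 2) * \<lambda>\<close> tends to \<open>- k\<^sup>2 / csqrt (- \<i> k)\<close>, the symbol of the limiting generator.

  On the continuum side, modulated Gaussians are approximate eigenfunctions of the generator in the
  supremum norm, which identifies the characteristic function of \<open>P t\<close>.  Fourier inversion for \<open>h\<close>
  and Riemann sums for \<open>f\<close> connect the two computations.
\<close>


section \<open>Correlations of a stationary Markov process\<close>

text \<open>Orders of magnitude decide the norm in which the argument runs. At
  \<open>\<theta>\<close> of order 1/n the decaying part of the approximate eigenvector has
  amplitude of order n^(-1/2) and extends over about n^(1/2) distances. Its sum is of order one, so
  a supremum bound on the modes would leave an error that does not vanish; its square norm, however,
  is of order n^(-1/4). This is why contraction in a square norm is needed. The exponent 3/2 comes
  from the second term of the eigenvalue: division by \<open>q\<close>, of order n^(-1/2), makes it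
  of order n^(-3/2), larger than the purely diffusive term of order n^(-2).

  The dynamics is given only through a square-mean derivative at time 0 on bounded smooth local
  functions. Products of coordinates lie outside this class, and the rate of the difference
  quotients is not controlled as a truncation is removed. The differential equations are therefore
  obtained in integrated form first. The correlations are then known only as a bounded solution, so
  uniqueness is part of the argument.\<close>

lemma integral_mult_le_sqrt:
  fixes U V :: "'a \<Rightarrow> real"
  assumes [measurable]: "U \<in> borel_measurable M" "V \<in> borel_measurable M"
    and U: "integrable M (\<lambda>x. (U x)\<^sup>2)" and V: "integrable M (\<lambda>x. (V x)\<^sup>2)"
  shows "integrable M (\<lambda>x. U x * V x)"
    and "\<bar>\<integral>x. U x * V x \<partial>M\<bar> \<le> sqrt (\<integral>x. (U x)\<^sup>2 \<partial>M) * sqrt (\<integral>x. (V x)\<^sup>2 \<partial>M)"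
proof -
  \<comment> \<open>The weight \<open>a\<close> stays free; optimising it later turns this
    inequality into the Cauchy-Schwarz bound.\<close>
  have amgm: "\<bar>U x * V x\<bar> \<le> (a * (U x)\<^sup>2 + (V x)\<^sup>2 / a) / 2" if "a > 0" for a x
  proof -
    have "0 \<le> (sqrt a * \<bar>U x\<bar> - \<bar>V x\<bar> / sqrt a)\<^sup>2" by simp
    also have "\<dots> = a * (U x)\<^sup>2 + (V x)\<^sup>2 / a - 2 * \<bar>U x * V x\<bar>"
      using that by (simp add: power2_diff power_mult_distrib power_divide abs_mult)
    finally show ?thesis by simp
  qed
  show i: "integrable M (\<lambda>x. U x * V x)"
    by (rule Bochner_Integration.integrable_bound[where f="\<lambda>x. (1 * (U x)\<^sup>2 + (V x)\<^sup>2 / 1) / 2"])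
       (use U V amgm[of 1] in auto)
  define A where "A = (\<integral>x. (U x)\<^sup>2 \<partial>M)"
  define B where "B = (\<integral>x. (V x)\<^sup>2 \<partial>M)"
  have "A \<ge> 0" "B \<ge> 0" by (auto simp: A_def B_def)
  have bd: "\<bar>\<integral>x. U x * V x \<partial>M\<bar> \<le> (a * A + B / a) / 2" if "a > 0" for a
  proof -
    have "\<bar>\<integral>x. U x * V x \<partial>M\<bar> \<le> (\<integral>x. \<bar>U x * V x\<bar> \<partial>M)"
      by (rule integral_abs_bound)
    also have "\<dots> \<le> (\<integral>x. (a * (U x)\<^sup>2 + (V x)\<^sup>2 / a) / 2 \<partial>M)"
      by (rule integral_mono) (use i U V amgm[OF that] in auto)
    also have "\<dots> = (a * A + B / a) / 2" using U V by (simp add: A_def B_def)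
    finally show ?thesis .
  qed
  \<comment> \<open>The shift by \<open>d\<close> keeps both norms positive, so the optimal weight
    is defined even when \<open>U\<close> or \<open>V\<close> vanishes almost everywhere.\<close>
  have lim0: "\<bar>\<integral>x. U x * V x \<partial>M\<bar> \<le> sqrt (A + d) * sqrt (B + d)" if "d > 0" for d
  proof -
    define a where "a = sqrt (B + d) / sqrt (A + d)"
    have p: "sqrt (A + d) > 0" "sqrt (B + d) > 0" using \<open>A \<ge> 0\<close> \<open>B \<ge> 0\<close> that by auto
    then have a: "a > 0" by (simp add: a_def)
    have "\<bar>\<integral>x. U x * V x \<partial>M\<bar> \<le> (a * A + B / a) / 2" by (rule bd[OF a])
    also have "\<dots> \<le> (a * (A + d) + (B + d) / a) / 2"
      using a that by (intro divide_right_mono add_mono mult_left_mono) auto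
    also have "a * (A + d) = a * (sqrt (A + d) * sqrt (A + d))"
      using \<open>A \<ge> 0\<close> that by (subst real_sqrt_mult_self) simp
    also have "\<dots> = sqrt (B + d) * sqrt (A + d)"
      using p unfolding a_def by (simp del: real_sqrt_mult_self add: divide_simps)
    also have "(B + d) / a = (sqrt (B + d) * sqrt (B + d)) / a"
      using \<open>B \<ge> 0\<close> that by (subst real_sqrt_mult_self) simp
    also have "\<dots> = sqrt (B + d) * sqrt (A + d)"
      using p unfolding a_def by (simp del: real_sqrt_mult_self add: divide_simps)
    finally show ?thesis by (simp add: mult.commute)
  qed
  have "((\<lambda>d. sqrt (A + d) * sqrt (B + d)) \<longlongrightarrow> sqrt (A + 0) * sqrt (B + 0)) (at_right 0)"
    by (intro tendsto_intros)
  then have "\<bar>\<integral>x. U x * V x \<partial>M\<bar> \<le> sqrt (A + 0) * sqrt (B + 0)"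
    by (rule tendsto_lowerbound) (use lim0 in \<open>auto intro: eventually_mono[OF eventually_at_right_less[of 0]]\<close>)
  then show "\<bar>\<integral>x. U x * V x \<partial>M\<bar> \<le> sqrt (\<integral>x. (U x)\<^sup>2 \<partial>M) * sqrt (\<integral>x. (V x)\<^sup>2 \<partial>M)"
    by (simp add: A_def B_def)
qed

lemma abs_mult_le_abs_mult: "\<bar>g\<bar> \<le> C \<Longrightarrow> \<bar>Y * g\<bar> \<le> \<bar>C * Y\<bar>" for g C Y :: real
  by (auto simp: abs_mult mult.commute[of "\<bar>Y\<bar>"] intro!: mult_right_mono)

locale stationary_markov =
  fixes M :: "'m measure" and E :: "'a measure" and K :: "real \<Rightarrow> 'a \<Rightarrow> 'a measure"
    and X :: "real \<Rightarrow> 'm \<Rightarrow> 'a" and \<mu> :: "'a measure"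
  assumes markov: "markov_process M E K X"
    and kernel: "t \<ge> 0 \<Longrightarrow> K t \<in> E \<rightarrow>\<^sub>M prob_algebra E"
    and init: "distr M E (X 0) = \<mu>"
    and invariant: "t \<ge> 0 \<Longrightarrow> \<mu> \<bind> K t = \<mu>"
begin

sublocale prob_space M
  using markov by (simp add: markov_process_def)

lemma X_measurable: "t \<ge> 0 \<Longrightarrow> X t \<in> M \<rightarrow>\<^sub>M E"
  using markov by (simp add: markov_process_def)

lemma sets_\<mu> [measurable_cong]: "sets \<mu> = sets E"
  using init[symmetric] by simp

lemma prob_\<mu>: "prob_space \<mu>"
  unfolding init[symmetric] by (rule prob_space_distr) (simp add: X_measurable)

lemma kernel_sub: "t \<ge> 0 \<Longrightarrow> K t \<in> E \<rightarrow>\<^sub>M subprob_algebra E"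
  using kernel by (metis measurable_prob_algebraD)

lemma kernel_prob: "t \<ge> 0 \<Longrightarrow> x \<in> space E \<Longrightarrow> prob_space (K t x)"
  and kernel_sets: "t \<ge> 0 \<Longrightarrow> x \<in> space E \<Longrightarrow> sets (K t x) = sets E"
  using measurable_space[OF kernel] by (auto simp: space_prob_algebra)

lemma subalgebra_past: "subalgebra M (past M E X s)"
proof -
  have "sets (past M E X s) = sigma_sets (space M)
      {X r -` B \<inter> space M | r B. 0 \<le> r \<and> r \<le> s \<and> B \<in> sets E}"
    unfolding past_def by (rule sets_measure_of) auto
  also have "\<dots> \<subseteq> sets M"
    by (rule sets.sigma_sets_subset) (use X_measurable measurable_sets in auto)
  finally show ?thesis by (auto simp: subalgebra_def past_def space_measure_of_conv)
qed

lemma past_measurable: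
  assumes "0 \<le> r" "r \<le> s" and f: "f \<in> borel_measurable E"
  shows "(\<lambda>w. f (X r w)) \<in> borel_measurable (past M E X s)"
proof -
  have "X r \<in> past M E X s \<rightarrow>\<^sub>M E"
    unfolding past_def using assms measurable_space[OF X_measurable]
    by (intro measurableI) (auto simp: space_measure_of_conv intro!: in_measure_of)
  then show ?thesis using f by (rule measurable_compose)
qed

text \<open>The Markov property is given as an almost sure identity of conditional expectations of
  indicators. Testing it against a factor measurable in the past turns it into an identity of
  expectations, the only form used afterwards.\<close>

lemma markov_indicator:
  fixes Y :: "'m \<Rightarrow> real"
  assumes s: "s \<ge> 0" "t \<ge> 0" and B: "B \<in> sets E"
    and Y: "Y \<in> borel_measurable (past M E X s)" "integrable M Y"
  shows "(\<integral>w. Y w * indicator B (X (s + t) w) \<partial>M) = (\<integral>w. Y w * measure (K t (X s w)) B \<partial>M)"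
proof -
  interpret S: finite_measure_subalgebra M "past M E X s"
    by unfold_locales (rule subalgebra_past)
  have [measurable]: "X s \<in> M \<rightarrow>\<^sub>M E" "X (s + t) \<in> M \<rightarrow>\<^sub>M E" using X_measurable s by auto
  have [measurable]: "B \<in> sets E" by (rule B)
  have [measurable]: "K t \<in> E \<rightarrow>\<^sub>M subprob_algebra E" using kernel_sub s by auto
  have Ym[measurable]: "Y \<in> borel_measurable M" using Y(2) by auto
  have m: "(\<lambda>w. indicator B (X (s + t) w) :: real) \<in> borel_measurable M" by measurable
  have i: "integrable M (\<lambda>w. Y w * indicator B (X (s + t) w))"
    by (rule Bochner_Integration.integrable_bound[OF Y(2)]) (auto simp: indicator_def)
  have ae: "AE w in M. real_cond_exp M (past M E X s) (\<lambda>w. indicator B (X (s + t) w)) w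
                   = measure (K t (X s w)) B"
    using markov s B by (simp add: markov_process_def)
  have "(\<integral>w. Y w * indicator B (X (s + t) w) \<partial>M)
    = (\<integral>w. Y w * real_cond_exp M (past M E X s) (\<lambda>w. indicator B (X (s + t) w)) w \<partial>M)"
    using S.real_cond_exp_intg(2)[OF i Y(1) m] by simp
  also have "\<dots> = (\<integral>w. Y w * measure (K t (X s w)) B \<partial>M)"
    by (rule integral_cong_AE) (use ae in auto)
  finally show ?thesis .
qed

lemma kernel_integral_le:
  fixes f :: "'a \<Rightarrow> real"
  assumes "t \<ge> 0" "x \<in> space E" and [measurable]: "f \<in> borel_measurable E" and "\<And>y. y \<in> space E \<Longrightarrow> \<bar>f y\<bar> \<le> B"
  shows "integrable (K t x) f" "\<bar>\<integral>y. f y \<partial>(K t x)\<bar> \<le> B"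
proof -
  interpret P: prob_space "K t x" using kernel_prob assms by auto
  have [measurable_cong]: "sets (K t x) = sets E" using kernel_sets assms by auto
  have sp: "space (K t x) = space E" by (rule sets_eq_imp_space_eq[OF kernel_sets[OF assms(1,2)]])
  show i: "integrable (K t x) f"
    by (rule P.integrable_const_bound[where B=B]) (use assms sp in auto)
  have "\<bar>\<integral>y. f y \<partial>(K t x)\<bar> \<le> (\<integral>y. \<bar>f y\<bar> \<partial>(K t x))" by (rule integral_abs_bound)
  also have "\<dots> \<le> (\<integral>y. B \<partial>(K t x))" by (rule integral_mono) (use i assms sp in auto)
  finally show "\<bar>\<integral>y. f y \<partial>(K t x)\<bar> \<le> B" by (simp add: P.prob_space)
qed

text \<open>Extension from indicators by measure-theoretic induction. \<open>Y\<close> is merely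
  integrable, so a bound on \<open>f\<close> is carried along to dominate by a multiple of
  \<open>Y\<close>; it varies in the induction because scaling changes it to
  \<open>B / c\<close>.\<close>

lemma markov_bounded_nonneg:
  fixes Y :: "'m \<Rightarrow> real" and f :: "'a \<Rightarrow> real"
  assumes s: "s \<ge> 0" "t \<ge> 0"
    and Y: "Y \<in> borel_measurable (past M E X s)" "integrable M Y"
    and f: "f \<in> borel_measurable E" "\<And>x. 0 \<le> f x" and B: "\<And>x. x \<in> space E \<Longrightarrow> f x \<le> B"
  shows "(\<integral>w. Y w * f (X (s + t) w) \<partial>M) = (\<integral>w. Y w * (\<integral>y. f y \<partial>(K t (X s w))) \<partial>M)"
proof -
  have X1[measurable]: "X s \<in> M \<rightarrow>\<^sub>M E" "X (s + t) \<in> M \<rightarrow>\<^sub>M E" using X_measurable s by auto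
  have [measurable]: "K t \<in> E \<rightarrow>\<^sub>M subprob_algebra E" using kernel_sub s by auto
  have [measurable]: "Y \<in> borel_measurable M" using Y(2) by auto
  have Xsp: "X s w \<in> space E" "X (s + t) w \<in> space E" if "w \<in> space M" for w
    using X1[THEN measurable_space] that by auto
  have ksp: "space (K t x) = space E" if "x \<in> space E" for x
    by (rule sets_eq_imp_space_eq[OF kernel_sets[OF s(2) that]])
  have intl: "integrable M (\<lambda>w. Y w * g (X (s + t) w))"
    if [measurable]: "g \<in> borel_measurable E" and "\<And>x. x \<in> space E \<Longrightarrow> \<bar>g x\<bar> \<le> C" for g :: "'a \<Rightarrow> real" and C
    by (rule Bochner_Integration.integrable_bound[where f="\<lambda>w. C * Y w"])
       (use Y(2) that Xsp in \<open>auto intro!: abs_mult_le_abs_mult AE_I2\<close>)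
  have intr: "integrable M (\<lambda>w. Y w * (\<integral>y. g y \<partial>(K t (X s w))))"
    if [measurable]: "g \<in> borel_measurable E" and "\<And>x. x \<in> space E \<Longrightarrow> \<bar>g x\<bar> \<le> C" for g :: "'a \<Rightarrow> real" and C
    by (rule Bochner_Integration.integrable_bound[where f="\<lambda>w. C * Y w"])
       (use Y(2) that Xsp kernel_integral_le(2)[OF s(2) _ that] in
         \<open>auto intro!: abs_mult_le_abs_mult AE_I2\<close>)
  show ?thesis
    using f B
  proof (induction arbitrary: B rule: borel_measurable_induct_real)
    case (set A)
    have "(\<integral>y. indicator A y \<partial>(K t (X s w))) = measure (K t (X s w)) A" if "w \<in> space M" for w
      using ksp[OF Xsp(1)[OF that]] sets.sets_into_space[OF set(1)] by (simp add: Int_absorb2)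
    then show ?case
      using markov_indicator[OF s set(1) Y] by (simp cong: Bochner_Integration.integral_cong)
  next
    case (mult u c)
    show ?case
    proof (cases "c = 0")
      case False
      then have "c > 0" using mult by simp
      then have "u x \<le> B / c" if "x \<in> space E" for x
        using mult.prems[OF that] by (simp add: field_simps)
      from mult.IH[OF this] show ?thesis
        by (simp add: mult.left_commute)
    qed simp
  next
    case (add u v)
    have b: "\<bar>u x\<bar> \<le> B" "\<bar>v x\<bar> \<le> B" if "x \<in> space E" for x
      using add.prems[OF that] add.hyps(2)[of x] add.hyps(4)[of x] by auto
    have e1: "(\<integral>w. Y w * u (X (s + t) w) \<partial>M) = (\<integral>w. Y w * (\<integral>y. u y \<partial>(K t (X s w))) \<partial>M)"
      by (rule add.IH(1)[of B]) (use b in force)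
    have e2: "(\<integral>w. Y w * v (X (s + t) w) \<partial>M) = (\<integral>w. Y w * (\<integral>y. v y \<partial>(K t (X s w))) \<partial>M)"
      by (rule add.IH(2)[of B]) (use b in force)
    have "(\<integral>w. Y w * (v (X (s + t) w) + u (X (s + t) w)) \<partial>M)
        = (\<integral>w. Y w * (\<integral>y. v y \<partial>(K t (X s w))) \<partial>M) + (\<integral>w. Y w * (\<integral>y. u y \<partial>(K t (X s w))) \<partial>M)"
      using intl[OF add.hyps(1) b(1)] intl[OF add.hyps(3) b(2)] e1 e2 by (simp add: distrib_left)
    also have "\<dots> = (\<integral>w. Y w * (\<integral>y. v y \<partial>(K t (X s w))) + Y w * (\<integral>y. u y \<partial>(K t (X s w))) \<partial>M)"
      using intr[OF add.hyps(1) b(1)] intr[OF add.hyps(3) b(2)] by simp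
    also have "\<dots> = (\<integral>w. Y w * (\<integral>y. v y + u y \<partial>(K t (X s w))) \<partial>M)"
      by (rule Bochner_Integration.integral_cong)
         (auto simp: kernel_integral_le(1)[OF s(2) Xsp(1) add.hyps(1) b(1)]
             kernel_integral_le(1)[OF s(2) Xsp(1) add.hyps(3) b(2)] distrib_left)
    finally show ?case .
  next
    case (seq U)
    have Ule: "U i x \<le> f x" if "x \<in> space E" for i x
      using seq.hyps(3)[unfolded incseq_def le_fun_def] seq.hyps(4)[OF that]
      by (intro incseq_le) (auto simp: incseq_def)
    then have b: "\<bar>U i x\<bar> \<le> B" if "x \<in> space E" for i x
      using seq.prems[OF that] seq.hyps(2)[of i x] Ule[OF that, of i] by simp
    note [measurable] = seq.hyps(1) f(1)
    have fb: "\<bar>f x\<bar> \<le> B" if "x \<in> space E" for x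
      using seq.prems[OF that] f(2)[of x] by auto
    have l: "(\<lambda>i. \<integral>w. Y w * U i (X (s + t) w) \<partial>M) \<longlonglongrightarrow> (\<integral>w. Y w * f (X (s + t) w) \<partial>M)"
    proof (rule integral_dominated_convergence[where w="\<lambda>w. \<bar>B * Y w\<bar>"])
      show "AE w in M. (\<lambda>i. Y w * U i (X (s + t) w)) \<longlonglongrightarrow> Y w * f (X (s + t) w)"
        by (intro AE_I2 tendsto_intros seq.hyps(4) Xsp)
      show "AE w in M. norm (Y w * U i (X (s + t) w)) \<le> \<bar>B * Y w\<bar>" for i
        unfolding real_norm_def by (intro AE_I2 abs_mult_le_abs_mult b Xsp)
    qed (use Y(2) in auto)
    have k: "(\<lambda>i. \<integral>y. U i y \<partial>(K t x)) \<longlonglongrightarrow> (\<integral>y. f y \<partial>(K t x))" if x: "x \<in> space E" for x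
    proof (rule integral_dominated_convergence[where w="\<lambda>_. B"])
      have "borel_measurable (K t x) = (borel_measurable E :: ('a \<Rightarrow> real) set)"
        by (rule measurable_cong_sets) (use kernel_sets s x in auto)
      then show "f \<in> borel_measurable (K t x)" "\<And>i. U i \<in> borel_measurable (K t x)"
        using seq.hyps(1) f(1) by auto
      interpret P: prob_space "K t x" using kernel_prob s x by auto
      show "integrable (K t x) (\<lambda>_. B)" by simp
      show "AE y in K t x. (\<lambda>i. U i y) \<longlonglongrightarrow> f y"
        by (intro AE_I2 seq.hyps(4)) (simp add: ksp[OF x])
      show "AE y in K t x. norm (U i y) \<le> B" for i
        by (intro AE_I2) (simp add: ksp[OF x] b)
    qed
    have r: "(\<lambda>i. \<integral>w. Y w * (\<integral>y. U i y \<partial>(K t (X s w))) \<partial>M) \<longlonglongrightarrow> (\<integral>w. Y w * (\<integral>y. f y \<partial>(K t (X s w))) \<partial>M)"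
    proof (rule integral_dominated_convergence[where w="\<lambda>w. \<bar>B * Y w\<bar>"])
      show "AE w in M. (\<lambda>i. Y w * (\<integral>y. U i y \<partial>(K t (X s w)))) \<longlonglongrightarrow> Y w * (\<integral>y. f y \<partial>(K t (X s w)))"
        by (intro AE_I2 tendsto_intros k Xsp)
      show "AE w in M. norm (Y w * (\<integral>y. U i y \<partial>(K t (X s w)))) \<le> \<bar>B * Y w\<bar>" for i
        unfolding real_norm_def
        by (intro AE_I2 abs_mult_le_abs_mult kernel_integral_le(2)[OF s(2) Xsp(1) seq.hyps(1) b])
    qed (use Y(2) in auto)
    have "(\<integral>w. Y w * U i (X (s + t) w) \<partial>M) = (\<integral>w. Y w * (\<integral>y. U i y \<partial>(K t (X s w))) \<partial>M)" for i
      by (rule seq.IH[of _ B]) (rule abs_le_D1[OF b])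
    with l r show ?case by (simp add: LIMSEQ_unique)
  qed
qed

text \<open>Adding \<open>B\<close> makes \<open>f\<close> nonnegative, and the constant passes
  through the kernel because \<open>K t x\<close> is a probability measure.\<close>

lemma markov_bounded:
  fixes Y :: "'m \<Rightarrow> real" and f :: "'a \<Rightarrow> real"
  assumes s: "s \<ge> 0" "t \<ge> 0"
    and Y: "Y \<in> borel_measurable (past M E X s)" "integrable M Y"
    and f[measurable]: "f \<in> borel_measurable E" and B: "\<And>x. \<bar>f x\<bar> \<le> B"
  shows "(\<integral>w. Y w * f (X (s + t) w) \<partial>M) = (\<integral>w. Y w * (\<integral>y. f y \<partial>(K t (X s w))) \<partial>M)"
proof -
  have X1[measurable]: "X s \<in> M \<rightarrow>\<^sub>M E" "X (s + t) \<in> M \<rightarrow>\<^sub>M E" using X_measurable s by auto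
  have [measurable]: "K t \<in> E \<rightarrow>\<^sub>M subprob_algebra E" using kernel_sub s by auto
  have [measurable]: "Y \<in> borel_measurable M" using Y(2) by auto
  have Xsp: "X s w \<in> space E" "X (s + t) w \<in> space E" if "w \<in> space M" for w
    using X1[THEN measurable_space] that by auto
  have "0 \<le> f x + B" for x using B[of x] by linarith
  moreover have "f x + B \<le> 2 * B" for x using B[of x] by linarith
  ultimately have *: "(\<integral>w. Y w * (f (X (s + t) w) + B) \<partial>M) = (\<integral>w. Y w * (\<integral>y. f y + B \<partial>(K t (X s w))) \<partial>M)"
    using markov_bounded_nonneg[OF s Y, of "\<lambda>x. f x + B" "2 * B"] by simp
  have i1: "integrable M (\<lambda>w. Y w * f (X (s + t) w))"
    by (rule Bochner_Integration.integrable_bound[where f="\<lambda>w. B * Y w"])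
       (use Y(2) B in \<open>auto intro!: abs_mult_le_abs_mult AE_I2\<close>)
  have i2: "integrable M (\<lambda>w. Y w * (\<integral>y. f y \<partial>(K t (X s w))))"
    by (rule Bochner_Integration.integrable_bound[where f="\<lambda>w. B * Y w"])
       (use Y(2) B Xsp kernel_integral_le(2)[OF s(2) _ f B] in
         \<open>auto intro!: abs_mult_le_abs_mult AE_I2\<close>)
  have c: "(\<integral>y. f y + B \<partial>(K t x)) = (\<integral>y. f y \<partial>(K t x)) + B" if "x \<in> space E" for x
  proof -
    interpret P: prob_space "K t x" using kernel_prob s that by auto
    show ?thesis using kernel_integral_le(1)[OF s(2) that f B] by (simp add: P.prob_space)
  qed
  have "(\<integral>w. Y w * f (X (s + t) w) \<partial>M) + (\<integral>w. Y w * B \<partial>M) = (\<integral>w. Y w * (f (X (s + t) w) + B) \<partial>M)"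
    using i1 Y(2) by (simp add: distrib_left)
  also have "\<dots> = (\<integral>w. Y w * (\<integral>y. f y \<partial>(K t (X s w))) + Y w * B \<partial>M)"
    unfolding * by (rule Bochner_Integration.integral_cong) (auto simp: c Xsp distrib_left)
  also have "\<dots> = (\<integral>w. Y w * (\<integral>y. f y \<partial>(K t (X s w))) \<partial>M) + (\<integral>w. Y w * B \<partial>M)"
    using i2 Y(2) by simp
  finally show ?thesis by simp
qed

text \<open>The Markov identity from time 0 with the trivial factor 1 expresses the law at time
  \<open>t\<close> as the initial law pushed through \<open>K t\<close>, and the initial law is
  invariant.\<close>

lemma distr_X:
  assumes t: "t \<ge> 0"
  shows "distr M E (X t) = \<mu>"
proof (rule measure_eqI)
  fix A assume "A \<in> sets (distr M E (X t))"
  then have A[measurable]: "A \<in> sets E" by simp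
  have X0[measurable]: "X 0 \<in> M \<rightarrow>\<^sub>M E" "X t \<in> M \<rightarrow>\<^sub>M E" using X_measurable t by auto
  have K[measurable]: "K t \<in> E \<rightarrow>\<^sub>M subprob_algebra E" using kernel_sub t by auto
  interpret mu: prob_space \<mu> by (rule prob_\<mu>)
  have "measure (distr M E (X t)) A = (\<integral>w. indicator A (X t w) \<partial>M)"
  proof -
    have "(\<integral>w. indicator A (X t w) \<partial>M) = (\<integral>x. indicator A x \<partial>distr M E (X t) :: real)"
      by (rule integral_distr[symmetric]) auto
    also have "\<dots> = measure (distr M E (X t)) (A \<inter> space (distr M E (X t)))" by simp
    also have "A \<inter> space (distr M E (X t)) = A" using sets.sets_into_space[OF A] by auto
    finally show ?thesis by (rule sym)
  qed
  also have "\<dots> = (\<integral>w. measure (K t (X 0 w)) A \<partial>M)"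
  proof -
    have "(\<integral>w. 1 * indicator A (X (0 + t) w) \<partial>M) = (\<integral>w. 1 * measure (K t (X 0 w)) A \<partial>M)"
      by (rule markov_indicator) (use t A in auto)
    then show ?thesis by (simp only: mult_1_left add_0_left)
  qed
  also have "\<dots> = (\<integral>x. measure (K t x) A \<partial>\<mu>)"
  proof -
    have "(\<integral>x. measure (K t x) A \<partial>distr M E (X 0)) = (\<integral>w. measure (K t (X 0 w)) A \<partial>M)"
      by (rule integral_distr) measurable
    then show ?thesis unfolding init by (rule sym)
  qed
  also have "\<dots> = measure (\<mu> \<bind> K t) A"
  proof -
    have "K t \<in> \<mu> \<rightarrow>\<^sub>M subprob_algebra E" using K by measurable
    then show ?thesis
      by (rule subprob_space.measure_bind[OF prob_space_imp_subprob_space[OF prob_\<mu>] _ A, symmetric])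
  qed
  finally have "measure (distr M E (X t)) A = measure (\<mu> \<bind> K t) A" .
  also have "\<mu> \<bind> K t = \<mu>" by (rule invariant[OF t])
  finally have "measure (distr M E (X t)) A = measure \<mu> A" .
  note eq = this
  interpret D: prob_space "distr M E (X t)" by (rule prob_space_distr) simp
  show "emeasure (distr M E (X t)) A = emeasure \<mu> A"
    by (simp only: D.emeasure_eq_measure mu.emeasure_eq_measure eq)
qed (simp only: sets_distr sets_\<mu>)

end

section \<open>Derivatives from difference quotients controlled uniformly in time\<close>

lemma telescoping_step_bound:
  fixes D :: "real \<Rightarrow> real"
  assumes T: "T \<ge> 0" and N: "N > 0"
    and step: "\<And>t. t \<ge> 0 \<Longrightarrow> t < T \<Longrightarrow> \<bar>D (t + T / real N) - D t\<bar> \<le> T / real N * a"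
  shows "\<bar>D T - D 0\<bar> \<le> T * a"
proof (cases "T = 0")
  case False
  then have T: "T > 0" using T by simp
  have "\<bar>D (real j * (T / real N)) - D 0\<bar> \<le> real j * (T / real N * a)" if "j \<le> N" for j
    using that
  proof (induction j)
    case (Suc j)
    have "real j * (T / real N) < T" using Suc.prems T by (simp add: field_simps)
    moreover have "real j * (T / real N) \<ge> 0" using T by simp
    ultimately have "\<bar>D (real j * (T / real N) + T / real N) - D (real j * (T / real N))\<bar> \<le> T / real N * a"
      using step by blast
    moreover have "real j * (T / real N) + T / real N = real (Suc j) * (T / real N)"
      by (simp add: algebra_simps add_divide_distrib)
    ultimately have "\<bar>D (real (Suc j) * (T / real N)) - D (real j * (T / real N))\<bar> \<le> T / real N * a" by metis
    moreover have "real (Suc j) * (T / real N * a) = real j * (T / real N * a) + T / real N * a"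
      unfolding of_nat_Suc distrib_right mult_1_left by (rule add.commute)
    ultimately show ?case using Suc by linarith
  qed simp
  from this[of N] show ?thesis using N by simp
qed simp

text \<open>A right derivative alone controls nothing to the left. Since the error is uniform in the
  base point, the estimate can be started from the smaller of two times, which gives a Lipschitz
  bound on short intervals in both directions.\<close>

lemma uniform_right_derivative_continuous:
  fixes m g \<rho> :: "real \<Rightarrow> real"
  assumes step: "\<And>t h. t \<ge> 0 \<Longrightarrow> h > 0 \<Longrightarrow> \<bar>m (t + h) - m t - h * g t\<bar> \<le> h * \<rho> h"
    and \<rho>: "(\<rho> \<longlongrightarrow> 0) (at_right 0)"
    and g: "\<And>t. t \<ge> 0 \<Longrightarrow> \<bar>g t\<bar> \<le> C"
  shows "continuous_on {0..} m"
proof -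
  from order_tendstoD(2)[OF \<rho>, of 1] obtain d where d: "d > 0" "\<And>h. h > 0 \<Longrightarrow> h < d \<Longrightarrow> \<rho> h < 1"
    unfolding eventually_at_right_field by auto
  have C: "C \<ge> 0" using g[of 0] by linarith
  have lip: "\<bar>m t - m s\<bar> \<le> (C + 1) * (t - s)" if "s \<ge> 0" "s < t" "t - s < d" for s t
  proof -
    have "\<bar>m t - m s - (t - s) * g s\<bar> \<le> (t - s) * \<rho> (t - s)" using step[of s "t - s"] that by simp
    also have "\<dots> \<le> (t - s) * 1" using that d(2)[of "t - s"] by (intro mult_left_mono) auto
    finally have 1: "\<bar>m t - m s - (t - s) * g s\<bar> \<le> (t - s)" by simp
    have "\<bar>(t - s) * g s\<bar> \<le> (t - s) * C"
      using that g[of s] by (simp add: abs_mult mult_left_mono)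
    with 1 show ?thesis by (simp add: algebra_simps)
  qed
  have lip2: "\<bar>m t - m s\<bar> \<le> (C + 1) * \<bar>t - s\<bar>" if "s \<ge> 0" "t \<ge> 0" "\<bar>t - s\<bar> < d" for s t
    using lip[of s t] lip[of t s] that by (cases s t rule: linorder_cases) (auto simp: abs_if split: if_splits)
  show ?thesis
    unfolding continuous_on_iff dist_real_def
  proof (intro ballI allI impI)
    fix s e :: real assume s: "s \<in> {0..}" and e: "e > 0"
    show "\<exists>d>0. \<forall>t\<in>{0..}. \<bar>t - s\<bar> < d \<longrightarrow> \<bar>m t - m s\<bar> < e"
    proof (intro exI[of _ "min d (e / (C + 1))"] conjI ballI impI)
      fix t assume t: "t \<in> {0..}" "\<bar>t - s\<bar> < min d (e / (C + 1))"
      then have "(C + 1) * \<bar>t - s\<bar> < e" using C by (simp add: field_simps)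
      then show "\<bar>m t - m s\<bar> < e" using lip2[of s t] s t by auto
    qed (use d C e in auto)
  qed
qed

text \<open>The rates \<open>\<rho> n\<close> need not be uniform in \<open>n\<close>, so derivative
  and limit cannot be interchanged directly. Instead \<open>n\<close> is fixed first and the step
  size chosen afterwards; summing the steps yields the integral equation for \<open>m\<close>, which
  is differentiated using the continuity of \<open>g\<close>.\<close>

lemma has_derivative_of_approximations:
  fixes m g :: "real \<Rightarrow> real" and mR gR \<rho> :: "nat \<Rightarrow> real \<Rightarrow> real"
  assumes um: "uniform_limit {0..} mR m sequentially"
    and ug: "uniform_limit {0..} gR g sequentially"
    and step: "\<And>n t h. t \<ge> 0 \<Longrightarrow> h > 0 \<Longrightarrow> \<bar>mR n (t + h) - mR n t - h * gR n t\<bar> \<le> h * \<rho> n h"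
    and \<rho>: "\<And>n. (\<rho> n \<longlongrightarrow> 0) (at_right 0)"
    and g: "continuous_on {0..} g"
    and t: "t \<ge> 0"
  shows "(m has_real_derivative g t) (at t within {0..})"
proof -
  have gi: "g integrable_on {a..b}" if "0 \<le> a" for a b
    by (rule integrable_continuous_interval) (use that g in \<open>auto intro: continuous_on_subset\<close>)
  define G where "G = (\<lambda>T. integral {0..T} g)"
  have eq: "m T - m 0 = G T" if T: "T \<ge> 0" for T
  proof -
    \<comment> \<open>\<open>2 * e\<close> is the cost of replacing \<open>m\<close> by its
      approximation at both ends. Per unit time three errors \<open>e\<close> accumulate: the
      remainder \<open>\<rho>\<close>, the replacement of \<open>gR n\<close> by \<open>g\<close>,
      and the variation of \<open>g\<close> within one step.\<close>
    have "\<bar>m T - m 0 - G T\<bar> \<le> (2 + 3 * T) * e" if e: "e > 0" for e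
    proof -
      from uniform_limitD[OF um e] uniform_limitD[OF ug e]
      have "eventually (\<lambda>n. (\<forall>x\<in>{0..}. dist (mR n x) (m x) < e) \<and> (\<forall>x\<in>{0..}. dist (gR n x) (g x) < e)) sequentially"
        by eventually_elim simp
      then obtain n where n: "\<And>x. x \<ge> 0 \<Longrightarrow> \<bar>mR n x - m x\<bar> < e" "\<And>x. x \<ge> 0 \<Longrightarrow> \<bar>gR n x - g x\<bar> < e"
        by (auto simp: eventually_sequentially dist_real_def)
      from order_tendstoD(2)[OF \<rho>[of n] e] obtain d1 where d1: "d1 > 0" "\<And>h. h > 0 \<Longrightarrow> h < d1 \<Longrightarrow> \<rho> n h < e"
        unfolding eventually_at_right_field by auto
      have "uniformly_continuous_on {0..T + 1} g"
        by (rule compact_uniformly_continuous) (use g in \<open>auto intro: continuous_on_subset\<close>)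
      then obtain d2 where d2: "d2 > 0" "\<And>x y. x \<in> {0..T + 1} \<Longrightarrow> y \<in> {0..T + 1} \<Longrightarrow> \<bar>y - x\<bar> < d2 \<Longrightarrow> \<bar>g y - g x\<bar> < e"
        unfolding uniformly_continuous_on_def dist_real_def using e by metis
      \<comment> \<open>The cap 1 on the step keeps \<open>s + h\<close> inside the interval up to
        \<open>T + 1\<close> on which uniform continuity of \<open>g\<close> was taken.\<close>
      obtain N :: nat where N: "T / min (min d1 d2) 1 < real N" using reals_Archimedean2 by blast
      have mpos: "min (min d1 d2) 1 > 0" using d1 d2 by simp
      have N0: "N > 0" using N T mpos by (metis divide_nonneg_pos gr0I leD of_nat_0)
      define h where "h = T / real N"
      have h: "h < d1" "h < d2" "h < 1" "h \<ge> 0"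
      proof -
        have "T < real N * min (min d1 d2) 1" using N mpos by (simp add: pos_divide_less_eq)
        moreover have "real N * min (min d1 d2) 1 \<le> real N * d" if "min (min d1 d2) 1 \<le> d" for d
          using that by (rule mult_left_mono) simp
        ultimately have "T < real N * d" if "min (min d1 d2) 1 \<le> d" for d
          using that by (meson less_le_trans)
        then have "T / real N < d" if "min (min d1 d2) 1 \<le> d" for d
          using N0 that by (simp add: pos_divide_less_eq mult.commute)
        then show "h < d1" "h < d2" "h < 1" unfolding h_def by auto
        show "h \<ge> 0" using T by (simp add: h_def)
      qed
      have Dstep: "\<bar>(mR n (s + h) - G (s + h)) - (mR n s - G s)\<bar> \<le> h * (3 * e)" if s: "s \<ge> 0" "s < T" for s
      proof -
        have hp: "h > 0" using s N0 by (simp add: h_def)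
        have "G (s + h) = G s + integral {s..s + h} g"
          unfolding G_def using Henstock_Kurzweil_Integration.integral_combine[of 0 s "s + h" g] s hp gi[of 0] by simp
        moreover have "\<bar>integral {s..s + h} g - h * g s\<bar> \<le> e * h"
        proof -
          have "integral {s..s + h} g - h * g s = integral {s..s + h} (\<lambda>x. g x - g s)"
            using gi[OF s(1)] hp by (subst integral_diff) auto
          moreover have "norm (integral {s..s + h} (\<lambda>x. g x - g s)) \<le> e * (s + h - s)"
          proof (rule integral_bound)
            show "continuous_on {s..s + h} (\<lambda>x. g x - g s)"
              using g s by (intro continuous_intros) (auto intro: continuous_on_subset)
            show "norm (g x - g s) \<le> e" if "x \<in> {s..s + h}" for x
              using d2(2)[of s x] that s h hp by (auto intro!: less_imp_le)
          qed (use hp in simp)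
          ultimately show ?thesis by simp
        qed
        moreover have "\<bar>mR n (s + h) - mR n s - h * gR n s\<bar> \<le> h * e"
          using step[of s h n] s hp d1(2)[OF hp h(1)] mult_left_mono[of "\<rho> n h" e h] by linarith
        moreover have "\<bar>h * gR n s - h * g s\<bar> \<le> h * e"
          using n(2)[OF s(1)] hp by (simp add: right_diff_distrib[symmetric] abs_mult)
        ultimately show ?thesis by (simp add: algebra_simps)
      qed
      have "\<bar>(mR n T - G T) - (mR n 0 - G 0)\<bar> \<le> T * (3 * e)"
        by (rule telescoping_step_bound[OF T N0]) (use Dstep in \<open>simp add: h_def\<close>)
      moreover have "G 0 = 0" by (simp add: G_def)
      ultimately show ?thesis using n(1)[of T] n(1)[of 0] T by (simp add: algebra_simps)
    qed note bd = this
    have "\<bar>m T - m 0 - G T\<bar> \<le> 0"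
    proof (rule field_le_epsilon)
      fix e :: real assume "e > 0"
      then show "\<bar>m T - m 0 - G T\<bar> \<le> 0 + e"
        using bd[of "e / (2 + 3 * T)"] T by simp
    qed
    then show ?thesis by simp
  qed
  have "(G has_real_derivative g t) (at t within {0..t + 1})"
    unfolding G_def by (rule integral_has_real_derivative) (use g t in \<open>auto intro: continuous_on_subset\<close>)
  then have "((\<lambda>T. G T + m 0) has_real_derivative g t) (at t within {0..t + 1})"
    by (auto intro!: derivative_eq_intros)
  then have "(m has_real_derivative g t) (at t within {0..t + 1})"
    by (rule has_field_derivative_transform_within[where d=1]) (use t in \<open>auto simp: eq[symmetric]\<close>)
  moreover have "at t within {0..t + 1} = at t within {0..}"
    by (rule at_within_nhd[of t "{..<t + 1}"]) auto
  ultimately show ?thesis by simp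
qed

section \<open>Square-integrable observables and their time correlations\<close>

definition square_integrable :: "'a measure \<Rightarrow> ('a \<Rightarrow> real) \<Rightarrow> bool" where
  "square_integrable M f \<longleftrightarrow> f \<in> borel_measurable M \<and> integrable M (\<lambda>x. (f x)\<^sup>2)"

lemma square_integrable_bound:
  assumes "square_integrable M g" "f \<in> borel_measurable M" "\<And>x. \<bar>f x\<bar> \<le> \<bar>g x\<bar>"
  shows "square_integrable M f"
  using assms unfolding square_integrable_def
  by (auto intro!: Bochner_Integration.integrable_bound[where f="\<lambda>x. (g x)\<^sup>2"] simp: abs_le_square_iff)

lemma square_integrable_cmult: "square_integrable M f \<Longrightarrow> square_integrable M (\<lambda>x. c * f x)"
  by (auto simp: square_integrable_def power_mult_distrib)

lemma square_integrable_add: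
  assumes "square_integrable M f" "square_integrable M g"
  shows "square_integrable M (\<lambda>x. f x + g x)"
proof -
  have "integrable M (\<lambda>x. (f x + g x)\<^sup>2)"
  proof (rule Bochner_Integration.integrable_bound[where f="\<lambda>x. 2 * (f x)\<^sup>2 + 2 * (g x)\<^sup>2"])
    have "(a + b)\<^sup>2 \<le> 2 * a\<^sup>2 + 2 * b\<^sup>2" for a b :: real
      using zero_le_power2[of "a - b"] by (simp add: power2_eq_square algebra_simps)
    then show "AE x in M. norm ((f x + g x)\<^sup>2) \<le> norm (2 * (f x)\<^sup>2 + 2 * (g x)\<^sup>2)"
      by (intro AE_I2) simp
  qed (use assms in \<open>auto simp: square_integrable_def\<close>)
  then show ?thesis using assms by (auto simp: square_integrable_def)
qed

lemma square_integrable_diff: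
  "square_integrable M f \<Longrightarrow> square_integrable M g \<Longrightarrow> square_integrable M (\<lambda>x. f x - g x)"
  using square_integrable_add[of M f "\<lambda>x. - 1 * g x"] square_integrable_cmult[of M g "-1"] by simp

lemma square_integrable_sum:
  "(\<And>i. i \<in> I \<Longrightarrow> square_integrable M (f i)) \<Longrightarrow> square_integrable M (\<lambda>x. \<Sum>i\<in>I. f i x)"
proof (induction I rule: infinite_finite_induct)
  case (insert i I)
  then show ?case using square_integrable_add[of M "f i" "\<lambda>x. \<Sum>i\<in>I. f i x"] by simp
qed (auto simp: square_integrable_def)

context stationary_markov
begin

definition corr :: "('a \<Rightarrow> real) \<Rightarrow> ('a \<Rightarrow> real) \<Rightarrow> real \<Rightarrow> real" where
  "corr \<eta> f t = (\<integral>w. \<eta> (X 0 w) * f (X t w) \<partial>M)"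

lemma square_integrable_X:
  assumes "t \<ge> 0" "square_integrable \<mu> f"
  shows "square_integrable M (\<lambda>w. f (X t w))" "(\<integral>w. (f (X t w))\<^sup>2 \<partial>M) = (\<integral>x. (f x)\<^sup>2 \<partial>\<mu>)"
proof -
  have m[measurable]: "f \<in> borel_measurable E" "X t \<in> M \<rightarrow>\<^sub>M E"
    using assms X_measurable by (auto simp: square_integrable_def measurable_cong_sets[OF sets_\<mu> refl])
  show "square_integrable M (\<lambda>w. f (X t w))" "(\<integral>w. (f (X t w))\<^sup>2 \<partial>M) = (\<integral>x. (f x)\<^sup>2 \<partial>\<mu>)"
    using assms(2) unfolding distr_X[OF assms(1), symmetric] square_integrable_def
    by (auto simp: integrable_distr_eq integral_distr)
qed

lemma integrable_corr:
  assumes "t \<ge> 0" "square_integrable \<mu> \<eta>" "square_integrable \<mu> f"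
  shows "integrable M (\<lambda>w. \<eta> (X 0 w) * f (X t w))"
  using square_integrable_X[of 0 \<eta>] square_integrable_X[of t f] assms
  by (intro integral_mult_le_sqrt) (auto simp: square_integrable_def)

lemma corr_le:
  assumes "t \<ge> 0" "square_integrable \<mu> \<eta>" "square_integrable \<mu> f"
  shows "\<bar>corr \<eta> f t\<bar> \<le> sqrt (\<integral>x. (\<eta> x)\<^sup>2 \<partial>\<mu>) * sqrt (\<integral>x. (f x)\<^sup>2 \<partial>\<mu>)"
  unfolding corr_def
  using integral_mult_le_sqrt(2)[of "\<lambda>w. \<eta> (X 0 w)" M "\<lambda>w. f (X t w)"] square_integrable_X[of 0 \<eta>] square_integrable_X[of t f] assms
  by (simp add: square_integrable_def)

lemma corr_add:
  assumes "t \<ge> 0" "square_integrable \<mu> \<eta>" "square_integrable \<mu> f" "square_integrable \<mu> g"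
  shows "corr \<eta> (\<lambda>x. f x + g x) t = corr \<eta> f t + corr \<eta> g t"
  using integrable_corr[OF assms(1,2,3)] integrable_corr[OF assms(1,2,4)]
  by (simp add: corr_def distrib_left)

lemma corr_cmult: "corr \<eta> (\<lambda>x. c * f x) t = c * corr \<eta> f t"
  by (simp add: corr_def mult.left_commute)

lemma corr_diff:
  assumes "t \<ge> 0" "square_integrable \<mu> \<eta>" "square_integrable \<mu> f" "square_integrable \<mu> g"
  shows "corr \<eta> (\<lambda>x. f x - g x) t = corr \<eta> f t - corr \<eta> g t"
  using integrable_corr[OF assms(1,2,3)] integrable_corr[OF assms(1,2,4)]
  by (simp add: corr_def right_diff_distrib)

lemma corr_sum:
  assumes "t \<ge> 0" "square_integrable \<mu> \<eta>" "\<And>i. i \<in> I \<Longrightarrow> square_integrable \<mu> (f i)"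
  shows "corr \<eta> (\<lambda>x. \<Sum>i\<in>I. f i x) t = (\<Sum>i\<in>I. corr \<eta> (f i) t)"
  using integrable_corr[OF assms(1,2,3)]
  by (simp add: corr_def sum_distrib_left)

text \<open>Stationarity gives the uniformity in time: the error is bounded by the norm of
  \<open>f n - l\<close> under \<open>\<mu>\<close>, which does not involve
  \<open>t\<close>.\<close>

lemma uniform_limit_corr:
  fixes f :: "nat \<Rightarrow> 'a \<Rightarrow> real"
  assumes \<eta>: "square_integrable \<mu> \<eta>" and f: "\<And>n. f n \<in> borel_measurable \<mu>"
    and g: "square_integrable \<mu> g" and bd: "\<And>n x. \<bar>f n x\<bar> \<le> \<bar>g x\<bar>"
    and lim: "\<And>x. (\<lambda>n. f n x) \<longlonglongrightarrow> l x"
  shows "square_integrable \<mu> l" "uniform_limit {0..} (\<lambda>n. corr \<eta> (f n)) (corr \<eta> l) sequentially"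
proof -
  have fs: "square_integrable \<mu> (f n)" for n
    by (rule square_integrable_bound[OF g f bd])
  have lm: "l \<in> borel_measurable \<mu>"
    by (rule borel_measurable_LIMSEQ_real[where u=f]) (use lim f in auto)
  have lbd: "\<bar>l x\<bar> \<le> \<bar>g x\<bar>" for x
    using lim[of x] by (intro tendsto_upperbound[OF tendsto_rabs]) (auto simp: bd)
  show l: "square_integrable \<mu> l"
    by (rule square_integrable_bound[OF g lm lbd])
  have "(\<lambda>n. \<integral>x. (f n x - l x)\<^sup>2 \<partial>\<mu>) \<longlonglongrightarrow> (\<integral>x. 0 \<partial>\<mu>)"
  proof (rule integral_dominated_convergence[where w="\<lambda>x. 4 * (g x)\<^sup>2"])
    show "AE x in \<mu>. (\<lambda>n. (f n x - l x)\<^sup>2) \<longlonglongrightarrow> 0"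
    proof (rule AE_I2)
      fix x
      show "(\<lambda>n. (f n x - l x)\<^sup>2) \<longlonglongrightarrow> 0"
        using tendsto_power[OF tendsto_diff[OF lim[of x] tendsto_const[of "l x"]], of 2] by simp
    qed
    show "AE x in \<mu>. norm ((f n x - l x)\<^sup>2) \<le> 4 * (g x)\<^sup>2" for n
    proof (rule AE_I2)
      fix x
      have "\<bar>f n x - l x\<bar> \<le> \<bar>2 * g x\<bar>" using bd[of n x] lbd[of x] by linarith
      then have "(f n x - l x)\<^sup>2 \<le> (2 * g x)\<^sup>2" by (simp only: abs_le_square_iff)
      then show "norm ((f n x - l x)\<^sup>2) \<le> 4 * (g x)\<^sup>2" by (simp add: power_mult_distrib)
    qed
  qed (use f lm g in \<open>auto simp: square_integrable_def\<close>)
  then have "(\<lambda>n. sqrt (\<integral>x. (\<eta> x)\<^sup>2 \<partial>\<mu>) * sqrt (\<integral>x. (f n x - l x)\<^sup>2 \<partial>\<mu>)) \<longlonglongrightarrow> sqrt (\<integral>x. (\<eta> x)\<^sup>2 \<partial>\<mu>) * sqrt 0"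
    by (intro tendsto_intros) simp
  then have e: "(\<lambda>n. sqrt (\<integral>x. (\<eta> x)\<^sup>2 \<partial>\<mu>) * sqrt (\<integral>x. (f n x - l x)\<^sup>2 \<partial>\<mu>)) \<longlonglongrightarrow> 0" by simp
  show "uniform_limit {0..} (\<lambda>n. corr \<eta> (f n)) (corr \<eta> l) sequentially"
  proof (rule uniform_limitI)
    fix d :: real assume "d > 0"
    from order_tendstoD(2)[OF e this]
    show "\<forall>\<^sub>F n in sequentially. \<forall>t\<in>{0..}. dist (corr \<eta> (f n) t) (corr \<eta> l t) < d"
    proof (eventually_elim, intro ballI)
      fix n and t :: real
      assume b: "sqrt (\<integral>x. (\<eta> x)\<^sup>2 \<partial>\<mu>) * sqrt (\<integral>x. (f n x - l x)\<^sup>2 \<partial>\<mu>) < d" and t: "t \<in> {0..}"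
      have "corr \<eta> (f n) t - corr \<eta> l t = corr \<eta> (\<lambda>x. f n x - l x) t"
        using corr_diff[OF _ \<eta> fs l] t by simp
      then show "dist (corr \<eta> (f n) t) (corr \<eta> l t) < d"
        using corr_le[OF _ \<eta> square_integrable_diff[OF fs l], of t n] b t by (simp add: dist_real_def)
    qed
  qed
qed

text \<open>The Markov property at time \<open>t\<close> moves the remainder of the semigroup
  derivative from time 0 to time \<open>t\<close>. Because the law at time \<open>t\<close> is still
  \<open>\<mu>\<close>, its norm is the same for all \<open>t\<close>, and one rate
  \<open>\<rho>\<close> serves every base point.\<close>

lemma corr_step:
  assumes \<eta>: "square_integrable \<mu> \<eta>"
    and \<phi>[measurable]: "\<phi> \<in> borel_measurable E" and bd: "\<And>x. \<bar>\<phi> x\<bar> \<le> B"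
    and \<psi>: "square_integrable \<mu> \<psi>"
    and lim: "((\<lambda>t. \<integral>\<^sup>+x. ennreal ((((\<integral>y. \<phi> y \<partial>(K t x)) - \<phi> x) / t - \<psi> x)\<^sup>2) \<partial>\<mu>) \<longlongrightarrow> 0) (at_right 0)"
  shows "\<exists>\<rho>. (\<rho> \<longlongrightarrow> 0) (at_right 0) \<and>
    (\<forall>t\<ge>0. \<forall>h>0. \<bar>corr \<eta> \<phi> (t + h) - corr \<eta> \<phi> t - h * corr \<eta> \<psi> t\<bar> \<le> h * \<rho> h)"
proof -
  interpret mu: prob_space \<mu> by (rule prob_\<mu>)
  have spE: "space \<mu> = space E" by (rule sets_eq_imp_space_eq[OF sets_\<mu>])
  have meq: "borel_measurable \<mu> = (borel_measurable E :: ('a \<Rightarrow> real) set)"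
    by (rule measurable_cong_sets[OF sets_\<mu> refl])
  define Q where "Q h x = (\<integral>y. \<phi> y \<partial>(K h x))" for h x
  have Qm: "Q h \<in> borel_measurable E" if "h \<ge> 0" for h
  proof -
    have [measurable]: "K h \<in> E \<rightarrow>\<^sub>M subprob_algebra E" by (rule kernel_sub[OF that])
    show ?thesis unfolding Q_def by measurable
  qed
  have Qb: "\<bar>Q h x\<bar> \<le> B" if "h \<ge> 0" "x \<in> space E" for h x
    unfolding Q_def by (rule kernel_integral_le(2)[OF that \<phi> bd])
  have bounded_sq: "square_integrable \<mu> u" if "u \<in> borel_measurable E" "\<And>x. x \<in> space E \<Longrightarrow> \<bar>u x\<bar> \<le> B" for u
    unfolding square_integrable_def
  proof
    show m: "u \<in> borel_measurable \<mu>" using that meq by simp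
    show "integrable \<mu> (\<lambda>x. (u x)\<^sup>2)"
    proof (rule mu.integrable_const_bound[where B="B\<^sup>2"])
      show "AE x in \<mu>. norm ((u x)\<^sup>2) \<le> B\<^sup>2"
        using that(2) spE by (auto intro!: AE_I2 abs_le_square_iff[THEN iffD1] order_trans[OF that(2) abs_ge_self])
    qed (use m in simp)
  qed
  have \<phi>s: "square_integrable \<mu> \<phi>" by (rule bounded_sq[OF \<phi>]) (use bd in auto)
  define R where "R h x = (Q h x - \<phi> x) / h - \<psi> x" for h x
  have Rs: "square_integrable \<mu> (R h)" if "h > 0" for h
  proof -
    have "square_integrable \<mu> (Q h)" by (rule bounded_sq) (use that Qm Qb in auto)
    then have "square_integrable \<mu> (\<lambda>x. (1 / h) * (Q h x - \<phi> x) - \<psi> x)"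
      by (intro square_integrable_diff square_integrable_cmult \<phi>s \<psi>)
    then show ?thesis by (simp add: R_def[abs_def])
  qed
  define \<rho> where "\<rho> h = sqrt (\<integral>x. (\<eta> x)\<^sup>2 \<partial>\<mu>) * sqrt (\<integral>x. (R h x)\<^sup>2 \<partial>\<mu>)" for h
  have "((\<lambda>h. \<integral>x. (R h x)\<^sup>2 \<partial>\<mu>) \<longlongrightarrow> 0) (at_right 0)"
  proof (rule tendsto_ennrealD)
    show "((\<lambda>h. ennreal (\<integral>x. (R h x)\<^sup>2 \<partial>\<mu>)) \<longlongrightarrow> ennreal 0) (at_right 0)"
    proof (rule Lim_transform_eventually)
      show "((\<lambda>t. \<integral>\<^sup>+x. ennreal ((R t x)\<^sup>2) \<partial>\<mu>) \<longlongrightarrow> ennreal 0) (at_right 0)"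
        using lim by (simp add: R_def Q_def)
      show "\<forall>\<^sub>F h in at_right 0. (\<integral>\<^sup>+x. ennreal ((R h x)\<^sup>2) \<partial>\<mu>) = ennreal (\<integral>x. (R h x)\<^sup>2 \<partial>\<mu>)"
        using eventually_at_right_less[of 0]
        by eventually_elim (use Rs in \<open>auto intro!: nn_integral_eq_integral simp: square_integrable_def\<close>)
    qed
  qed auto
  then have "(\<rho> \<longlongrightarrow> sqrt (\<integral>x. (\<eta> x)\<^sup>2 \<partial>\<mu>) * sqrt 0) (at_right 0)"
    unfolding \<rho>_def by (intro tendsto_intros)
  moreover have "\<bar>corr \<eta> \<phi> (t + h) - corr \<eta> \<phi> t - h * corr \<eta> \<psi> t\<bar> \<le> h * \<rho> h" if t: "t \<ge> 0" "h > 0" for t h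
  proof -
    have \<eta>E: "\<eta> \<in> borel_measurable E" using \<eta> meq by (simp add: square_integrable_def)
    have X0: "square_integrable M (\<lambda>w. \<eta> (X 0 w))" by (rule square_integrable_X[OF _ \<eta>]) simp
    then have "integrable M (\<lambda>w. \<eta> (X 0 w))"
      using integral_mult_le_sqrt(1)[of "\<lambda>w. \<eta> (X 0 w)" M "\<lambda>_. 1"] by (simp add: square_integrable_def)
    then have "corr \<eta> \<phi> (t + h) = (\<integral>w. \<eta> (X 0 w) * (\<integral>y. \<phi> y \<partial>(K h (X t w))) \<partial>M)"
      unfolding corr_def using t
      by (intro markov_bounded[where B=B] past_measurable[OF _ _ \<eta>E] \<phi> bd) auto
    also have "\<dots> = corr \<eta> (Q h) t" by (simp add: corr_def Q_def)
    also have "Q h = (\<lambda>x. h * R h x + (\<phi> x + h * \<psi> x))" using t by (auto simp: R_def field_simps)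
    also have "corr \<eta> \<dots> t = h * corr \<eta> (R h) t + (corr \<eta> \<phi> t + h * corr \<eta> \<psi> t)"
      using t by (simp add: corr_add corr_cmult \<eta> \<phi>s \<psi> Rs square_integrable_add square_integrable_cmult)
    finally have "corr \<eta> \<phi> (t + h) - corr \<eta> \<phi> t - h * corr \<eta> \<psi> t = h * corr \<eta> (R h) t" by simp
    then show ?thesis
      using corr_le[OF t(1) \<eta> Rs[OF t(2)]] t(2) by (simp add: abs_mult \<rho>_def)
  qed
  ultimately show ?thesis by (intro exI[of _ \<rho>]) auto
qed

end

section \<open>The generator on products of coordinates\<close>

lemma integral_PiM_UNIV_prod:
  fixes G :: "real measure" and f :: "'i \<Rightarrow> real \<Rightarrow> real"
  assumes G: "prob_space G" and J: "finite J" and f: "\<And>i. i \<in> J \<Longrightarrow> integrable G (f i)"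
  shows "(\<integral>\<xi>. (\<Prod>i\<in>J. f i (\<xi> i)) \<partial>(\<Pi>\<^sub>M i\<in>UNIV. G)) = (\<Prod>i\<in>J. \<integral>s. f i s \<partial>G)"
proof -
  interpret G: prob_space G by (rule G)
  interpret P: product_prob_space "\<lambda>_::'i. G" UNIV by unfold_locales
  have m[measurable]: "f i \<in> borel_measurable G" if "i \<in> J" for i using f[OF that] by auto
  have [measurable]: "(\<lambda>\<xi>. restrict \<xi> J) \<in> (\<Pi>\<^sub>M i\<in>UNIV. G) \<rightarrow>\<^sub>M (\<Pi>\<^sub>M i\<in>J. G)"
    by (rule measurable_restrict_subset) simp
  have [measurable]: "(\<lambda>\<xi>. \<Prod>i\<in>J. f i (\<xi> i)) \<in> borel_measurable (\<Pi>\<^sub>M i\<in>J. G)"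
    by measurable
  have "(\<Prod>i\<in>J. \<integral>s. f i s \<partial>G) = (\<integral>\<xi>. (\<Prod>i\<in>J. f i (\<xi> i)) \<partial>(\<Pi>\<^sub>M i\<in>J. G))"
    by (rule P.product_integral_prod[symmetric]) (use J f in auto)
  also have "\<dots> = (\<integral>\<xi>. (\<Prod>i\<in>J. f i (\<xi> i)) \<partial>distr (\<Pi>\<^sub>M i\<in>UNIV. G) (\<Pi>\<^sub>M i\<in>J. G) (\<lambda>\<xi>. restrict \<xi> J))"
    by (subst P.distr_PiM_restrict_finite) (use J in auto)
  also have "\<dots> = (\<integral>\<xi>. (\<Prod>i\<in>J. f i (restrict \<xi> J i)) \<partial>(\<Pi>\<^sub>M i\<in>UNIV. G))"
    by (rule integral_distr) auto
  also have "\<dots> = (\<integral>\<xi>. (\<Prod>i\<in>J. f i (\<xi> i)) \<partial>(\<Pi>\<^sub>M i\<in>UNIV. G))"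
    by (intro Bochner_Integration.integral_cong prod.cong) auto
  finally show ?thesis by simp
qed

section \<open>Gaussian moments under the Gibbs measure\<close>

definition gauss :: "real \<Rightarrow> real measure" where
  "gauss \<beta> = density lborel (\<lambda>s. ennreal (normal_density 0 (1 / sqrt \<beta>) s))"

lemma gibbs_eq: 
  assumes "\<beta> > 0"
  shows "gibbs \<beta> = (\<Pi>\<^sub>M x\<in>UNIV. gauss \<beta>)"
  unfolding gibbs_def gauss_def normal_density_def using assms
  by (simp add: power_divide real_sqrt_divide mult.commute)

definition energy :: "real \<Rightarrow> int \<Rightarrow> config \<Rightarrow> real" where
  "energy \<beta> y \<xi> = (\<xi> y)\<^sup>2 - 1 / \<beta>"

lemma sets_gibbs: "sets (gibbs \<beta>) = sets config_space"
  unfolding gibbs_def config_space_def by (rule sets_PiM_cong) auto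

lemma prod_sq_le: "(a * b)\<^sup>2 * 2 \<le> a ^ 4 + b ^ 4" for a b :: real
proof -
  have "0 \<le> (a\<^sup>2 - b\<^sup>2)\<^sup>2" by simp
  then show ?thesis by (simp add: power2_diff power_mult_distrib flip: power_mult)
qed

context
  fixes \<beta> :: real
  assumes \<beta>: "\<beta> > 0"
begin

lemma prob_space_gauss: "prob_space (gauss \<beta>)"
  unfolding gauss_def using \<beta> by (intro prob_space_normal_density) simp

lemma gauss_moments:
  shows "integrable (gauss \<beta>) (\<lambda>s. s ^ k)" "(\<integral>s. s \<partial>gauss \<beta>) = 0" "(\<integral>s. s ^ 2 \<partial>gauss \<beta>) = 1 / \<beta>"
    "(\<integral>s. s ^ 3 \<partial>gauss \<beta>) = 0" "(\<integral>s. s ^ 4 \<partial>gauss \<beta>) = 3 / \<beta>\<^sup>2"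
proof -
  have p: "1 / sqrt \<beta> > 0" using \<beta> by simp
  show "integrable (gauss \<beta>) (\<lambda>s. s ^ k)"
    unfolding gauss_def using integrable_normal_moment[OF p, of 0 k]
    by (subst integrable_density) auto
  have e: "(\<integral>s. s ^ k \<partial>gauss \<beta>) = (\<integral>s. normal_density 0 (1 / sqrt \<beta>) s * s ^ k \<partial>lborel)" for k
    unfolding gauss_def by (subst integral_density) auto
  have odd: "(\<integral>s. s ^ (2 * k + 1) \<partial>gauss \<beta>) = 0" for k
    unfolding e using normal_moment_odd[OF p, of 0 k] by (simp add: has_bochner_integral_iff)
  have even: "(\<integral>s. s ^ (2 * k) \<partial>gauss \<beta>) = fact (2 * k) / ((2 * \<beta>) ^ k * fact k)" for k
    unfolding e using integral_normal_moment_even[OF p, of 0 k] \<beta> by (simp add: power_divide)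
  show "(\<integral>s. s \<partial>gauss \<beta>) = 0" using odd[of 0] by simp
  show "(\<integral>s. s ^ 2 \<partial>gauss \<beta>) = 1 / \<beta>" using even[of 1] by (simp add: fact_numeral)
  show "(\<integral>s. s ^ 3 \<partial>gauss \<beta>) = 0" using odd[of 1] by (simp add: numeral_eq_Suc)
  show "(\<integral>s. s ^ 4 \<partial>gauss \<beta>) = 3 / \<beta>\<^sup>2" using even[of 2] by (simp add: fact_numeral power2_eq_square)
qed

lemma gibbs_marginal:
  fixes f :: "real \<Rightarrow> real"
  assumes "integrable (gauss \<beta>) f"
  shows "integrable (gibbs \<beta>) (\<lambda>\<xi>. f (\<xi> x))" "(\<integral>\<xi>. f (\<xi> x) \<partial>gibbs \<beta>) = (\<integral>s. f s \<partial>gauss \<beta>)"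
proof -
  have d: "distr (\<Pi>\<^sub>M x\<in>UNIV. gauss \<beta>) (gauss \<beta>) (\<lambda>\<xi>. \<xi> x) = gauss \<beta>"
    by (rule distr_PiM_component) (auto simp: prob_space_gauss)
  have m: "(\<lambda>\<xi>. \<xi> x) \<in> (\<Pi>\<^sub>M x\<in>UNIV. gauss \<beta>) \<rightarrow>\<^sub>M gauss \<beta>" by (rule measurable_component_singleton) simp
  have f: "f \<in> borel_measurable (gauss \<beta>)" using assms by auto
  show "integrable (gibbs \<beta>) (\<lambda>\<xi>. f (\<xi> x))"
    unfolding gibbs_eq[OF \<beta>] using integrable_distr_eq[OF m f] assms d by simp
  show "(\<integral>\<xi>. f (\<xi> x) \<partial>gibbs \<beta>) = (\<integral>s. f s \<partial>gauss \<beta>)"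
    unfolding gibbs_eq[OF \<beta>] using integral_distr[OF m f] d by simp
qed

lemma coordinate_measurable: "(\<lambda>\<xi>. \<xi> x) \<in> borel_measurable (gibbs \<beta>)"
proof -
  have "(\<lambda>\<xi>. \<xi> x) \<in> borel_measurable config_space"
    unfolding config_space_def by (rule measurable_component_singleton) simp
  then show ?thesis using measurable_cong_sets[OF sets_gibbs refl] by blast
qed

lemma square_integrable_coordinates: "square_integrable (gibbs \<beta>) (\<lambda>\<xi>. \<xi> x * \<xi> y)"
proof -
  note [measurable] = coordinate_measurable
  have "integrable (gibbs \<beta>) (\<lambda>\<xi>. (\<xi> x * \<xi> y)\<^sup>2)"
    by (rule Bochner_Integration.integrable_bound[where f="\<lambda>\<xi>. (\<xi> x ^ 4 + \<xi> y ^ 4) / 2"])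
       (auto intro!: gibbs_marginal(1) gauss_moments(1) AE_I2 simp: prod_sq_le)
  then show ?thesis by (simp add: square_integrable_def)
qed

lemma integral_coordinates_le: "(\<integral>\<xi>. (\<xi> x * \<xi> y)\<^sup>2 \<partial>gibbs \<beta>) \<le> 3 / \<beta>\<^sup>2"
proof -
  note i = gibbs_marginal[OF gauss_moments(1)[of 4]] gauss_moments(5)
  have "(\<integral>\<xi>. (\<xi> x * \<xi> y)\<^sup>2 \<partial>gibbs \<beta>) \<le> (\<integral>\<xi>. (\<xi> x ^ 4 + \<xi> y ^ 4) / 2 \<partial>gibbs \<beta>)"
    using square_integrable_coordinates i(1)
    by (intro integral_mono) (auto simp: square_integrable_def prod_sq_le)
  also have "\<dots> = 3 / \<beta>\<^sup>2" using i by simp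
  finally show ?thesis .
qed

lemma square_integrable_energy: "square_integrable (gibbs \<beta>) (energy \<beta> y)"
proof -
  interpret P: prob_space "gibbs \<beta>"
    unfolding gibbs_eq[OF \<beta>] by (rule prob_space_PiM) (rule prob_space_gauss)
  have "square_integrable (gibbs \<beta>) (\<lambda>\<xi>. \<xi> y * \<xi> y - 1 / \<beta>)"
    by (intro square_integrable_diff square_integrable_coordinates) (simp add: square_integrable_def)
  then show ?thesis by (simp add: energy_def[abs_def] power2_eq_square)
qed

text \<open>By independence the integral factorises over sites. If \<open>x\<close> and
  \<open>y\<close> differ, an odd moment remains; if they agree but differ from \<open>z\<close>,
  the centred energy has mean zero; otherwise the value is
  \<open>3 / \<beta>^2 - 1 / \<beta>^2\<close>.\<close>

lemma gibbs_energy_coordinates: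
  "(\<integral>\<xi>. energy \<beta> z \<xi> * (\<xi> x * \<xi> y) \<partial>gibbs \<beta>) = (if x = z \<and> y = z then 2 / \<beta>\<^sup>2 else 0)"
proof -
  interpret G: prob_space "gauss \<beta>" by (rule prob_space_gauss)
  \<comment> \<open>One factor per site, equal to 1 where the site does not occur, so that all
    coincidences among \<open>x\<close>, \<open>y\<close>, \<open>z\<close> are covered by a single
    product.\<close>
  define m where "m i s = (if i = x then s else 1) * (if i = y then s else 1) * (if i = z then s\<^sup>2 - 1 / \<beta> else 1)"
    for i and s :: real
  have P: "(\<Prod>i\<in>{x, y, z}. m i (\<xi> i)) = energy \<beta> z \<xi> * (\<xi> x * \<xi> y)" for \<xi>
    by (cases "x = y"; cases "x = z"; cases "y = z") (auto simp: m_def energy_def insert_commute)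
  have i: "integrable (gauss \<beta>) (\<lambda>s. s ^ k)" for k by (rule gauss_moments(1))
  have i1: "integrable (gauss \<beta>) (\<lambda>s. s)" "integrable (gauss \<beta>) (\<lambda>s. s * s)" "integrable (gauss \<beta>) (\<lambda>s. s * (s\<^sup>2 - 1 / \<beta>))"
      "integrable (gauss \<beta>) (\<lambda>s. s * s * (s\<^sup>2 - 1 / \<beta>))"
    using i[of 1] i[of 2] i[of 3] i[of 4] by (auto simp: algebra_simps numeral_eq_Suc)
  have int: "integrable (gauss \<beta>) (m i)" for i
  proof -
    have "integrable (gauss \<beta>) (\<lambda>s. (if A then s else 1) * (if B then s else 1) * (if C then s\<^sup>2 - 1 / \<beta> else 1))" for A B C
      by (cases A; cases B; cases C) (use i1 i[of 2] in simp_all)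
    then show ?thesis unfolding m_def[abs_def] .
  qed
  have E: "(\<integral>\<xi>. energy \<beta> z \<xi> * (\<xi> x * \<xi> y) \<partial>gibbs \<beta>) = (\<Prod>i\<in>{x, y, z}. \<integral>s. m i s \<partial>gauss \<beta>)"
    unfolding gibbs_eq[OF \<beta>] P[symmetric] by (rule integral_PiM_UNIV_prod) (auto intro: prob_space_gauss int)
  have m1: "(\<integral>s. s \<partial>gauss \<beta>) = 0" by (rule gauss_moments)
  have m2: "(\<integral>s. s * s \<partial>gauss \<beta>) = 1 / \<beta>" using gauss_moments(3) by (simp add: power2_eq_square)
  have m3: "(\<integral>s. s * (s\<^sup>2 - 1 / \<beta>) \<partial>gauss \<beta>) = 0"
  proof -
    have "(\<integral>s. s * (s\<^sup>2 - 1 / \<beta>) \<partial>gauss \<beta>) = (\<integral>s. s ^ 3 - s / \<beta> \<partial>gauss \<beta>)"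
      by (simp add: algebra_simps numeral_eq_Suc)
    also have "\<dots> = 0" using i[of 3] i1(1) m1 gauss_moments(4) by simp
    finally show ?thesis .
  qed
  have m4: "(\<integral>s. s * s * (s\<^sup>2 - 1 / \<beta>) \<partial>gauss \<beta>) = 2 / \<beta>\<^sup>2"
  proof -
    have "(\<integral>s. s * s * (s\<^sup>2 - 1 / \<beta>) \<partial>gauss \<beta>) = (\<integral>s. s ^ 4 - s ^ 2 / \<beta> \<partial>gauss \<beta>)"
      by (simp add: algebra_simps numeral_eq_Suc)
    also have "\<dots> = 3 / \<beta>\<^sup>2 - 1 / \<beta> / \<beta>" using i[of 4] i[of 2] gauss_moments(3,5) by simp
    finally show ?thesis by (simp add: power2_eq_square field_simps)
  qed
  have m5: "(\<integral>s. s\<^sup>2 - 1 / \<beta> \<partial>gauss \<beta>) = 0"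
    using i[of 2] gauss_moments(3) by (simp add: G.prob_space)
  show ?thesis
  proof (cases "x = y")
    case True
    then show ?thesis
      unfolding E by (cases "x = z") (auto simp: m_def[abs_def] m4 m5)
  next
    case False
    then have "(\<integral>s. m x s \<partial>gauss \<beta>) = 0"
      by (cases "x = z") (auto simp: m_def[abs_def] m1 m3)
    then show ?thesis using False unfolding E by auto
  qed
qed

lemma integral_energy_sq: "(\<integral>\<xi>. (energy \<beta> y \<xi>)\<^sup>2 \<partial>gibbs \<beta>) = 2 / \<beta>\<^sup>2"
proof -
  interpret G: prob_space "gauss \<beta>" by (rule prob_space_gauss)
  note i = gauss_moments(1)[of 2] gauss_moments(1)[of 4]
  have "(s\<^sup>2 - 1 / \<beta>)\<^sup>2 = s ^ 4 - 2 / \<beta> * s\<^sup>2 + 1 / \<beta>\<^sup>2" for s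
    by (simp add: power2_diff power_divide flip: power_mult)
  then have "integrable (gauss \<beta>) (\<lambda>s. (s\<^sup>2 - 1 / \<beta>)\<^sup>2)"
     and "(\<integral>s. (s\<^sup>2 - 1 / \<beta>)\<^sup>2 \<partial>gauss \<beta>) = 3 / \<beta>\<^sup>2 - 2 / \<beta> * (1 / \<beta>) + 1 / \<beta>\<^sup>2"
    using i gauss_moments(3,5) by (simp_all add: G.prob_space)
  from gibbs_marginal(2)[OF this(1)] this(2) show ?thesis
    by (simp add: energy_def power2_eq_square)
qed

end

section \<open>The generator on truncated products\<close>

definition swap_site :: "int \<Rightarrow> int \<Rightarrow> int" where
  "swap_site z x = (if x = z then z + 1 else if x = z + 1 then z else x)"

text \<open>The generator maps \<open>\<xi> x * \<xi> y\<close> to a linear combination of such products; applied to a family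
  \<open>c x y\<close> indexed by the products, it becomes the following operator.  A flip changes the
  sign of a product only off the diagonal.\<close>

definition lattice_gen :: "real \<Rightarrow> (int \<Rightarrow> int \<Rightarrow> 'a::real_vector) \<Rightarrow> int \<Rightarrow> int \<Rightarrow> 'a" where
  "lattice_gen \<gamma> c x y = (c (x + 1) y - c (x - 1) y) + (c x (y + 1) - c x (y - 1))
     - (if x = y then 0 else 4 * \<gamma>) *\<^sub>R c x y
     + (\<Sum>z\<in>{x - 1, x, y - 1, y}. c (swap_site z x) (swap_site z y) - c x y)"

text \<open>\<open>\<xi> x * \<xi> y\<close> is unbounded, hence outside the domain on which the dynamics is specified.
  It is approximated by \<open>R\<^sup>2 sin (\<xi> x / R) sin (\<xi> y / R)\<close>, dominated by \<open>\<bar>\<xi> x * \<xi> y\<bar>\<close>.\<close>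

definition tsin :: "real \<Rightarrow> real \<Rightarrow> real" where "tsin R u = R * sin (u / R)"

definition trunc_prod :: "real \<Rightarrow> int \<Rightarrow> int \<Rightarrow> config \<Rightarrow> real" where
  "trunc_prod R x y \<xi> = tsin R (\<xi> x) * tsin R (\<xi> y)"

lemma tsin_le: "R > 0 \<Longrightarrow> \<bar>tsin R u\<bar> \<le> \<bar>u\<bar>"
  using abs_sin_x_le_abs_x[of "u / R"] by (simp add: tsin_def abs_mult pos_le_divide_eq mult.commute)

lemma tsin_le_const: "R > 0 \<Longrightarrow> \<bar>tsin R u\<bar> \<le> R"
  by (simp add: tsin_def abs_mult mult_left_le)

lemma tsin_LIMSEQ: "(\<lambda>n. tsin (real (Suc n)) u) \<longlonglongrightarrow> u"
  unfolding tsin_def by real_asymp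

lemma DERIV_tsin: "R > 0 \<Longrightarrow> (tsin R has_real_derivative cos (u / R)) (at u)"
  unfolding tsin_def[abs_def] by (auto intro!: derivative_eq_intros)

text \<open>A class of functions that is closed under partial derivatives, whether or not \<open>x = y\<close>.\<close>

definition two_waves :: "int \<Rightarrow> int \<Rightarrow> real \<Rightarrow> real \<Rightarrow> real \<Rightarrow> real \<Rightarrow> real \<Rightarrow> real \<Rightarrow> real \<Rightarrow> real \<Rightarrow> config \<Rightarrow> real" where
  "two_waves x y a k l p a' k' l' p' \<xi> =
     a * sin (k * \<xi> x + l * \<xi> y + p) + a' * sin (k' * \<xi> x + l' * \<xi> y + p')"

text \<open>Differentiating a sine shifts its phase by \<open>pi / 2\<close>. Hence only amplitudes
  and phases change, while the wave numbers stay fixed.\<close>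

lemma two_waves_deriv:
  fixes z :: int
  defines "d i \<equiv> (if i = z then 1 else 0 :: real)"
  shows "((\<lambda>s. two_waves x y a k l p a' k' l' p' (\<xi>(z := s))) has_real_derivative
     two_waves x y (a * (k * d x + l * d y)) k l (p + pi / 2) (a' * (k' * d x + l' * d y)) k' l' (p' + pi / 2) (\<xi>(z := s))) (at s)"
proof -
  have c: "((\<lambda>s. (\<xi>(z := s)) i) has_real_derivative d i) (at s)" for i
    by (cases "i = z") (auto simp: d_def)
  have "sin (u + (q + pi / 2)) = cos (u + q)" for u q :: real
    by (simp add: add.assoc[symmetric] sin_add[of "u + q"])
  then have e: "A * (cos (K * (\<xi>(z := s)) x + L * (\<xi>(z := s)) y + q) * (K * d x + L * d y))
      = A * (K * d x + L * d y) * sin (K * (\<xi>(z := s)) x + L * (\<xi>(z := s)) y + (q + pi / 2))" for A K L q :: real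
    by simp
  have w: "((\<lambda>s. A * sin (K * (\<xi>(z := s)) x + L * (\<xi>(z := s)) y + q)) has_real_derivative
      A * (cos (K * (\<xi>(z := s)) x + L * (\<xi>(z := s)) y + q) * (K * d x + L * d y))) (at s)" for A K L q :: real
    by (intro DERIV_cmult DERIV_fun_sin)
       (use DERIV_add[OF DERIV_add[OF DERIV_cmult[OF c[of x]] DERIV_cmult[OF c[of y]]] DERIV_const] in \<open>simp only: add_0_right\<close>)
  show ?thesis
    unfolding two_waves_def e[symmetric] by (intro DERIV_add w)
qed

lemma partial_deriv_two_waves:
  "\<exists>a b q q'. partial_deriv z (two_waves x y a0 k l p a' k' l' p') = two_waves x y a k l q b k' l' q'"
proof -
  let ?d = "\<lambda>i. (if i = z then 1 else 0 :: real)"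
  have "partial_deriv z (two_waves x y a0 k l p a' k' l' p')
      = two_waves x y (a0 * (k * ?d x + l * ?d y)) k l (p + pi / 2) (a' * (k' * ?d x + l' * ?d y)) k' l' (p' + pi / 2)"
    unfolding partial_deriv_def[abs_def]
    by (rule ext, subst DERIV_imp_deriv[OF two_waves_deriv]) simp
  then show ?thesis by blast
qed

lemma smooth_two_waves: "smooth_fun (two_waves x y a k l p a' k' l' p')"
proof -
  have ex: "\<exists>a b q q'. foldr partial_deriv xs (two_waves x y a0 k l p a' k' l' p') = two_waves x y a k l q b k' l' q'" for xs a0
  proof (induction xs)
    case (Cons z zs)
    then obtain a b q q' where "foldr partial_deriv zs (two_waves x y a0 k l p a' k' l' p') = two_waves x y a k l q b k' l' q'"
      by blast
    then show ?case using partial_deriv_two_waves[of z x y a k l q b k' l' q'] by simp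
  qed auto
  have c: "continuous_on UNIV (two_waves x y a k l q b k' l' q')" for a b q q'
    unfolding two_waves_def[abs_def] by (intro continuous_intros continuous_on_product_coordinates)
  have d: "(\<lambda>s. two_waves x y a k l q b k' l' q' (\<eta>(z := s))) differentiable (at (\<eta> z))" for a b q q' \<eta> z
    using two_waves_deriv real_differentiable_def by blast
  show ?thesis
    unfolding smooth_fun_def using ex c d by metis
qed

lemma trunc_prod_eq_two_waves:
  assumes "R > 0"
  shows "trunc_prod R x y = two_waves x y (R\<^sup>2 / 2) (1 / R) (- 1 / R) (pi / 2) (- R\<^sup>2 / 2) (1 / R) (1 / R) (pi / 2)"
proof
  fix \<xi>
  have "sin (u / R) * sin (v / R) = (cos (u / R - v / R) - cos (u / R + v / R)) / 2" for u v :: real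
    by (rule sin_times_sin)
  moreover have "trunc_prod R x y \<xi> = R\<^sup>2 * (sin (\<xi> x / R) * sin (\<xi> y / R))"
    by (simp add: trunc_prod_def tsin_def power2_eq_square)
  ultimately have "trunc_prod R x y \<xi> = R\<^sup>2 * ((cos (\<xi> x / R - \<xi> y / R) - cos (\<xi> x / R + \<xi> y / R)) / 2)"
    by (simp only:)
  also have "\<dots> = two_waves x y (R\<^sup>2 / 2) (1 / R) (- 1 / R) (pi / 2) (- R\<^sup>2 / 2) (1 / R) (1 / R) (pi / 2) \<xi>"
  proof -
    have "sin (u + pi / 2) = cos u" for u by (simp add: sin_add)
    moreover have "(1 / R) * \<xi> x + (- 1 / R) * \<xi> y = \<xi> x / R - \<xi> y / R"
      "(1 / R) * \<xi> x + (1 / R) * \<xi> y = \<xi> x / R + \<xi> y / R" by simp_all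
    ultimately show ?thesis unfolding two_waves_def by (simp only:) (simp add: field_simps)
  qed
  finally show "trunc_prod R x y \<xi> = \<dots>" .
qed

lemma trunc_prod_le_const: 
  assumes "R > 0" shows "\<bar>trunc_prod R x y \<xi>\<bar> \<le> R * R"
  unfolding trunc_prod_def abs_mult using assms by (intro mult_mono tsin_le_const) auto

lemma trunc_prod_le: "R > 0 \<Longrightarrow> \<bar>trunc_prod R x y \<xi>\<bar> \<le> \<bar>\<xi> x * \<xi> y\<bar>"
  unfolding trunc_prod_def abs_mult by (intro mult_mono tsin_le) auto

lemma trunc_prod_in_domain:
  assumes "R > 0"
  shows "trunc_prod R x y \<in> smooth_local_bounded"
proof -
  have "local_fun (trunc_prod R x y)"
    unfolding local_fun_def trunc_prod_def by (intro exI[of _ "{x, y}"]) auto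
  moreover have "bounded (range (trunc_prod R x y))"
    unfolding bounded_iff using trunc_prod_le_const[OF assms] by auto
  ultimately show ?thesis
    unfolding smooth_local_bounded_def using smooth_two_waves trunc_prod_eq_two_waves[OF assms] by auto
qed

lemma infsum_finite_support:
  assumes "finite S" "\<And>x. x \<notin> S \<Longrightarrow> f x = 0"
  shows "infsum f UNIV = sum f S"
  using infsum_cong_neutral[of S UNIV f f] assms by simp

lemma generator_trunc_prod:
  assumes R: "R > 0"
  shows "generator \<gamma> 1 (trunc_prod R x y) \<xi> =
     ((\<xi> (x + 1) - \<xi> (x - 1)) * (cos (\<xi> x / R) * tsin R (\<xi> y)) +
      (\<xi> (y + 1) - \<xi> (y - 1)) * (cos (\<xi> y / R) * tsin R (\<xi> x)))
     - (if x = y then 0 else 4 * \<gamma>) * trunc_prod R x y \<xi>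
     + (\<Sum>z\<in>{x - 1, x, y - 1, y}. trunc_prod R (swap_site z x) (swap_site z y) \<xi> - trunc_prod R x y \<xi>)"
proof -
  have pd: "partial_deriv z (trunc_prod R x y) \<xi> =
     (if z = x then cos (\<xi> x / R) * tsin R (\<xi> y) else 0) + (if z = y then cos (\<xi> y / R) * tsin R (\<xi> x) else 0)" for z
  proof -
    have c: "((\<lambda>s. tsin R ((\<xi>(z := s)) i)) has_real_derivative (if z = i then cos (\<xi> i / R) else 0)) (at (\<xi> z))" for i
      using DERIV_tsin[OF R, of "\<xi> z"] by auto
    have "((\<lambda>s. trunc_prod R x y (\<xi>(z := s))) has_real_derivative
       ((if z = x then cos (\<xi> x / R) else 0) * tsin R (\<xi> y) + tsin R (\<xi> x) * (if z = y then cos (\<xi> y / R) else 0))) (at (\<xi> z))"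
      unfolding trunc_prod_def using DERIV_mult[OF c[of x] c[of y]] by (simp add: algebra_simps)
    from DERIV_imp_deriv[OF this] show ?thesis by (simp add: partial_deriv_def)
  qed
  have "A_gen (trunc_prod R x y) \<xi> = (\<Sum>z\<in>{x, y}. (\<xi> (z + 1) - \<xi> (z - 1)) * partial_deriv z (trunc_prod R x y) \<xi>)"
    unfolding A_gen_def by (rule infsum_finite_support) (auto simp: pd)
  also have "\<dots> = (\<xi> (x + 1) - \<xi> (x - 1)) * (cos (\<xi> x / R) * tsin R (\<xi> y)) +
      (\<xi> (y + 1) - \<xi> (y - 1)) * (cos (\<xi> y / R) * tsin R (\<xi> x))"
    \<comment> \<open>For \<open>x = y\<close> the sum runs over one site only, but both summands of
      \<open>pd\<close> contribute there, so the total keeps its form.\<close>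
    unfolding pd by (cases "x = y") (simp_all add: distrib_left)
  finally have A: "A_gen (trunc_prod R x y) \<xi> = \<dots>" .
  have "S_flip (trunc_prod R x y) \<xi> = (\<Sum>z\<in>{x, y}. trunc_prod R x y (\<xi>(z := - \<xi> z)) - trunc_prod R x y \<xi>)"
    unfolding S_flip_def by (rule infsum_finite_support) (auto simp: trunc_prod_def)
  \<comment> \<open>Off the diagonal each of the two flips changes the product by minus twice
    itself.\<close>
  also have "\<dots> = - (if x = y then 0 else 4) * trunc_prod R x y \<xi>"
    by (cases "x = y") (auto simp: trunc_prod_def tsin_def)
  finally have F: "S_flip (trunc_prod R x y) \<xi> = \<dots>" .
  have sw: "trunc_prod R x y (\<xi>(z := \<xi> (z + 1), z + 1 := \<xi> z)) = trunc_prod R (swap_site z x) (swap_site z y) \<xi>" for z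
    by (auto simp: trunc_prod_def swap_site_def)
  have E: "S_exch (trunc_prod R x y) \<xi> = (\<Sum>z\<in>{x - 1, x, y - 1, y}. trunc_prod R (swap_site z x) (swap_site z y) \<xi> - trunc_prod R x y \<xi>)"
    unfolding S_exch_def sw by (rule infsum_finite_support) (auto simp: swap_site_def)
  show ?thesis unfolding generator_def A F E by auto
qed

lemma uniform_limit_sum:
  fixes f :: "'i \<Rightarrow> 'n \<Rightarrow> 'a \<Rightarrow> 'b::real_normed_vector"
  assumes "\<And>i. i \<in> I \<Longrightarrow> uniform_limit S (f i) (l i) F"
  shows "uniform_limit S (\<lambda>n x. \<Sum>i\<in>I. f i n x) (\<lambda>x. \<Sum>i\<in>I. l i x) F"
  using assms by (induction I rule: infinite_finite_induct) (auto intro: uniform_limit_add uniform_limitI)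

locale stationary_chain =
  fixes M :: "'m measure" and X :: "real \<Rightarrow> 'm \<Rightarrow> config" and K :: "real \<Rightarrow> config \<Rightarrow> config measure"
    and \<beta> \<gamma> :: real
  assumes beta_pos: "\<beta> > 0"
    and chain: "stationary_markov M config_space K X (gibbs \<beta>)"
    and L2_gen: "has_L2_generator_on (gibbs \<beta>) K (generator \<gamma> 1) smooth_local_bounded"
begin

sublocale stationary_markov M config_space K X "gibbs \<beta>"
  by (rule chain)

definition pair_corr :: "(config \<Rightarrow> real) \<Rightarrow> int \<Rightarrow> int \<Rightarrow> real \<Rightarrow> real" where
  "pair_corr \<eta> x y t = corr \<eta> (\<lambda>\<xi>. \<xi> x * \<xi> y) t"

lemma trunc_prod_measurable: "trunc_prod R x y \<in> borel_measurable (gibbs \<beta>)"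
  unfolding trunc_prod_def[abs_def] tsin_def
  by (intro borel_measurable_times borel_measurable_const measurable_compose[OF _ borel_measurable_sin]
      borel_measurable_divide coordinate_measurable[OF beta_pos])

lemma uniform_limit_trunc_prod:
  assumes \<eta>: "square_integrable (gibbs \<beta>) \<eta>"
  shows "uniform_limit {0..} (\<lambda>n. corr \<eta> (trunc_prod (real (Suc n)) x y)) (pair_corr \<eta> x y) sequentially"
  unfolding pair_corr_def[abs_def]
  by (rule uniform_limit_corr(2)[OF \<eta> trunc_prod_measurable square_integrable_coordinates[OF beta_pos, of x y]])
     (auto simp: trunc_prod_le simp del: of_nat_Suc, auto simp: trunc_prod_def simp del: of_nat_Suc intro!: tendsto_intros tsin_LIMSEQ)

text \<open>The drift multiplies the truncated factors by a neighbouring coordinate that is not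
  truncated. The term is unbounded, yet a product of two coordinates dominates it independently of
  \<open>R\<close>.\<close>

lemma drift_term:
  assumes R: "R > 0"
  shows "square_integrable (gibbs \<beta>) (\<lambda>\<xi>. \<xi> z * (cos (\<xi> x / R) * tsin R (\<xi> y)))"
    and "\<bar>\<xi> z * (cos (\<xi> x / R) * tsin R (\<xi> y))\<bar> \<le> \<bar>\<xi> z * \<xi> y\<bar>"
proof -
  show b: "\<bar>\<xi> z * (cos (\<xi> x / R) * tsin R (\<xi> y))\<bar> \<le> \<bar>\<xi> z * \<xi> y\<bar>" for \<xi>
  proof -
    have "\<bar>cos (\<xi> x / R)\<bar> * \<bar>tsin R (\<xi> y)\<bar> \<le> 1 * \<bar>\<xi> y\<bar>"
      by (intro mult_mono tsin_le R) auto
    then show ?thesis unfolding abs_mult by (intro mult_left_mono) auto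
  qed
  have [measurable]: "(\<lambda>\<xi>. \<xi> i) \<in> borel_measurable (gibbs \<beta>)" for i by (rule coordinate_measurable[OF beta_pos])
  show "square_integrable (gibbs \<beta>) (\<lambda>\<xi>. \<xi> z * (cos (\<xi> x / R) * tsin R (\<xi> y)))"
    by (rule square_integrable_bound[OF square_integrable_coordinates[OF beta_pos, of z y] _ b])
       (simp add: tsin_def)
qed

lemma uniform_limit_drift_term:
  assumes \<eta>: "square_integrable (gibbs \<beta>) \<eta>"
  shows "uniform_limit {0..} (\<lambda>n. corr \<eta> (\<lambda>\<xi>. \<xi> z * (cos (\<xi> x / real (Suc n)) * tsin (real (Suc n)) (\<xi> y)))) (pair_corr \<eta> z y) sequentially"
  unfolding pair_corr_def[abs_def]
proof (rule uniform_limit_corr(2)[OF \<eta> _ square_integrable_coordinates[OF beta_pos, of z y]])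
  have Sp: "real (Suc n) > 0" for n by simp
  show "\<bar>\<xi> z * (cos (\<xi> x / real (Suc n)) * tsin (real (Suc n)) (\<xi> y))\<bar> \<le> \<bar>\<xi> z * \<xi> y\<bar>" for n \<xi>
    by (rule drift_term(2)[OF Sp])
  show "(\<lambda>\<xi>. \<xi> z * (cos (\<xi> x / real (Suc n)) * tsin (real (Suc n)) (\<xi> y))) \<in> borel_measurable (gibbs \<beta>)" for n
    using drift_term(1)[OF Sp] by (simp only: square_integrable_def)
  fix \<xi> :: config
  have "(\<lambda>n. cos (\<xi> x / real (Suc n))) \<longlonglongrightarrow> 1" by real_asymp
  from tendsto_mult[OF tendsto_const tendsto_mult[OF this tsin_LIMSEQ]]
  show "(\<lambda>n. \<xi> z * (cos (\<xi> x / real (Suc n)) * tsin (real (Suc n)) (\<xi> y))) \<longlonglongrightarrow> \<xi> z * \<xi> y" by simp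
qed

lemma square_integrable_trunc_prod: "R > 0 \<Longrightarrow> square_integrable (gibbs \<beta>) (trunc_prod R x y)"
  by (rule square_integrable_bound[OF square_integrable_coordinates[OF beta_pos, of x y] trunc_prod_measurable trunc_prod_le])

lemma generator_trunc_prod_split:
  assumes "R > 0"
  shows "generator \<gamma> 1 (trunc_prod R x y) = (\<lambda>\<xi>.
     ((\<xi> (x + 1) * (cos (\<xi> x / R) * tsin R (\<xi> y)) - \<xi> (x - 1) * (cos (\<xi> x / R) * tsin R (\<xi> y))) +
      (\<xi> (y + 1) * (cos (\<xi> y / R) * tsin R (\<xi> x)) - \<xi> (y - 1) * (cos (\<xi> y / R) * tsin R (\<xi> x))))
     - (if x = y then 0 else 4 * \<gamma>) * trunc_prod R x y \<xi>
     + (\<Sum>z\<in>{x - 1, x, y - 1, y}. trunc_prod R (swap_site z x) (swap_site z y) \<xi> - trunc_prod R x y \<xi>))"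
  unfolding generator_trunc_prod[OF assms, abs_def] left_diff_distrib ..

lemma square_integrable_generator:
  assumes "R > 0"
  shows "square_integrable (gibbs \<beta>) (generator \<gamma> 1 (trunc_prod R x y))"
  unfolding generator_trunc_prod_split[OF assms]
  by (intro square_integrable_add square_integrable_diff square_integrable_sum square_integrable_cmult
      square_integrable_trunc_prod drift_term(1) assms)

text \<open>As \<open>R\<close> grows, the cosine tends to 1 and \<open>tsin\<close> to the
  identity, so the drift of a truncated product tends to that of the product itself; this is what
  closes the system.\<close>

lemma uniform_limit_generator:
  assumes \<eta>: "square_integrable (gibbs \<beta>) \<eta>"
  shows "uniform_limit {0..} (\<lambda>n. corr \<eta> (generator \<gamma> 1 (trunc_prod (real (Suc n)) x y)))
     (\<lambda>t. lattice_gen \<gamma> (\<lambda>x y. pair_corr \<eta> x y t) x y) sequentially"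
proof (rule uniform_limit_cong[THEN iffD1])
  have R: "real (Suc n) > 0" for n by simp
  define A where "A z x y n = corr \<eta> (\<lambda>\<xi>. \<xi> z * (cos (\<xi> x / real (Suc n)) * tsin (real (Suc n)) (\<xi> y)))" for z x y n
  define B where "B x y n = corr \<eta> (trunc_prod (real (Suc n)) x y)" for x y n
  show "uniform_limit {0..} (\<lambda>n t. (A (x + 1) x y n t - A (x - 1) x y n t) + (A (y + 1) y x n t - A (y - 1) y x n t)
      - (if x = y then 0 else 4 * \<gamma>) *\<^sub>R B x y n t + (\<Sum>z\<in>{x - 1, x, y - 1, y}. B (swap_site z x) (swap_site z y) n t - B x y n t))
     (\<lambda>t. (pair_corr \<eta> (x + 1) y t - pair_corr \<eta> (x - 1) y t) + (pair_corr \<eta> (y + 1) x t - pair_corr \<eta> (y - 1) x t)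
      - (if x = y then 0 else 4 * \<gamma>) *\<^sub>R pair_corr \<eta> x y t + (\<Sum>z\<in>{x - 1, x, y - 1, y}. pair_corr \<eta> (swap_site z x) (swap_site z y) t - pair_corr \<eta> x y t))
      sequentially"
    unfolding A_def B_def
    by (intro uniform_limit_add uniform_limit_minus uniform_limit_sum
        bounded_linear_uniform_limit_intros uniform_limit_trunc_prod uniform_limit_drift_term \<eta>)
  show "(pair_corr \<eta> (x + 1) y t - pair_corr \<eta> (x - 1) y t) + (pair_corr \<eta> (y + 1) x t - pair_corr \<eta> (y - 1) x t)
      - (if x = y then 0 else 4 * \<gamma>) *\<^sub>R pair_corr \<eta> x y t + (\<Sum>z\<in>{x - 1, x, y - 1, y}. pair_corr \<eta> (swap_site z x) (swap_site z y) t - pair_corr \<eta> x y t)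
     = lattice_gen \<gamma> (\<lambda>x y. pair_corr \<eta> x y t) x y" for t
    unfolding lattice_gen_def pair_corr_def by (simp add: mult.commute)
  show "\<forall>\<^sub>F n in sequentially. \<forall>t\<in>{0..}. (A (x + 1) x y n t - A (x - 1) x y n t) + (A (y + 1) y x n t - A (y - 1) y x n t)
      - (if x = y then 0 else 4 * \<gamma>) *\<^sub>R B x y n t + (\<Sum>z\<in>{x - 1, x, y - 1, y}. B (swap_site z x) (swap_site z y) n t - B x y n t)
      = corr \<eta> (generator \<gamma> 1 (trunc_prod (real (Suc n)) x y)) t"
  proof (intro always_eventually allI ballI)
    fix n and t :: real assume t: "t \<in> {0..}"
    then have t: "t \<ge> 0" by simp
    show "(A (x + 1) x y n t - A (x - 1) x y n t) + (A (y + 1) y x n t - A (y - 1) y x n t)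
      - (if x = y then 0 else 4 * \<gamma>) *\<^sub>R B x y n t + (\<Sum>z\<in>{x - 1, x, y - 1, y}. B (swap_site z x) (swap_site z y) n t - B x y n t)
      = corr \<eta> (generator \<gamma> 1 (trunc_prod (real (Suc n)) x y)) t"
      unfolding A_def B_def generator_trunc_prod_split[OF R]
      by (simp only: corr_add[OF t \<eta>] corr_diff[OF t \<eta>] corr_sum[OF t \<eta>] corr_cmult real_scaleR_def
          square_integrable_add square_integrable_diff square_integrable_sum square_integrable_cmult
          square_integrable_trunc_prod[OF R] drift_term(1)[OF R])
  qed
qed

lemma corr_generator_step:
  assumes \<eta>: "square_integrable (gibbs \<beta>) \<eta>" and R: "R > 0"
  shows "\<exists>\<rho>. (\<rho> \<longlongrightarrow> 0) (at_right 0) \<and> (\<forall>t\<ge>0. \<forall>h>0.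
    \<bar>corr \<eta> (trunc_prod R x y) (t + h) - corr \<eta> (trunc_prod R x y) t - h * corr \<eta> (generator \<gamma> 1 (trunc_prod R x y)) t\<bar> \<le> h * \<rho> h)"
proof (rule corr_step[OF \<eta>])
  show "trunc_prod R x y \<in> borel_measurable config_space"
    using trunc_prod_measurable measurable_cong_sets[OF sets_gibbs refl] by blast
  show "\<bar>trunc_prod R x y \<xi>\<bar> \<le> R * R" for \<xi> by (rule trunc_prod_le_const[OF R])
  show g: "square_integrable (gibbs \<beta>) (generator \<gamma> 1 (trunc_prod R x y))"
    by (rule square_integrable_generator[OF R])
  show "((\<lambda>t. \<integral>\<^sup>+\<xi>. ennreal ((((\<integral>\<zeta>. trunc_prod R x y \<zeta> \<partial>(K t \<xi>)) - trunc_prod R x y \<xi>) / t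
      - generator \<gamma> 1 (trunc_prod R x y) \<xi>)\<^sup>2) \<partial>gibbs \<beta>) \<longlongrightarrow> 0) (at_right 0)"
    using L2_gen trunc_prod_in_domain[OF R, of x y] g unfolding has_L2_generator_on_def square_integrable_def by blast
qed

lemma pair_corr_le:
  assumes "t \<ge> 0" "square_integrable (gibbs \<beta>) \<eta>"
  shows "\<bar>pair_corr \<eta> x y t\<bar> \<le> sqrt (\<integral>\<xi>. (\<eta> \<xi>)\<^sup>2 \<partial>gibbs \<beta>) * sqrt (3 / \<beta>\<^sup>2)"
proof -
  have "\<bar>pair_corr \<eta> x y t\<bar> \<le> sqrt (\<integral>\<xi>. (\<eta> \<xi>)\<^sup>2 \<partial>gibbs \<beta>) * sqrt (\<integral>\<xi>. (\<xi> x * \<xi> y)\<^sup>2 \<partial>gibbs \<beta>)"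
    unfolding pair_corr_def by (rule corr_le[OF assms square_integrable_coordinates[OF beta_pos]])
  also have "\<dots> \<le> sqrt (\<integral>\<xi>. (\<eta> \<xi>)\<^sup>2 \<partial>gibbs \<beta>) * sqrt (3 / \<beta>\<^sup>2)"
    by (intro mult_left_mono real_sqrt_le_mono integral_coordinates_le[OF beta_pos]) auto
  finally show ?thesis .
qed

text \<open>Supplies the continuity of the right-hand side required by
  \<open>has_derivative_of_approximations\<close>. For a truncated product it follows from the step
  estimate, and uniform convergence passes it on.\<close>

lemma continuous_pair_corr:
  assumes \<eta>: "square_integrable (gibbs \<beta>) \<eta>"
  shows "continuous_on {0..} (pair_corr \<eta> x y)"
proof (rule uniform_limit_theorem[OF _ uniform_limit_trunc_prod[OF \<eta>]])
  show "\<forall>\<^sub>F n in sequentially. continuous_on {0..} (corr \<eta> (trunc_prod (real (Suc n)) x y))"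
  proof (intro always_eventually allI)
    fix n
    obtain \<rho> where \<rho>: "(\<rho> \<longlongrightarrow> 0) (at_right 0)"
      "\<And>t h. t \<ge> 0 \<Longrightarrow> h > 0 \<Longrightarrow> \<bar>corr \<eta> (trunc_prod (real (Suc n)) x y) (t + h) - corr \<eta> (trunc_prod (real (Suc n)) x y) t
          - h * corr \<eta> (generator \<gamma> 1 (trunc_prod (real (Suc n)) x y)) t\<bar> \<le> h * \<rho> h"
      using corr_generator_step[OF \<eta>, of "real (Suc n)" x y] by auto
    show "continuous_on {0..} (corr \<eta> (trunc_prod (real (Suc n)) x y))"
      by (rule uniform_right_derivative_continuous[OF \<rho>(2) \<rho>(1) corr_le[OF _ \<eta> square_integrable_generator]]) auto
  qed
qed simp

lemma pair_corr_deriv: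
  assumes \<eta>: "square_integrable (gibbs \<beta>) \<eta>" and t: "t \<ge> 0"
  shows "(pair_corr \<eta> x y has_real_derivative lattice_gen \<gamma> (\<lambda>x y. pair_corr \<eta> x y t) x y) (at t within {0..})"
proof -
  have "\<exists>\<rho>. \<forall>n. (\<rho> n \<longlongrightarrow> 0) (at_right 0) \<and> (\<forall>t\<ge>0. \<forall>h>0.
    \<bar>corr \<eta> (trunc_prod (real (Suc n)) x y) (t + h) - corr \<eta> (trunc_prod (real (Suc n)) x y) t
     - h * corr \<eta> (generator \<gamma> 1 (trunc_prod (real (Suc n)) x y)) t\<bar> \<le> h * \<rho> n h)"
    by (intro choice allI corr_generator_step \<eta>) simp
  then obtain \<rho> where \<rho>: "\<And>n. (\<rho> n \<longlongrightarrow> 0) (at_right 0)"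
     "\<And>n t h. t \<ge> 0 \<Longrightarrow> h > 0 \<Longrightarrow> \<bar>corr \<eta> (trunc_prod (real (Suc n)) x y) (t + h) - corr \<eta> (trunc_prod (real (Suc n)) x y) t
     - h * corr \<eta> (generator \<gamma> 1 (trunc_prod (real (Suc n)) x y)) t\<bar> \<le> h * \<rho> n h"
    by blast
  show ?thesis
  proof (rule has_derivative_of_approximations[OF uniform_limit_trunc_prod[OF \<eta>] uniform_limit_generator[OF \<eta>] \<rho>(2) \<rho>(1) _ t])
    show "continuous_on {0..} (\<lambda>t. lattice_gen \<gamma> (\<lambda>x y. pair_corr \<eta> x y t) x y)"
      unfolding lattice_gen_def by (intro continuous_intros continuous_pair_corr \<eta>)
  qed
qed

lemma pair_corr_0: "pair_corr (energy \<beta> z) x y 0 = (if x = z \<and> y = z then 2 / \<beta>\<^sup>2 else 0)"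
proof -
  have m: "(\<lambda>\<xi>. energy \<beta> z \<xi> * (\<xi> x * \<xi> y)) \<in> borel_measurable config_space"
  proof -
    have [measurable]: "(\<lambda>\<xi>. \<xi> i) \<in> borel_measurable config_space" for i
      unfolding config_space_def by (rule measurable_component_singleton) simp
    show ?thesis unfolding energy_def by measurable
  qed
  have "pair_corr (energy \<beta> z) x y 0 = (\<integral>\<xi>. energy \<beta> z \<xi> * (\<xi> x * \<xi> y) \<partial>gibbs \<beta>)"
    unfolding pair_corr_def corr_def init[symmetric]
    by (rule integral_distr[symmetric]) (use m X_measurable[of 0] in auto)
  then show ?thesis by (simp add: gibbs_energy_coordinates[OF beta_pos])
qed

end

section \<open>The lattice system\<close>

definition site_weight :: "int \<Rightarrow> int \<Rightarrow> int \<Rightarrow> int \<Rightarrow> real" where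
  "site_weight a b x y = exp (of_int (\<bar>x - a\<bar> + \<bar>y - b\<bar>))"

lemma exp_1_le_3: "exp (1 :: real) \<le> 3"
  using exp_le by simp

lemma site_weight_le:
  assumes "\<bar>x' - a\<bar> + \<bar>y' - b\<bar> \<le> \<bar>x - a\<bar> + \<bar>y - b\<bar> + int k"
  shows "site_weight a b x' y' \<le> 3 ^ k * site_weight a b x y"
proof -
  have "site_weight a b x' y' \<le> exp (of_int (\<bar>x - a\<bar> + \<bar>y - b\<bar>) + of_nat k)"
  proof -
    have "real_of_int (\<bar>x' - a\<bar> + \<bar>y' - b\<bar>) \<le> of_int (\<bar>x - a\<bar> + \<bar>y - b\<bar> + int k)"
      using assms by (simp only: of_int_le_iff)
    then show ?thesis unfolding site_weight_def exp_le_cancel_iff by simp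
  qed
  also have "\<dots> = exp 1 ^ k * site_weight a b x y"
    by (simp add: exp_add site_weight_def mult.commute flip: exp_of_nat_mult)
  also have "\<dots> \<le> 3 ^ k * site_weight a b x y"
    by (intro mult_right_mono power_mono exp_1_le_3) (auto simp: site_weight_def)
  finally show ?thesis .
qed

text \<open>The weight grows by at most a factor 3 per lattice step. The four drift terms give 12.
  Each of at most four exchanges may move both indices, giving 9 + 1, hence 40 in total. The flips
  give \<open>4 * \<gamma>\<close>.\<close>

lemma lattice_gen_norm_le:
  fixes c :: "int \<Rightarrow> int \<Rightarrow> 'a::real_normed_vector"
  assumes c: "\<And>x y. norm (c x y) \<le> B * site_weight a b x y" and g: "\<gamma> \<ge> 0"
  shows "norm (lattice_gen \<gamma> c x y) \<le> (52 + 4 * \<gamma>) * (B * site_weight a b x y)"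
proof -
  define W where "W = B * site_weight a b x y"
  have sw: "site_weight a b x y > 0" for x y by (simp add: site_weight_def)
  have "0 \<le> B * site_weight a b a b" using c[of a b] norm_ge_zero order_trans by blast
  then have B: "B \<ge> 0" using sw[of a b] by (simp add: zero_le_mult_iff)
  then have W: "W \<ge> 0" using sw[of x y] by (simp add: W_def)
  have n: "norm (c x' y') \<le> 3 ^ k * W" if "\<bar>x' - a\<bar> + \<bar>y' - b\<bar> \<le> \<bar>x - a\<bar> + \<bar>y - b\<bar> + int k" for x' y' k
    using order_trans[OF c[of x' y'] mult_left_mono[OF site_weight_le[OF that] B]] by (simp add: W_def mult_ac)
  have n0: "norm (c x y) \<le> W" using n[of x y 0] by simp
  have n1: "norm (c (x + 1) y) \<le> 3 * W" "norm (c (x - 1) y) \<le> 3 * W" "norm (c x (y + 1)) \<le> 3 * W" "norm (c x (y - 1)) \<le> 3 * W"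
    by (use n[of _ _ 1] in auto)
  have n2: "norm (c (swap_site z x) (swap_site z y) - c x y) \<le> 10 * W" for z
  proof -
    have "norm (c (swap_site z x) (swap_site z y)) \<le> 3 ^ 2 * W"
      by (rule n) (auto simp: swap_site_def)
    with n0 show ?thesis
      using norm_triangle_ineq4[of "c (swap_site z x) (swap_site z y)" "c x y"] by simp
  qed
  have "norm (\<Sum>z\<in>{x - 1, x, y - 1, y}. c (swap_site z x) (swap_site z y) - c x y) \<le> of_nat (card {x - 1, x, y - 1, y}) * (10 * W)"
    by (rule sum_norm_bound) (rule n2)
  also have "\<dots> \<le> of_nat 4 * (10 * W)"
    using card_length[of "[x - 1, x, y - 1, y]"] W by (intro mult_right_mono) auto
  finally have s: "norm (\<Sum>z\<in>{x - 1, x, y - 1, y}. c (swap_site z x) (swap_site z y) - c x y) \<le> 40 * W" by simp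
  have f: "norm ((if x = y then 0 else 4 * \<gamma>) *\<^sub>R c x y) \<le> 4 * \<gamma> * W"
    using g W n0 by (auto intro: mult_left_mono)
  have "norm (lattice_gen \<gamma> c x y) \<le> norm (c (x + 1) y - c (x - 1) y) + norm (c x (y + 1) - c x (y - 1))
      + norm ((if x = y then 0 else 4 * \<gamma>) *\<^sub>R c x y) + norm (\<Sum>z\<in>{x - 1, x, y - 1, y}. c (swap_site z x) (swap_site z y) - c x y)"
    unfolding lattice_gen_def
    by (intro order_trans[OF norm_triangle_ineq] order_trans[OF norm_triangle_ineq4] add_mono order_refl)
  also have "\<dots> \<le> 6 * W + 6 * W + 4 * \<gamma> * W + 40 * W"
    using n1 f s norm_triangle_ineq4[of "c (x + 1) y" "c (x - 1) y"] norm_triangle_ineq4[of "c x (y + 1)" "c x (y - 1)"]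
    by linarith
  also have "\<dots> = (52 + 4 * \<gamma>) * W" by (simp add: algebra_simps)
  finally show ?thesis by (simp add: W_def)
qed

lemma power_over_fact_tendsto_0: "(\<lambda>m. (x::real) ^ m / fact m) \<longlonglongrightarrow> 0"
  using summable_LIMSEQ_zero[OF summable_exp[of x]] by (simp add: divide_inverse mult.commute)

text \<open>Since \<open>lattice_gen\<close> has range one, it is bounded for every exponential weight.  The freedom in
  the centre of the weight yields uniqueness and exponential localization at once.\<close>

lemma lattice_stability:
  fixes D :: "int \<Rightarrow> int \<Rightarrow> real \<Rightarrow> 'a::real_normed_vector"
  assumes deriv: "\<And>x y t. t \<ge> 0 \<Longrightarrow> (D x y has_vector_derivative lattice_gen \<gamma> (\<lambda>x y. D x y t) x y) (at t within {0..})"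
    and bd: "\<And>x y t. 0 \<le> t \<Longrightarrow> t \<le> T \<Longrightarrow> norm (D x y t) \<le> M * site_weight a b x y"
    and init: "\<And>x y. norm (D x y 0) \<le> B * site_weight a b x y"
    and g: "\<gamma> \<ge> 0" and t: "0 \<le> t" "t \<le> T" and M: "M \<ge> 0"
  shows "norm (D x y t) \<le> B * site_weight a b x y * exp ((52 + 4 * \<gamma>) * t)"
proof -
  define C where "C = 52 + 4 * \<gamma>"
  have C: "C > 0" using g by (simp add: C_def)
  \<comment> \<open>Feeding the bound back into the equation and integrating replaces the a priori
    constant \<open>M\<close> by the next term of the exponential series. In the limit
    \<open>M\<close> disappears and only the initial bound \<open>B\<close> is left.\<close>
  have iter: "norm (D x y t) \<le> (B * exp (C * t) + M * (C * t) ^ m / fact m) * site_weight a b x y"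
    if "0 \<le> t" "t \<le> T" for m x y t
    using that
  proof (induction m arbitrary: x y t)
    case 0
    have "0 \<le> B * site_weight a b x y" using init[of x y] norm_ge_zero order_trans by blast
    then have "B \<ge> 0" by (simp add: site_weight_def zero_le_mult_iff)
    then have "M * site_weight a b x y \<le> (B * exp (C * t) + M) * site_weight a b x y"
      by (intro mult_right_mono) (auto simp: site_weight_def)
    with bd[OF 0, of x y] show ?case by simp
  next
    case (Suc m)
    let ?w = "site_weight a b x y"
    define \<phi> where "\<phi> s = (B * exp (C * s) + M * (C * s) ^ Suc m / fact (Suc m)) * ?w" for s
    have \<phi>': "(\<phi> has_real_derivative C * ((B * exp (C * s) + M * (C * s) ^ m / fact m) * ?w)) (at s)" for s
    proof -
      have e: "M * (real (Suc m) * (C * s) ^ m * C) / fact (Suc m) = C * (M * (C * s) ^ m / fact m)"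
        by (simp add: fact_Suc del: of_nat_Suc)
      have "((\<lambda>s. B * exp (C * s) + M * (C * s) ^ Suc m / fact (Suc m)) has_real_derivative
         B * (exp (C * s) * C) + M * (real (Suc m) * (C * s) ^ m * C) / fact (Suc m)) (at s)"
        by (auto intro!: derivative_eq_intros simp del: of_nat_Suc fact_Suc power_Suc)
      from DERIV_cmult_right[OF this[unfolded e], of ?w] show ?thesis
        unfolding \<phi>_def[abs_def] by (simp add: algebra_simps)
    qed
    show ?case
    proof (cases "t = 0")
      case True
      then show ?thesis using init[of x y] by simp
    next
      case False
      then have t: "0 < t" using Suc by simp
      have "norm (D x y t - D x y 0) \<le> \<phi> t - \<phi> 0"
      proof (rule differentiable_bound_general[OF t])
        show "continuous_on {0..t} (D x y)"
          by (rule continuous_on_vector_derivative[OF has_vector_derivative_within_subset[OF deriv]]) auto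
        show "continuous_on {0..t} \<phi>"
          by (rule DERIV_continuous_on[OF has_field_derivative_at_within[OF \<phi>']])
        show "(D x y has_vector_derivative lattice_gen \<gamma> (\<lambda>x y. D x y s) x y) (at s)" if "0 < s" "s < t" for s
        proof -
          have "at s within {0..} = at s" by (rule at_within_interior) (use that in simp)
          then show ?thesis using deriv[of s x y] that by simp
        qed
        show "(\<phi> has_vector_derivative C * ((B * exp (C * s) + M * (C * s) ^ m / fact m) * ?w)) (at s)" if "0 < s" "s < t" for s
          using \<phi>'[of s] by (simp add: has_real_derivative_iff_has_vector_derivative)
        show "norm (lattice_gen \<gamma> (\<lambda>x y. D x y s) x y) \<le> C * ((B * exp (C * s) + M * (C * s) ^ m / fact m) * ?w)" if "0 < s" "s < t" for s
          unfolding C_def by (rule lattice_gen_norm_le[OF Suc.IH[unfolded C_def] g]) (use that Suc.prems in auto)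
      qed
      moreover have "\<phi> 0 = B * ?w" by (simp add: \<phi>_def)
      moreover have "norm (D x y t) \<le> norm (D x y 0) + norm (D x y t - D x y 0)"
        using norm_triangle_ineq[of "D x y 0" "D x y t - D x y 0"] by simp
      ultimately show ?thesis using init[of x y] by (simp add: \<phi>_def)
    qed
  qed
  have "(\<lambda>m. (B * exp (C * t) + M * ((C * t) ^ m / fact m)) * site_weight a b x y)
     \<longlonglongrightarrow> (B * exp (C * t) + M * 0) * site_weight a b x y"
    by (intro tendsto_intros power_over_fact_tendsto_0)
  from LIMSEQ_le_const[OF this, of "norm (D x y t)"] iter[OF t, of x y] show ?thesis
    by (auto simp: C_def mult_ac)
qed

section \<open>Plane waves in the centre of mass\<close>

definition mode_gen :: "real \<Rightarrow> real \<Rightarrow> (nat \<Rightarrow> complex) \<Rightarrow> nat \<Rightarrow> complex" where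
  "mode_gen \<gamma> \<theta> u d =
    (if d = 0 then 2 * \<i> * of_real (2 * sin (\<theta> / 2)) * u 1 - of_real ((2 * sin (\<theta> / 2))\<^sup>2) * u 0
     else if d = 1 then \<i> * of_real (2 * sin (\<theta> / 2)) * (u 2 + u 0) + of_real (2 * cos (\<theta> / 2)) * u 2 - of_real (2 + 4 * \<gamma>) * u 1
     else 2 * cis (\<theta> / 2) * (u (d + 1) + u (d - 1)) - of_real (4 + 4 * \<gamma>) * u d)"

text \<open>\<open>mode_gen\<close> is \<open>lattice_gen\<close> on functions whose dependence on the centre \<open>(x + y) / 2\<close> is a plane
  wave.\<close>

definition wave :: "real \<Rightarrow> (nat \<Rightarrow> complex) \<Rightarrow> int \<Rightarrow> int \<Rightarrow> complex" where
  "wave \<theta> u x y = cis (\<theta> * of_int (x + y) / 2) * u (nat \<bar>y - x\<bar>)"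

lemma mode_gen_0:
  "mode_gen \<gamma> \<theta> u 0 = 2 * \<i> * of_real (2 * sin (\<theta> / 2)) * u 1 - of_real ((2 * sin (\<theta> / 2))\<^sup>2) * u 0"
  by (simp add: mode_gen_def)

lemma mode_gen_1:
  "mode_gen \<gamma> \<theta> u 1 = \<i> * of_real (2 * sin (\<theta> / 2)) * u 0 + 2 * cis (\<theta> / 2) * u 2 - of_real (2 + 4 * \<gamma>) * u 1"
proof -
  have "2 * cis (\<theta> / 2) = of_real (2 * cos (\<theta> / 2)) + \<i> * of_real (2 * sin (\<theta> / 2))" by (simp add: complex_eq_iff)
  then show ?thesis unfolding mode_gen_def by (simp add: algebra_simps)
qed

lemma mode_gen_Suc_Suc:
  "mode_gen \<gamma> \<theta> u (Suc (Suc k)) = 2 * cis (\<theta> / 2) * (u (Suc (Suc (Suc k))) + u (Suc k)) - of_real (4 + 4 * \<gamma>) * u (Suc (Suc k))"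
  by (simp add: mode_gen_def)

lemma lattice_gen_swap: "(\<And>x y. c x y = c y x) \<Longrightarrow> lattice_gen \<gamma> c x y = lattice_gen \<gamma> c y x"
proof -
  assume c: "\<And>x y. c x y = c y x"
  have "{x - 1, x, y - 1, y} = {y - 1, y, x - 1, x}" by auto
  moreover have "c (swap_site z x) (swap_site z y) = c (swap_site z y) (swap_site z x)" for z by (rule c)
  ultimately show ?thesis
    unfolding lattice_gen_def c[of x y] c[of "x + 1" y] c[of "x - 1" y] c[of x "y + 1"] c[of x "y - 1"]
    by (simp add: algebra_simps eq_commute)
qed

text \<open>With \<open>e = cis (\<theta> / 2)\<close> and \<open>e'\<close> its inverse, at
  distance two or more the drift contributes \<open>e - e'\<close> and the exchanges
  \<open>e + e'\<close> to both neighbouring distances. At exchange rate one these add up to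
  \<open>2 * e\<close>, which gives the constant coefficients. On the diagonal each distance-one
  value is reached in two ways, whence the factor 2 in \<open>mode_gen\<close> at 0.\<close>

lemma lattice_gen_wave: "lattice_gen \<gamma> (wave \<theta> u) x y = wave \<theta> (mode_gen \<gamma> \<theta> u) x y"
proof -
  have sym: "wave \<theta> u x y = wave \<theta> u y x" for u x y
    by (simp add: wave_def add.commute abs_minus_commute)
  have main: "lattice_gen \<gamma> (wave \<theta> u) x (x + int d) = wave \<theta> (mode_gen \<gamma> \<theta> u) x (x + int d)" for x d
  proof -
    define e where "e = cis (\<theta> / 2)"
    define e' where "e' = cis (- (\<theta> / 2))"
    define E where "E = cis (\<theta> * of_int (2 * x + int d) / 2)"
    have ee: "e * e' = 1" "e' * e = 1" by (simp_all add: e_def e'_def cis_mult)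
    have s: "\<i> * of_real (2 * sin (\<theta> / 2)) = e - e'" "of_real (2 * cos (\<theta> / 2)) = e + e'"
      by (simp_all add: e_def e'_def complex_eq_iff)
    have shift: "cis (\<theta> * of_int (2 * x + int d + 1) / 2) = E * e" "cis (\<theta> * of_int (2 * x + int d - 1) / 2) = E * e'"
      "cis (\<theta> * of_int (2 * x + int d + 2) / 2) = E * e * e" "cis (\<theta> * of_int (2 * x + int d - 2) / 2) = E * e' * e'"
      by (simp_all add: E_def e_def e'_def cis_mult algebra_simps add_divide_distrib diff_divide_distrib)
    have W: "wave \<theta> v x' y' = F * v k" if "cis (\<theta> * of_int j / 2) = F" "x' + y' = j" "nat \<bar>y' - x'\<bar> = k" for v x' y' j F k
      using that by (simp add: wave_def)
    have s2: "of_real ((2 * sin (\<theta> / 2))\<^sup>2) = - (e - e') * (e - e')"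
      unfolding s(1)[symmetric] by (simp add: power2_eq_square)
    have mg0: "mode_gen \<gamma> \<theta> u 0 = 2 * (e - e') * u 1 + (e - e') * (e - e') * u 0"
      unfolding mode_gen_def s(1)[symmetric] s2 by (simp add: algebra_simps flip: s(1))
    have mg1: "mode_gen \<gamma> \<theta> u 1 = (e - e') * (u 2 + u 0) + (e + e') * u 2 - of_real (2 + 4 * \<gamma>) * u 1"
      unfolding mode_gen_def s by simp
    have mgk: "mode_gen \<gamma> \<theta> u (Suc (Suc k)) = 2 * e * (u (Suc (Suc (Suc k))) + u (Suc k)) - of_real (4 + 4 * \<gamma>) * u (Suc (Suc k))" for k
      unfolding mode_gen_def e_def by simp
    have eez: "e * (e' * z) = z" "e' * (e * z) = z" for z using ee by (simp_all flip: mult.assoc)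
    consider "d = 0" | "d = 1" | k where "d = Suc (Suc k)" by (cases d rule: nat.exhaust; metis One_nat_def not0_implies_Suc)
    then show ?thesis
    proof cases
      case 1
      have S: "{x - 1, x, (x + int d) - 1, x + int d} = {x - 1, x}" using 1 by auto
      show ?thesis
        unfolding lattice_gen_def S using 1
        by (simp add: swap_site_def W[where k=1, OF shift(1)] W[where k=1, OF shift(2)] W[where k=0, OF shift(3)]
            W[where k=0, OF shift(4)] W[where k=0, OF E_def[symmetric]] mg0 ee eez algebra_simps)
    next
      case 2
      \<comment> \<open>At distance one the exchange across the middle bond merely swaps the two
        sites and fixes the symmetric wave. Two exchanges remain, so the diagonal coefficient is
        \<open>2 + 4 * \<gamma>\<close> here and \<open>4 + 4 * \<gamma>\<close> farther
        out.\<close>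
      have S: "{x - 1, x, (x + int d) - 1, x + int d} = {x - 1, x, x + 1}" using 2 by auto
      show ?thesis
        unfolding lattice_gen_def S using 2
        by (simp add: swap_site_def W[where k=2, OF shift(1)] W[where k=2, OF shift(2)] W[where k=0, OF shift(1)] W[where k=0, OF shift(2)]
            W[where k=1, OF E_def[symmetric]] mg1[unfolded One_nat_def] mg1 algebra_simps scaleR_conv_of_real)
    next
      case (3 k)
      have S: "(\<Sum>z\<in>{x - 1, x, (x + int d) - 1, x + int d}. g z) = g (x - 1) + g x + g (x + int d - 1) + g (x + int d)" for g :: "int \<Rightarrow> complex"
        using 3 by (simp add: add.assoc)
      show ?thesis
        unfolding lattice_gen_def S using 3
        by (simp add: swap_site_def W[where k="d + 1", OF shift(1)] W[where k="d + 1", OF shift(2)] W[where k="d - 1", OF shift(1)] W[where k="d - 1", OF shift(2)]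
            W[where k=d, OF E_def[symmetric]] mgk algebra_simps scaleR_conv_of_real)
    qed
  qed
  show ?thesis
  proof (cases "x \<le> y")
    case True
    then show ?thesis using main[of x "nat (y - x)"] by simp
  next
    case False
    have "lattice_gen \<gamma> (wave \<theta> u) x y = lattice_gen \<gamma> (wave \<theta> u) y x" by (rule lattice_gen_swap) (rule sym)
    also have "\<dots> = wave \<theta> (mode_gen \<gamma> \<theta> u) y x" using main[of y "nat (x - y)"] False by simp
    finally show ?thesis by (simp add: sym)
  qed
qed

text \<open>The rows at positive distance are the largest and give
  \<open>2 * (1 + 3) + 4 + 4 * \<gamma>\<close>. The exponential weight makes
  \<open>mode_sol\<close> decay in the distance, which later removes the boundary terms of cut-off
  sums.\<close>

lemma mode_gen_norm_le:
  assumes u: "\<And>d. norm (u d) \<le> B * exp (- real d)" and g: "\<gamma> \<ge> 0"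
  shows "norm (mode_gen \<gamma> \<theta> u d) \<le> (12 + 4 * \<gamma>) * B * exp (- real d)"
proof -
  define W where "W = B * exp (- real d)"
  have "0 \<le> B" using order_trans[OF norm_ge_zero u[of 0]] by simp
  then have W: "W \<ge> 0" by (simp add: W_def)
  have up: "norm (u (Suc d)) \<le> W"
    using \<open>0 \<le> B\<close> by (intro order_trans[OF u]) (auto simp: W_def intro!: mult_left_mono)
  have down: "norm (u (d - 1)) \<le> 3 * W" if "d \<ge> 1"
  proof -
    have "exp (- real (d - 1)) = exp 1 * exp (- real d)"
      using that by (simp add: of_nat_diff flip: exp_add)
    also have "\<dots> \<le> 3 * exp (- real d)" using exp_1_le_3 by (rule mult_right_mono) simp
    finally show ?thesis
      using order_trans[OF u[of "d - 1"] mult_left_mono[OF _ \<open>0 \<le> B\<close>]] by (simp add: W_def mult.left_commute)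
  qed
  have n: "norm (u d) \<le> W" unfolding W_def by (rule u)
  define \<sigma> where "\<sigma> = 2 * sin (\<theta> / 2)"
  define a where "a = 2 * cos (\<theta> / 2)"
  have \<sigma>: "\<bar>\<sigma>\<bar> \<le> 2" and a: "\<bar>a\<bar> \<le> 2" by (simp_all add: \<sigma>_def a_def abs_mult)
  have \<sigma>2: "\<sigma>\<^sup>2 \<le> 4" using \<sigma> by (metis abs_le_square_iff abs_numeral power2_eq_square mult_2 numeral_Bit0 numeral_times_numeral semiring_norm(11) semiring_norm(13))
  have "norm (mode_gen \<gamma> \<theta> u d) \<le> (12 + 4 * \<gamma>) * W"
  proof -
    consider "d = 0" | "d = 1" | "d \<ge> 2" by linarith
    then show ?thesis
    proof cases
      case 1
      have "norm (mode_gen \<gamma> \<theta> u d) \<le> 2 * \<bar>\<sigma>\<bar> * norm (u 1) + \<sigma>\<^sup>2 * norm (u 0)"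
        using 1 norm_triangle_ineq4[of "2 * \<i> * of_real \<sigma> * u 1" "of_real (\<sigma>\<^sup>2) * u 0"]
        unfolding mode_gen_def \<sigma>_def[symmetric] by (simp add: norm_mult norm_power)
      also have "\<dots> \<le> 2 * 2 * W + 4 * W"
        using up n 1 W \<sigma> \<sigma>2 by (intro add_mono mult_mono) auto
      finally show ?thesis using mult_nonneg_nonneg[OF g W] W by (simp add: algebra_simps)
    next
      case 2
      have "norm (mode_gen \<gamma> \<theta> u d) \<le> norm (\<i> * of_real \<sigma> * (u 2 + u 0)) + norm (of_real a * u 2) + norm (of_real (2 + 4 * \<gamma>) * u 1)"
        using 2 unfolding mode_gen_def \<sigma>_def[symmetric] a_def[symmetric]
        by (simp del: of_real_add of_real_mult) (intro order_trans[OF norm_triangle_ineq4] add_mono norm_triangle_ineq order_refl)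
      also have "\<dots> \<le> 2 * (W + 3 * W) + 2 * W + (2 + 4 * \<gamma>) * W"
        unfolding norm_mult using up n down 2 W \<sigma> a g
        by (intro add_mono mult_mono) (auto simp: numeral_2_eq_2 simp del: of_real_add intro!: order_trans[OF norm_triangle_ineq])
      finally show ?thesis by (simp add: algebra_simps)
    next
      case 3
      have "norm (mode_gen \<gamma> \<theta> u d) \<le> norm (2 * cis (\<theta> / 2) * (u (d + 1) + u (d - 1))) + norm (of_real (4 + 4 * \<gamma>) * u d)"
        using 3 unfolding mode_gen_def by (simp del: of_real_add of_real_mult) (intro norm_triangle_ineq4)
      also have "\<dots> \<le> 2 * (W + 3 * W) + (4 + 4 * \<gamma>) * W"
        unfolding norm_mult using up n down 3 W g
        by (intro add_mono mult_mono) (auto simp del: of_real_add intro!: order_trans[OF norm_triangle_ineq])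
      finally show ?thesis by (simp add: algebra_simps)
    qed
  qed
  then show ?thesis by (simp add: W_def mult.assoc)
qed

text \<open>Powers of \<open>mode_gen\<close> applied to the unit vector at distance 0. The
  exponential series built from them in \<open>mode_sol\<close> is the semigroup of this bounded
  operator acting on that vector.\<close>

primrec mode_coeff :: "real \<Rightarrow> real \<Rightarrow> nat \<Rightarrow> nat \<Rightarrow> complex" where
  "mode_coeff \<gamma> \<theta> 0 = (\<lambda>d. if d = 0 then 1 else 0)"
| "mode_coeff \<gamma> \<theta> (Suc m) = mode_gen \<gamma> \<theta> (mode_coeff \<gamma> \<theta> m)"

definition mode_sol :: "real \<Rightarrow> real \<Rightarrow> real \<Rightarrow> nat \<Rightarrow> complex" where
  "mode_sol \<gamma> \<theta> t d = (\<Sum>m. mode_coeff \<gamma> \<theta> m d / fact m * of_real t ^ m)"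

context
  fixes \<gamma> :: real
  assumes \<gamma>: "\<gamma> \<ge> 0"
begin

lemma mode_coeff_norm_le: "norm (mode_coeff \<gamma> \<theta> m d) \<le> (12 + 4 * \<gamma>) ^ m * exp (- real d)"
proof (induction m arbitrary: d)
  case (Suc m)
  from mode_gen_norm_le[OF Suc.IH \<gamma>] show ?case by (simp add: mult_ac)
qed simp

lemma mode_term_norm_le:
  "norm (mode_coeff \<gamma> \<theta> m d / fact m * z ^ m) \<le> exp (- real d) * (inverse (fact m) * ((12 + 4 * \<gamma>) * norm z) ^ m)"
  using mult_right_mono[OF mode_coeff_norm_le[of \<theta> m d], of "inverse (fact m) * norm z ^ m"]
  by (simp add: norm_mult norm_inverse norm_power power_mult_distrib divide_inverse mult_ac)

lemma summable_mode: "summable (\<lambda>m. norm (mode_coeff \<gamma> \<theta> m d / fact m * z ^ m))"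
  by (rule summable_comparison_test'[OF summable_mult[OF summable_exp]]) (use mode_term_norm_le in auto)

lemma mode_sol_norm_le: "norm (mode_sol \<gamma> \<theta> t d) \<le> exp (- real d) * exp ((12 + 4 * \<gamma>) * \<bar>t\<bar>)"
proof -
  have "norm (mode_sol \<gamma> \<theta> t d) \<le> (\<Sum>m. norm (mode_coeff \<gamma> \<theta> m d / fact m * of_real t ^ m))"
    unfolding mode_sol_def by (rule summable_norm[OF summable_mode])
  also have "\<dots> \<le> (\<Sum>m. exp (- real d) * (inverse (fact m) * ((12 + 4 * \<gamma>) * \<bar>t\<bar>) ^ m))"
    by (intro suminf_le summable_mode summable_mult summable_exp) (use mode_term_norm_le[of \<theta> _ d "of_real t"] in simp)
  also have "\<dots> = exp (- real d) * exp ((12 + 4 * \<gamma>) * \<bar>t\<bar>)"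
    by (subst suminf_mult[OF summable_exp]) (simp add: exp_def divide_inverse mult.commute scaleR_conv_of_real)
  finally show ?thesis .
qed

lemma mode_sol_norm_le_uniform:
  assumes "0 \<le> s" "s \<le> t"
  shows "norm (mode_sol \<gamma> \<theta> s d) \<le> exp (- real d) * exp ((12 + 4 * \<gamma>) * t)"
proof -
  have "exp (- real d) * exp ((12 + 4 * \<gamma>) * \<bar>s\<bar>) \<le> exp (- real d) * exp ((12 + 4 * \<gamma>) * t)"
    using assms \<gamma> by (intro mult_left_mono) (auto intro!: mult_left_mono)
  then show ?thesis by (rule order_trans[OF mode_sol_norm_le])
qed

lemma mode_sol_0: "mode_sol \<gamma> \<theta> 0 d = (if d = 0 then 1 else 0)"
  unfolding mode_sol_def using powser_zero[of "\<lambda>m. mode_coeff \<gamma> \<theta> m d / fact m"] by simp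

text \<open>An entry of \<open>mode_gen\<close> involves at most three entries of its argument, so
  \<open>mode_gen\<close> may be applied to the series term by term.\<close>

lemma mode_sol_gen: "(\<Sum>m. mode_coeff \<gamma> \<theta> (Suc m) d / fact m * of_real t ^ m) = mode_gen \<gamma> \<theta> (mode_sol \<gamma> \<theta> t) d"
proof -
  have h: "(\<lambda>m. mode_coeff \<gamma> \<theta> m d / fact m * of_real t ^ m) sums mode_sol \<gamma> \<theta> t d" for d
    unfolding mode_sol_def by (rule summable_sums[OF summable_norm_cancel[OF summable_mode]])
  have "(\<lambda>m. mode_gen \<gamma> \<theta> (\<lambda>d. mode_coeff \<gamma> \<theta> m d / fact m * of_real t ^ m) d) sums mode_gen \<gamma> \<theta> (mode_sol \<gamma> \<theta> t) d"
    unfolding mode_gen_def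
    by (cases "d = 0"; cases "d = 1") (simp_all only: if_True if_False simp_thms, (intro sums_add sums_diff sums_mult h)+)
  moreover have "mode_gen \<gamma> \<theta> (\<lambda>d. mode_coeff \<gamma> \<theta> m d / fact m * of_real t ^ m) d = mode_coeff \<gamma> \<theta> (Suc m) d / fact m * of_real t ^ m" for m
    unfolding mode_coeff.simps mode_gen_def by (simp add: field_simps)
  ultimately show ?thesis using sums_unique by fastforce
qed

lemma mode_sol_deriv:
  "((\<lambda>t. mode_sol \<gamma> \<theta> t d) has_vector_derivative mode_gen \<gamma> \<theta> (mode_sol \<gamma> \<theta> t) d) (at t within S)"
proof -
  let ?c = "\<lambda>m. mode_coeff \<gamma> \<theta> m d / fact m"
  have "((\<lambda>z. \<Sum>m. ?c m * z ^ m) has_field_derivative (\<Sum>m. diffs ?c m * of_real t ^ m)) (at (of_real t))"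
    by (rule termdiffs_strong_converges_everywhere) (rule summable_norm_cancel[OF summable_mode])
  moreover have "diffs ?c = (\<lambda>m. mode_coeff \<gamma> \<theta> (Suc m) d / fact m)"
    by (rule ext) (simp add: diffs_def del: of_nat_Suc mode_coeff.simps)
  ultimately have "((\<lambda>z. \<Sum>m. ?c m * z ^ m) has_field_derivative mode_gen \<gamma> \<theta> (mode_sol \<gamma> \<theta> t) d) (at (of_real t))"
    using mode_sol_gen[of \<theta> d t] by simp
  from has_vector_derivative_real_field[OF this] show ?thesis
    by (simp add: mode_sol_def)
qed

end

text \<open>All that is kept of the process. The index \<open>z\<close> is the site of the energy at
  time 0, and the uniform bound singles out the solution.\<close>

locale lattice_flow =
  fixes \<gamma> A :: real and c :: "int \<Rightarrow> int \<Rightarrow> int \<Rightarrow> real \<Rightarrow> real"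
  assumes gamma_nonneg: "\<gamma> \<ge> 0"
    and deriv: "t \<ge> 0 \<Longrightarrow> (c z x y has_real_derivative lattice_gen \<gamma> (\<lambda>x y. c z x y t) x y) (at t within {0..})"
    and bounded: "t \<ge> 0 \<Longrightarrow> \<bar>c z x y t\<bar> \<le> A"
    and init: "c z x y 0 = (if x = z \<and> y = z then 1 else 0)"
begin

lemma site_weight_ge_1: "1 \<le> site_weight a b x y"
  by (simp add: site_weight_def)

lemma A_nonneg: "A \<ge> 0"
  using bounded[of 0 0 0 0] by simp

text \<open>The weight is centred at the point \<open>(x, x)\<close> of evaluation, where it equals
  1. The source at \<open>(z, z)\<close> has weight \<open>exp (2 * \<bar>x - z\<bar>)\<close>
  there, so the initial datum is dominated by the weight with a correspondingly small
  constant.\<close>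

lemma flow_decay:
  assumes t: "t \<ge> 0"
  shows "\<bar>c z x x t\<bar> \<le> exp (- 2 * of_int \<bar>x - z\<bar>) * exp ((52 + 4 * \<gamma>) * t)"
proof -
  have "norm (c z x x t) \<le> exp (- 2 * of_int \<bar>x - z\<bar>) * site_weight x x x x * exp ((52 + 4 * \<gamma>) * t)"
  proof (rule lattice_stability[where D="c z" and T=t and M=A])
    show "(c z x' y' has_vector_derivative lattice_gen \<gamma> (\<lambda>x y. c z x y s) x' y') (at s within {0..})" if "s \<ge> 0" for s x' y'
      using deriv[OF that] by (simp add: has_real_derivative_iff_has_vector_derivative)
    show "norm (c z x' y' s) \<le> A * site_weight x x x' y'" if "0 \<le> s" for s x' y'
      using order_trans[OF bounded[OF that] mult_left_mono[OF site_weight_ge_1 A_nonneg, unfolded mult_1_right]] by simp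
    show "norm (c z x' y' 0) \<le> exp (- 2 * of_int \<bar>x - z\<bar>) * site_weight x x x' y'" for x' y'
      by (auto simp: init site_weight_def abs_minus_commute simp flip: exp_add)
  qed (use t gamma_nonneg A_nonneg in auto)
  then show ?thesis by (simp add: site_weight_def)
qed

text \<open>Superposing the sources with phases \<open>cis (\<theta> * z)\<close> and the wave
  solution obey the same linear system. Initially they differ only on diagonal points beyond
  \<open>N\<close>, where the weight centred at 0 is at least \<open>exp (2 * N)\<close>; stability
  carries the factor \<open>exp (- 2 * N)\<close> to time \<open>t\<close>.\<close>

lemma flow_wave_sum:
  assumes t: "t \<ge> 0"
  shows "norm ((\<Sum>z\<in>{- int N..int N}. cis (\<theta> * of_int z) * of_real (c z x x t)) - cis (\<theta> * of_int x) * mode_sol \<gamma> \<theta> t 0)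
    \<le> exp (- 2 * real N) * exp (2 * of_int \<bar>x\<bar>) * exp ((52 + 4 * \<gamma>) * t)"
proof -
  define D where "D x y s = (\<Sum>z\<in>{- int N..int N}. cis (\<theta> * of_int z) * of_real (c z x y s)) - wave \<theta> (mode_sol \<gamma> \<theta> s) x y" for x y s
  have lin: "lattice_gen \<gamma> (\<lambda>x y. D x y s) x y = (\<Sum>z\<in>{- int N..int N}. cis (\<theta> * of_int z) * of_real (lattice_gen \<gamma> (\<lambda>x y. c z x y s) x y))
      - lattice_gen \<gamma> (wave \<theta> (mode_sol \<gamma> \<theta> s)) x y" for x y s
  proof -
    have 1: "lattice_gen \<gamma> (\<lambda>x y. p x y - q x y) x y = lattice_gen \<gamma> p x y - lattice_gen \<gamma> q x y" for p q :: "int \<Rightarrow> int \<Rightarrow> complex"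
      unfolding lattice_gen_def by (simp add: sum_subtractf sum.distrib scaleR_diff_right algebra_simps)
    have 2: "lattice_gen \<gamma> (\<lambda>x y. \<Sum>z\<in>I. p z x y) x y = (\<Sum>z\<in>I. lattice_gen \<gamma> (p z) x y)" for p :: "int \<Rightarrow> int \<Rightarrow> int \<Rightarrow> complex" and I
      unfolding lattice_gen_def sum_subtractf sum.distrib scaleR_sum_right by (simp add: sum.swap[of _ I] sum_distrib_left)
    have 3: "lattice_gen \<gamma> (\<lambda>x y. k * of_real (p x y)) x y = k * of_real (lattice_gen \<gamma> p x y)" for p and k :: complex
      unfolding lattice_gen_def by (simp add: algebra_simps sum_distrib_left sum_subtractf scaleR_conv_of_real)
    show ?thesis unfolding D_def 1 2 3 ..
  qed
  have wv: "((\<lambda>s. wave \<theta> (mode_sol \<gamma> \<theta> s) x y) has_vector_derivative lattice_gen \<gamma> (wave \<theta> (mode_sol \<gamma> \<theta> s)) x y) (at s within {0..})" for x y s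
    unfolding lattice_gen_wave unfolding wave_def
    by (intro has_vector_derivative_mult_right mode_sol_deriv gamma_nonneg)
  have "norm (D x x t) \<le> exp (- 2 * real N) * site_weight 0 0 x x * exp ((52 + 4 * \<gamma>) * t)"
  proof (rule lattice_stability[where D=D and T=t and M="(2 * real N + 1) * A + exp ((12 + 4 * \<gamma>) * t)"])
    show "(D x' y' has_vector_derivative lattice_gen \<gamma> (\<lambda>x y. D x y s) x' y') (at s within {0..})" if "s \<ge> 0" for s x' y'
      unfolding lin unfolding D_def
      using deriv[OF that]
      by (intro has_vector_derivative_diff has_vector_derivative_sum has_vector_derivative_mult_right wv has_vector_derivative_of_real)
         (auto simp: has_real_derivative_iff_has_vector_derivative)
    show "norm (D x' y' s) \<le> ((2 * real N + 1) * A + exp ((12 + 4 * \<gamma>) * t)) * site_weight 0 0 x' y'" if "0 \<le> s" "s \<le> t" for s x' y'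
    proof -
      have "norm (\<Sum>z\<in>{- int N..int N}. cis (\<theta> * of_int z) * of_real (c z x' y' s)) \<le> of_nat (card {- int N..int N}) * A"
        by (rule sum_norm_bound) (use bounded[OF that(1)] in \<open>simp add: norm_mult\<close>)
      also have "of_nat (card {- int N..int N}) * A = (2 * real N + 1) * A" by simp
      finally have 1: "norm (\<Sum>z\<in>{- int N..int N}. cis (\<theta> * of_int z) * of_real (c z x' y' s)) \<le> (2 * real N + 1) * A" .
      have "norm (wave \<theta> (mode_sol \<gamma> \<theta> s) x' y') \<le> exp (- real (nat \<bar>y' - x'\<bar>)) * exp ((12 + 4 * \<gamma>) * t)"
        unfolding wave_def norm_mult norm_cis mult_1_left by (rule mode_sol_norm_le_uniform[OF gamma_nonneg that])
      also have "\<dots> \<le> 1 * exp ((12 + 4 * \<gamma>) * t)" by (intro mult_right_mono) auto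
      finally have 2: "norm (wave \<theta> (mode_sol \<gamma> \<theta> s) x' y') \<le> exp ((12 + 4 * \<gamma>) * t)" by simp
      have "norm (D x' y' s) \<le> (2 * real N + 1) * A + exp ((12 + 4 * \<gamma>) * t)"
        unfolding D_def using 1 2 by (intro order_trans[OF norm_triangle_ineq4] add_mono)
      also have "\<dots> \<le> ((2 * real N + 1) * A + exp ((12 + 4 * \<gamma>) * t)) * site_weight 0 0 x' y'"
        using mult_left_mono[OF site_weight_ge_1[of 0 0 x' y'], of "(2 * real N + 1) * A + exp ((12 + 4 * \<gamma>) * t)"] A_nonneg by simp
      finally show ?thesis .
    qed
    show "norm (D x' y' 0) \<le> exp (- 2 * real N) * site_weight 0 0 x' y'" for x' y'
    proof -
      have "(\<Sum>z\<in>{- int N..int N}. cis (\<theta> * of_int z) * of_real (c z x' y' 0))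
         = (\<Sum>z\<in>{- int N..int N}. if z = x' then (if x' = y' then cis (\<theta> * of_int x') else 0) else 0)"
        by (rule sum.cong) (auto simp: init)
      also have "\<dots> = (if x' \<in> {- int N..int N} \<and> x' = y' then cis (\<theta> * of_int x') else 0)" by auto
      finally have s: "(\<Sum>z\<in>{- int N..int N}. cis (\<theta> * of_int z) * of_real (c z x' y' 0)) = \<dots>" .
      have w: "wave \<theta> (mode_sol \<gamma> \<theta> 0) x' y' = (if x' = y' then cis (\<theta> * of_int x') else 0)"
        by (auto simp: wave_def mode_sol_0[OF gamma_nonneg])
      have "D x' y' 0 = (if x' = y' \<and> x' \<notin> {- int N..int N} then - cis (\<theta> * of_int x') else 0)"
        unfolding D_def s w by auto
      moreover have "1 \<le> exp (- 2 * real N) * site_weight 0 0 x' y'" if "x' = y'" "x' \<notin> {- int N..int N}"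
      proof -
        have "real N \<le> real_of_int \<bar>x'\<bar>" using that by auto
        then show ?thesis using that by (simp add: site_weight_def flip: exp_add)
      qed
      ultimately show ?thesis by (auto simp: site_weight_def)
    qed
  qed (use t gamma_nonneg A_nonneg in auto)
  then show ?thesis by (simp add: D_def wave_def site_weight_def)
qed

end

section \<open>Approximate eigenvectors\<close>

text \<open>Each positive distance carries weight 2, as it stands for the two ordered pairs. With
  these weights the coupling between distances 0 and 1 is skew and drops out of the real part. The
  remaining couplings are absorbed by the diagonal, except for the flux through the cut at
  \<open>Suc N\<close>.\<close>

lemma mode_gen_energy:
  assumes g: "\<gamma> \<ge> 0"
  shows "2 * Re (cnj (u 0) * mode_gen \<gamma> \<theta> u 0) + 4 * (\<Sum>d=1..Suc N. Re (cnj (u d) * mode_gen \<gamma> \<theta> u d))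
    \<le> 4 * Re (2 * cis (\<theta> / 2) * cnj (u (Suc N)) * u (Suc (Suc N))) - 8 * (norm (u (Suc N)))\<^sup>2"
proof -
  define \<sigma> where "\<sigma> = 2 * sin (\<theta> / 2)"
  define a where "a = 2 * cos (\<theta> / 2)"
  define w where "w = 2 * cis (\<theta> / 2)"
  have w: "w = Complex a \<sigma>" by (simp add: w_def a_def \<sigma>_def complex_eq_iff)
  have a: "\<bar>a\<bar> \<le> 2" by (simp add: a_def abs_mult)
  note m0 = mode_gen_0[of \<gamma> \<theta> u, folded \<sigma>_def]
  note m1 = mode_gen_1[of \<gamma> \<theta> u, folded \<sigma>_def w_def]
  note mk = mode_gen_Suc_Suc[of \<gamma> \<theta> u, folded w_def]
  have "2 * Re (cnj (u 0) * mode_gen \<gamma> \<theta> u 0) + 4 * (\<Sum>d=1..Suc N. Re (cnj (u d) * mode_gen \<gamma> \<theta> u d))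
    \<le> 4 * Re (w * cnj (u (Suc N)) * u (Suc (Suc N))) - 8 * (norm (u (Suc N)))\<^sup>2"
  proof (induction N)
    case 0
    have "2 * Re (cnj (u 0) * mode_gen \<gamma> \<theta> u 0) + 4 * Re (cnj (u 1) * mode_gen \<gamma> \<theta> u 1)
      = 4 * Re (w * cnj (u 1) * u 2) - 2 * \<sigma>\<^sup>2 * (norm (u 0))\<^sup>2 - 4 * (2 + 4 * \<gamma>) * (norm (u 1))\<^sup>2"
      unfolding m0 m1 cmod_power2 by (simp add: algebra_simps power2_eq_square)
    also have "\<dots> \<le> 4 * Re (w * cnj (u 1) * u 2) - 8 * (norm (u 1))\<^sup>2"
      using mult_nonneg_nonneg[OF g zero_le_power2[of "norm (u 1)"]] mult_nonneg_nonneg[OF zero_le_power2[of \<sigma>] zero_le_power2[of "norm (u 0)"]]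
      by (simp add: algebra_simps)
    finally show ?case by (simp add: numeral_2_eq_2)
  next
    case (Suc N)
    let ?p = "u (Suc N)" and ?q = "u (Suc (Suc N))" and ?r = "u (Suc (Suc (Suc N)))"
    have s: "4 * (\<Sum>d=1..Suc (Suc N). Re (cnj (u d) * mode_gen \<gamma> \<theta> u d))
      = 4 * (\<Sum>d=1..Suc N. Re (cnj (u d) * mode_gen \<gamma> \<theta> u d)) + 4 * Re (cnj ?q * mode_gen \<gamma> \<theta> u (Suc (Suc N)))"
      by simp
    have q: "Re (cnj ?q * mode_gen \<gamma> \<theta> u (Suc (Suc N))) = Re (w * cnj ?q * ?r) + Re (w * cnj ?q * ?p) - (4 + 4 * \<gamma>) * (norm ?q)\<^sup>2"
      unfolding mk cmod_power2 by (simp add: algebra_simps power2_eq_square)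
    \<comment> \<open>The imaginary part \<open>\<sigma>\<close> of \<open>w\<close> cancels between
      the two directions; only the real part \<open>a\<close>, of size at most 2, survives.\<close>
    have "Re (w * cnj ?p * ?q) + Re (w * cnj ?q * ?p) = a * (2 * Re (cnj ?p * ?q))"
      unfolding w by (simp add: algebra_simps)
    also have "\<dots> \<le> 2 * (2 * (norm ?p * norm ?q))"
    proof -
      have "a * (2 * Re (cnj ?p * ?q)) \<le> \<bar>a\<bar> * (2 * \<bar>Re (cnj ?p * ?q)\<bar>)"
        by (metis abs_ge_self abs_mult abs_numeral)
      also have "\<dots> \<le> 2 * (2 * norm (cnj ?p * ?q))"
        using a by (intro mult_mono abs_Re_le_cmod order_refl) auto
      finally show ?thesis by (simp add: norm_mult)
    qed
    also have "\<dots> \<le> 2 * (norm ?p)\<^sup>2 + 2 * (norm ?q)\<^sup>2"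
      using zero_le_power2[of "norm ?p - norm ?q"] by (simp add: power2_diff)
    finally have "Re (w * cnj ?p * ?q) + Re (w * cnj ?q * ?p) \<le> 2 * (norm ?p)\<^sup>2 + 2 * (norm ?q)\<^sup>2" .
    moreover have "(4 + 4 * \<gamma>) * (norm ?q)\<^sup>2 \<ge> 4 * (norm ?q)\<^sup>2" using g by (intro mult_right_mono) auto
    moreover have "F + 4 * (A3 + A2 - R) \<le> 4 * A3 - 8 * Q"
      if "A1 + A2 \<le> 2 * P + 2 * Q" "R \<ge> 4 * Q" "F \<le> 4 * A1 - 8 * P" for A1 A2 A3 P Q R F :: real
      using that by argo
    ultimately show ?case unfolding s q add.assoc[symmetric] using Suc by (simp only:)
  qed
  then show ?thesis by (simp only: w_def)
qed

lemma has_derivative_norm_sq: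
  fixes f :: "real \<Rightarrow> complex"
  assumes "(f has_vector_derivative f') (at t within S)"
  shows "((\<lambda>t. (norm (f t))\<^sup>2) has_real_derivative 2 * Re (cnj (f t) * f')) (at t within S)"
proof -
  have "((\<lambda>t. Re (f t)) has_real_derivative Re f') (at t within S)" "((\<lambda>t. Im (f t)) has_real_derivative Im f') (at t within S)"
    using bounded_linear.has_vector_derivative[OF bounded_linear_Re assms] bounded_linear.has_vector_derivative[OF bounded_linear_Im assms]
    by (auto simp: has_real_derivative_iff_has_vector_derivative)
  from DERIV_add[OF DERIV_power[OF this(1), of 2] DERIV_power[OF this(2), of 2]]
  show ?thesis by (simp add: cmod_power2 algebra_simps)
qed

lemma growth_bound:
  fixes f :: "real \<Rightarrow> 'a::real_normed_vector"
  assumes f: "\<And>s. 0 \<le> s \<Longrightarrow> s \<le> t \<Longrightarrow> (f has_vector_derivative f' s) (at s)"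
    and b: "\<And>s. 0 \<le> s \<Longrightarrow> s \<le> t \<Longrightarrow> norm (f' s) \<le> B" and t: "t \<ge> 0"
  shows "norm (f t - f 0) \<le> B * t"
proof -
  have "norm (f t - f 0) \<le> B * norm (t - 0)"
  proof (rule differentiable_bound[of "{0..t}" f "\<lambda>s h. h *\<^sub>R f' s"])
    show "(f has_derivative (\<lambda>h. h *\<^sub>R f' s)) (at s within {0..t})" if "s \<in> {0..t}" for s
      using has_vector_derivative_at_within[OF f, of s "{0..t}"] that by (simp add: has_vector_derivative_def)
    show "onorm (\<lambda>h. h *\<^sub>R f' s) \<le> B" if "s \<in> {0..t}" for s
    proof (rule onorm_le)
      fix h show "norm (h *\<^sub>R f' s) \<le> B * norm h"
        using mult_right_mono[OF b[of s], of "norm h"] that by (simp add: mult.commute)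
    qed
  qed (use t in auto)
  then show ?thesis using t by simp
qed

text \<open>A finite energy can grow only through the flux at its cut, which is at most a constant
  times \<open>exp (- n)\<close> by the decay of \<open>mode_sol\<close>. Letting the cut go to
  infinity leaves the initial energy 1.\<close>

lemma mode_sol_energy_le:
  assumes g: "\<gamma> \<ge> 0" and t: "t \<ge> 0"
  shows "(norm (mode_sol \<gamma> \<theta> t 0))\<^sup>2 + 2 * (\<Sum>d=1..N. (norm (mode_sol \<gamma> \<theta> t d))\<^sup>2) \<le> 1"
proof -
  define u where "u s d = mode_sol \<gamma> \<theta> s d" for s d
  define E where "E N s = (norm (u s 0))\<^sup>2 + 2 * (\<Sum>d=1..N. (norm (u s d))\<^sup>2)" for N s
  define K where "K = exp ((12 + 4 * \<gamma>) * t)"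
  have ub: "norm (u s d) \<le> exp (- real d) * K" if "0 \<le> s" "s \<le> t" for s d
    unfolding u_def K_def by (rule mode_sol_norm_le_uniform[OF g that])
  have K: "K > 0" by (simp add: K_def)
  define E' where "E' n s = 2 * Re (cnj (u s 0) * mode_gen \<gamma> \<theta> (u s) 0)
      + 4 * (\<Sum>d=1..Suc n. Re (cnj (u s d) * mode_gen \<gamma> \<theta> (u s) d))" for n s
  have dE: "(E (Suc n) has_real_derivative E' n s) (at s)" for n s
  proof -
    have du: "((\<lambda>s. (norm (u s d))\<^sup>2) has_real_derivative 2 * Re (cnj (u s d) * mode_gen \<gamma> \<theta> (u s) d)) (at s)" for d
      unfolding u_def by (rule has_derivative_norm_sq[OF mode_sol_deriv[OF g]])
    have "(E (Suc n) has_real_derivative 2 * Re (cnj (u s 0) * mode_gen \<gamma> \<theta> (u s) 0)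
      + 2 * (\<Sum>d=1..Suc n. 2 * Re (cnj (u s d) * mode_gen \<gamma> \<theta> (u s) d))) (at s)"
      unfolding E_def[abs_def] by (intro DERIV_add DERIV_cmult DERIV_sum du)
    then show ?thesis unfolding E'_def by (simp only: sum_distrib_left[symmetric] mult.assoc[symmetric]) simp
  qed
  have E'_le: "E' n s \<le> 8 * (exp (- real n) * K) * K" if "0 \<le> s" "s \<le> t" for n s
  proof -
    have "E' n s \<le> 4 * Re (2 * cis (\<theta> / 2) * cnj (u s (Suc n)) * u s (Suc (Suc n))) - 8 * (norm (u s (Suc n)))\<^sup>2"
      unfolding E'_def by (rule mode_gen_energy[OF g])
    also have "\<dots> \<le> 4 * norm (2 * cis (\<theta> / 2) * cnj (u s (Suc n)) * u s (Suc (Suc n)))"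
      using complex_Re_le_cmod[of "2 * cis (\<theta> / 2) * cnj (u s (Suc n)) * u s (Suc (Suc n))"] zero_le_power2[of "norm (u s (Suc n))"] by linarith
    also have "\<dots> = 8 * (norm (u s (Suc n)) * norm (u s (Suc (Suc n))))" by (simp add: norm_mult)
    also have "\<dots> \<le> 8 * ((exp (- real n) * K) * (1 * K))"
    proof (intro mult_left_mono mult_mono)
      show "norm (u s (Suc n)) \<le> exp (- real n) * K"
        using order_trans[OF ub[OF that, of "Suc n"] mult_right_mono[of "exp (- real (Suc n))" "exp (- real n)" K]] K by simp
      show "norm (u s (Suc (Suc n))) \<le> 1 * K"
        using order_trans[OF ub[OF that, of "Suc (Suc n)"] mult_right_mono[of "exp (- real (Suc (Suc n)))" 1 K]] K by simp
    qed (use K in auto)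
    finally show ?thesis by simp
  qed
  have E0: "E N 0 = 1" for N
  proof -
    have "(\<Sum>d=1..N. (norm (u 0 d))\<^sup>2) = 0" by (rule sum.neutral) (auto simp: u_def mode_sol_0[OF g])
    then show ?thesis by (simp add: E_def u_def mode_sol_0[OF g])
  qed
  have En: "E (Suc n) t \<le> 1 + exp (- real n) * (8 * K * K * t)" for n
  proof (cases "t = 0")
    case False
    then have "t > 0" using t by simp
    from MVT2[OF this dE] obtain s where s: "0 < s" "s < t" "E (Suc n) t - E (Suc n) 0 = (t - 0) * E' n s" by blast
    have "t * E' n s \<le> t * (8 * (exp (- real n) * K) * K)" using E'_le s t by (intro mult_left_mono) auto
    with s E0 show ?thesis by (simp add: algebra_simps)
  qed (simp add: E0)
  have "E N t \<le> 1 + exp (- real n) * (8 * K * K * t)" if "n \<ge> N" for n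
  proof -
    have "E N t \<le> E (Suc n) t" unfolding E_def using that by (intro add_left_mono mult_left_mono sum_mono2) auto
    with En[of n] show ?thesis by linarith
  qed
  moreover have "(\<lambda>n. 1 + exp (- real n) * (8 * K * K * t)) \<longlonglongrightarrow> 1 + 0 * (8 * K * K * t)"
  proof (intro tendsto_intros)
    show "(\<lambda>n. exp (- real n)) \<longlonglongrightarrow> 0"
      by real_asymp
  qed
  ultimately have "E N t \<le> 1 + 0 * (8 * K * K * t)" by (intro LIMSEQ_le_const) auto
  then show ?thesis by (simp add: E_def u_def)
qed

text \<open>\<open>(1, G 0, G 1, \<dots>)\<close>, with \<open>G d\<close> sitting at distance \<open>d + 1\<close>, is annihilated by \<open>mode_gen\<close> at
  all positive distances: there \<open>mode_gen\<close> is a second order recurrence with constant coefficients, and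
  \<open>r\<close> is its root of modulus less than one.  At distance \<open>0\<close> it is mapped to \<open>lam\<close>.  Its distance to
  \<open>(1, 0, 0, \<dots>)\<close> is at most \<open>err\<close>, so it is an approximate eigenvector.\<close>

locale corrector =
  fixes \<gamma> \<theta> :: real and q :: complex
  assumes gamma_nonneg: "\<gamma> \<ge> 0" and q_sq: "q\<^sup>2 = of_real ((1 + \<gamma>)\<^sup>2) - cis \<theta>" and Re_q: "Re q > 0"
begin

definition "\<sigma> = 2 * sin (\<theta> / 2)"
definition "r = cis (- \<theta> / 2) * (1 + of_real \<gamma> - q)"
definition "gc = \<i> * of_real \<sigma> / (2 * (of_real \<gamma> + q))"
definition "lam = - of_real (\<sigma>\<^sup>2) - of_real (\<sigma>\<^sup>2) / (of_real \<gamma> + q)"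
definition "G d = gc * r ^ d"
definition "err = sqrt 2 * norm gc * sqrt ((1 + Re q) / Re q)"

lemma gq: "of_real \<gamma> + q \<noteq> 0" "Re (of_real \<gamma> + q) > 0"
  using gamma_nonneg Re_q by (auto simp: complex_eq_iff)

lemma cis_r: "cis (\<theta> / 2) * r = 1 + of_real \<gamma> - q"
proof -
  have "cis (\<theta> / 2) * cis (- \<theta> / 2) = 1" by (simp add: cis_mult)
  then show ?thesis unfolding r_def by (simp only: mult.assoc[symmetric] mult_1_left)
qed

lemma gc_eq: "gc * (2 * (of_real \<gamma> + q)) = \<i> * of_real \<sigma>" "2 * gc = \<i> * of_real \<sigma> / (of_real \<gamma> + q)"
proof -
  have "2 * (of_real \<gamma> + q) \<noteq> 0" using gq(1) by (metis mult_eq_0_iff zero_neq_numeral)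
  then show 1: "gc * (2 * (of_real \<gamma> + q)) = \<i> * of_real \<sigma>" by (metis gc_def nonzero_eq_divide_eq)
  have "(2 * gc) * (of_real \<gamma> + q) = \<i> * of_real \<sigma>" unfolding 1[symmetric] by (simp only: mult_ac)
  then show "2 * gc = \<i> * of_real \<sigma> / (of_real \<gamma> + q)" using gq(1) by (metis nonzero_eq_divide_eq)
qed

text \<open>\<open>1 + \<gamma> - q\<close> and \<open>1 + \<gamma> + q\<close> have product
  \<open>cis \<theta>\<close> of modulus one. The second has real part at least
  \<open>1 + Re q\<close>, so the first is correspondingly small.\<close>

lemma norm_r: "norm r \<le> 1 / (1 + Re q)" "norm r < 1"
proof -
  have "(1 + of_real \<gamma> - q) * (1 + of_real \<gamma> + q) = of_real ((1 + \<gamma>)\<^sup>2) - q\<^sup>2"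
    by (simp add: power2_eq_square algebra_simps)
  then have "(1 + of_real \<gamma> - q) * (1 + of_real \<gamma> + q) = cis \<theta>" by (simp add: q_sq)
  then have "norm (1 + of_real \<gamma> - q) * norm (1 + of_real \<gamma> + q) = 1" by (metis norm_cis norm_mult)
  then have "norm r * norm (1 + of_real \<gamma> + q) = 1" by (simp add: r_def norm_mult)
  moreover have "1 + Re q \<le> norm (1 + of_real \<gamma> + q)"
    using complex_Re_le_cmod[of "1 + of_real \<gamma> + q"] gamma_nonneg by simp
  ultimately have "norm r * (1 + Re q) \<le> 1" by (metis mult_left_mono norm_ge_zero)
  then show "norm r \<le> 1 / (1 + Re q)" using Re_q by (simp add: field_simps)
  also have "\<dots> < 1" using Re_q by simp
  finally show "norm r < 1" .
qed

lemma G_rec0: "\<i> * of_real \<sigma> - of_real (2 + 4 * \<gamma>) * G 0 + 2 * cis (\<theta> / 2) * G 1 = 0"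
proof -
  have "of_real (2 + 4 * \<gamma>) * G 0 - 2 * cis (\<theta> / 2) * G 1 = gc * (2 + 4 * of_real \<gamma> - 2 * (cis (\<theta> / 2) * r))"
    by (simp add: G_def algebra_simps)
  also have "\<dots> = gc * (2 * (of_real \<gamma> + q))" unfolding cis_r by (simp add: algebra_simps)
  also have "\<dots> = \<i> * of_real \<sigma>" by (rule gc_eq)
  finally show ?thesis by (simp add: algebra_simps)
qed

lemma G_rec: "2 * cis (\<theta> / 2) * (G d + G (Suc (Suc d))) = of_real (4 + 4 * \<gamma>) * G (Suc d)"
proof -
  define e where "e = cis (\<theta> / 2)"
  have e: "e * e = cis \<theta>" by (simp add: e_def cis_mult)
  have e0: "e \<noteq> 0" by (simp add: e_def)
  have er: "e * r = 1 + of_real \<gamma> - q" unfolding e_def by (rule cis_r)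
  have "e * (2 * e * (1 + r * r) - (4 + 4 * of_real \<gamma>) * r) = 2 * (e * e) + 2 * (e * r) * (e * r) - (4 + 4 * of_real \<gamma>) * (e * r)"
    by (simp add: algebra_simps)
  also have "\<dots> = 2 * (cis \<theta> - (of_real ((1 + \<gamma>)\<^sup>2) - q\<^sup>2))"
    unfolding e er by (simp add: algebra_simps power2_eq_square)
  also have "\<dots> = 0" unfolding q_sq by simp
  finally have "2 * e * (1 + r * r) = (4 + 4 * of_real \<gamma>) * r" using e0 by simp
  then have "gc * r ^ d * (2 * e * (1 + r * r)) = gc * r ^ d * ((4 + 4 * of_real \<gamma>) * r)" by simp
  then show ?thesis by (simp add: G_def e_def algebra_simps)
qed

lemma lam_eq: "lam = - of_real (\<sigma>\<^sup>2) + 2 * \<i> * of_real \<sigma> * G 0"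
proof -
  have "2 * \<i> * of_real \<sigma> * G 0 = \<i> * of_real \<sigma> * (2 * gc)" by (simp add: G_def)
  also have "\<dots> = - of_real (\<sigma>\<^sup>2) / (of_real \<gamma> + q)" 
  proof -
    have "\<i> * of_real \<sigma> * (\<i> * of_real \<sigma>) = - complex_of_real (\<sigma>\<^sup>2)" by (simp add: complex_eq_iff power2_eq_square)
    then show ?thesis unfolding gc_eq(2) times_divide_eq_right by (simp only:)
  qed
  finally show ?thesis by (simp add: lam_def)
qed

lemma Re_lam: "Re lam \<le> 0"
proof -
  have "Re (of_real (\<sigma>\<^sup>2) / (of_real \<gamma> + q)) = \<sigma>\<^sup>2 * Re (of_real \<gamma> + q) / (norm (of_real \<gamma> + q))\<^sup>2"
    by (simp add: Re_divide cmod_power2)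
  also have "\<dots> \<ge> 0" using gq by (intro divide_nonneg_nonneg mult_nonneg_nonneg) auto
  finally have "0 \<le> Re (of_real (\<sigma>\<^sup>2) / (of_real \<gamma> + q))" .
  moreover have "Re lam = - \<sigma>\<^sup>2 - Re (of_real (\<sigma>\<^sup>2) / (of_real \<gamma> + q))"
    by (simp only: lam_def minus_complex.sel uminus_complex.sel Re_complex_of_real)
  ultimately show ?thesis using zero_le_power2[of \<sigma>] by linarith
qed

text \<open>Summation by parts. For the bilinear pairing with weights 1, 2, 2, ... (no conjugation)
  \<open>mode_gen\<close> is symmetric, so it can be moved from \<open>u\<close> to the vector
  formed by 1 and \<open>G\<close>. There it yields \<open>lam\<close> at distance 0 and nothing at
  the positive distances, up to a boundary term at the cut.\<close>

lemma mode_gen_pairing: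
  "mode_gen \<gamma> \<theta> u 0 + 2 * (\<Sum>d\<le>N. G d * mode_gen \<gamma> \<theta> u (Suc d))
    = lam * u 0 + 2 * (2 * cis (\<theta> / 2)) * (G N * u (Suc (Suc N)) - G (Suc N) * u (Suc N))"
proof -
  define w where "w = 2 * cis (\<theta> / 2)"
  note m0 = mode_gen_0[of \<gamma> \<theta> u, folded \<sigma>_def]
  note m1 = mode_gen_1[of \<gamma> \<theta> u, folded \<sigma>_def w_def]
  note mk = mode_gen_Suc_Suc[of \<gamma> \<theta> u, folded w_def]
  have "mode_gen \<gamma> \<theta> u 0 + 2 * (\<Sum>d\<le>N. G d * mode_gen \<gamma> \<theta> u (Suc d))
    = lam * u 0 + 2 * w * (G N * u (Suc (Suc N)) - G (Suc N) * u (Suc N))"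
  proof (induction N)
    case 0
    have "\<i> * of_real \<sigma> - of_real (2 + 4 * \<gamma>) * G 0 = - (w * G 1)"
      using G_rec0 unfolding w_def by (simp only: add_eq_0_iff2)
    then have "2 * u 1 * (\<i> * of_real \<sigma> - of_real (2 + 4 * \<gamma>) * G 0) = 2 * u 1 * (- (w * G 1))" by simp
    moreover have "mode_gen \<gamma> \<theta> u 0 + 2 * (G 0 * mode_gen \<gamma> \<theta> u 1)
      = lam * u 0 + 2 * w * (G 0 * u 2) + 2 * u 1 * (\<i> * of_real \<sigma> - of_real (2 + 4 * \<gamma>) * G 0)"
      unfolding m0 m1 lam_eq by (simp add: algebra_simps)
    ultimately have "mode_gen \<gamma> \<theta> u 0 + 2 * (G 0 * mode_gen \<gamma> \<theta> u 1)
      = lam * u 0 + 2 * w * (G 0 * u 2) + 2 * u 1 * (- (w * G 1))" by (simp only:)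
    also have "\<dots> = lam * u 0 + 2 * w * (G 0 * u 2 - G 1 * u 1)" by (simp add: algebra_simps)
    finally have "mode_gen \<gamma> \<theta> u 0 + 2 * (G 0 * mode_gen \<gamma> \<theta> u 1)
      = lam * u 0 + 2 * w * (G 0 * u 2 - G 1 * u 1)" .
    then show ?case by (simp add: numeral_2_eq_2)
  next
    case (Suc N)
    have r: "of_real (4 + 4 * \<gamma>) * G (Suc N) = w * (G N + G (Suc (Suc N)))" unfolding w_def by (rule G_rec[symmetric])
    have "G (Suc N) * mode_gen \<gamma> \<theta> u (Suc (Suc N)) = w * G (Suc N) * (u (Suc (Suc (Suc N))) + u (Suc N))
       - (of_real (4 + 4 * \<gamma>) * G (Suc N)) * u (Suc (Suc N))"
      unfolding mk by (simp add: algebra_simps)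
    then have "G (Suc N) * mode_gen \<gamma> \<theta> u (Suc (Suc N)) = w * G (Suc N) * (u (Suc (Suc (Suc N))) + u (Suc N))
       - w * (G N + G (Suc (Suc N))) * u (Suc (Suc N))" unfolding r .
    note rec = this
    have "mode_gen \<gamma> \<theta> u 0 + 2 * (\<Sum>d\<le>Suc N. G d * mode_gen \<gamma> \<theta> u (Suc d))
       = (mode_gen \<gamma> \<theta> u 0 + 2 * (\<Sum>d\<le>N. G d * mode_gen \<gamma> \<theta> u (Suc d))) + 2 * (G (Suc N) * mode_gen \<gamma> \<theta> u (Suc (Suc N)))"
      by (simp add: algebra_simps)
    then show ?case unfolding Suc rec by (simp add: algebra_simps)
  qed
  then show ?thesis by (simp only: w_def)
qed

text \<open>The geometric series has sum \<open>1 / (1 - s)\<close> with \<open>s\<close> the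
  squared modulus of \<open>r\<close>; \<open>norm_r\<close> makes this at most of order
  \<open>1 / Re q\<close>, the spatial extent of \<open>G\<close>.\<close>

lemma sum_G_le: "(\<Sum>d\<le>N. (norm (G d))\<^sup>2) \<le> (norm gc)\<^sup>2 * ((1 + Re q) / Re q)"
proof -
  define s where "s = (norm r)\<^sup>2"
  have s1: "0 \<le> s" "s \<le> norm r"
    using norm_r(2) by (auto simp: s_def power2_eq_square intro: mult_left_le)
  then have s: "0 \<le> s" "s \<le> norm r" "s < 1" using norm_r(2) by auto
  have "(\<Sum>d\<le>N. (norm (G d))\<^sup>2) = (norm gc)\<^sup>2 * (\<Sum>d\<le>N. s ^ d)"
    by (simp add: G_def norm_mult norm_power power_mult_distrib s_def sum_distrib_left flip: power_mult) (simp add: mult.commute)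
  also have "(\<Sum>d\<le>N. s ^ d) \<le> (\<Sum>d. s ^ d)"
    by (rule sum_le_suminf) (use s in auto)
  also have "(\<Sum>d. s ^ d) = 1 / (1 - s)" using s by (subst suminf_geometric) auto
  also have "\<dots> \<le> (1 + Re q) / Re q"
  proof -
    have "s \<le> 1 / (1 + Re q)" using s norm_r(1) by linarith
    then have "Re q / (1 + Re q) \<le> 1 - s" using Re_q by (simp add: field_simps)
    then have "inverse (1 - s) \<le> inverse (Re q / (1 + Re q))" using Re_q by (intro le_imp_inverse_le) auto
    then show ?thesis by (simp add: divide_inverse mult.commute)
  qed
  finally show ?thesis by (simp add: mult_left_mono)
qed

text \<open>Pairing the solution with 1 and \<open>G\<close> gives a scalar \<open>v\<close> with
  \<open>v' = lam * u 0\<close> up to a boundary term. By Cauchy-Schwarz and the energy bound,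
  \<open>v\<close> stays within \<open>err\<close> of \<open>u 0\<close>. So \<open>v\<close> solves
  the equation of the exponential with source at most \<open>norm lam * err\<close>, and one more
  \<open>err\<close> returns from \<open>v\<close> to \<open>u 0\<close>.\<close>

theorem mode_sol_approx:
  assumes T: "T \<ge> 0"
  shows "norm (mode_sol \<gamma> \<theta> T 0 - exp (lam * of_real T)) \<le> err + T * norm lam * err"
proof -
  define u where "u s d = mode_sol \<gamma> \<theta> s d" for s d
  define v where "v N s = u s 0 + 2 * (\<Sum>d\<le>N. G d * u s (Suc d))" for N s
  define K where "K = exp ((12 + 4 * \<gamma>) * T)"
  have ub: "norm (u s d) \<le> exp (- real d) * K" if "0 \<le> s" "s \<le> T" for s d
    unfolding u_def K_def by (rule mode_sol_norm_le_uniform[OF gamma_nonneg that])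
  have vu: "norm (v N s - u s 0) \<le> err" if s: "0 \<le> s" for N s
  proof -
    have "norm (\<Sum>d\<le>N. G d * u s (Suc d)) \<le> (\<Sum>d\<le>N. norm (G d) * norm (u s (Suc d)))"
      by (rule order_trans[OF norm_sum]) (simp add: norm_mult)
    also have "\<dots> \<le> sqrt ((\<Sum>d\<le>N. (norm (G d))\<^sup>2) * (\<Sum>d\<le>N. (norm (u s (Suc d)))\<^sup>2))"
      by (rule real_le_rsqrt) (rule Cauchy_Schwarz_ineq_sum)
    also have "\<dots> \<le> sqrt ((norm gc)\<^sup>2 * ((1 + Re q) / Re q) * (1 / 2))"
    proof (intro real_sqrt_le_mono mult_mono sum_G_le)
      have "(\<Sum>d\<le>N. (norm (u s (Suc d)))\<^sup>2) = (\<Sum>d=1..Suc N. (norm (u s d))\<^sup>2)"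
        unfolding atMost_atLeast0 One_nat_def by (rule sum.shift_bounds_cl_Suc_ivl[symmetric])
      \<comment> \<open>The energy counts positive distances twice, hence 1/2; this yields the
        factor \<open>sqrt 2\<close> in \<open>err\<close>.\<close>
      then show "(\<Sum>d\<le>N. (norm (u s (Suc d)))\<^sup>2) \<le> 1 / 2"
        using mode_sol_energy_le[OF gamma_nonneg s, of \<theta> "Suc N", folded u_def] zero_le_power2[of "norm (u s 0)"] by linarith
    qed (use Re_q in \<open>auto intro!: sum_nonneg\<close>)
    also have "2 * \<dots> = err"
    proof -
      have "2 * sqrt (1 / 2) = sqrt (2::real)" by (simp add: real_sqrt_divide real_div_sqrt)
      moreover have "2 * sqrt ((norm gc)\<^sup>2 * ((1 + Re q) / Re q) * (1 / 2)) = 2 * sqrt (1 / 2) * (norm gc * sqrt ((1 + Re q) / Re q))"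
        unfolding real_sqrt_mult real_sqrt_abs abs_norm_cancel by (simp only: mult_ac)
      ultimately show ?thesis by (simp only: err_def mult.assoc)
    qed
    finally have "2 * norm (\<Sum>d\<le>N. G d * u s (Suc d)) \<le> err" by simp
    then show ?thesis by (simp add: v_def norm_mult)
  qed
  have Gb: "norm (G d) \<le> norm gc" for d
    using norm_r(2) by (simp add: G_def norm_mult norm_power mult_left_le power_le_one)
  have step: "norm (u T 0 - exp (lam * of_real T)) \<le> err + T * (norm lam * err + exp (- real N) * (8 * norm gc * K))" for N
  proof -
    define \<rho> where "\<rho> s = 2 * (2 * cis (\<theta> / 2)) * (G N * u s (Suc (Suc N)) - G (Suc N) * u s (Suc N))" for s
    have dv: "(v N has_vector_derivative lam * u s 0 + \<rho> s) (at s)" for s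
    proof -
      have "(v N has_vector_derivative mode_gen \<gamma> \<theta> (u s) 0 + 2 * (\<Sum>d\<le>N. G d * mode_gen \<gamma> \<theta> (u s) (Suc d))) (at s)"
        unfolding v_def[abs_def] u_def
        by (intro has_vector_derivative_add has_vector_derivative_mult_right has_vector_derivative_sum mode_sol_deriv gamma_nonneg)
      then show ?thesis unfolding mode_gen_pairing \<rho>_def .
    qed
    have \<rho>: "norm (\<rho> s) \<le> exp (- real N) * (8 * norm gc * K)" if "0 \<le> s" "s \<le> T" for s
    proof -
      have e: "norm (u s (Suc d)) \<le> exp (- real N) * K" if "d \<ge> N" for d
      proof -
        have "exp (- real (Suc d)) * K \<le> exp (- real N) * K" using that by (intro mult_right_mono) (auto simp: K_def)
        then show ?thesis using ub[OF \<open>0 \<le> s\<close> \<open>s \<le> T\<close>, of "Suc d"] by linarith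
      qed
      have "norm (G N * u s (Suc (Suc N)) - G (Suc N) * u s (Suc N)) \<le> norm gc * (exp (- real N) * K) + norm gc * (exp (- real N) * K)"
        by (intro order_trans[OF norm_triangle_ineq4] add_mono) (auto simp: norm_mult intro!: mult_mono Gb e)
      then have "4 * norm (G N * u s (Suc (Suc N)) - G (Suc N) * u s (Suc N)) \<le> exp (- real N) * (8 * norm gc * K)"
        by (simp add: algebra_simps)
      then show ?thesis unfolding \<rho>_def norm_mult norm_cis by simp
    qed
    \<comment> \<open>Integrating factor: the equation for \<open>w\<close> contains only the error
      terms.\<close>
    define w where "w s = exp (- lam * of_real s) * v N s" for s
    have dw: "(w has_vector_derivative exp (- lam * of_real s) * (lam * (u s 0 - v N s) + \<rho> s)) (at s)" for s
    proof -
      have "((\<lambda>z. exp (- lam * z)) has_field_derivative - lam * exp (- lam * of_real s)) (at (of_real s))"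
        by (auto intro!: derivative_eq_intros)
      from has_vector_derivative_mult[OF has_vector_derivative_real_field[OF this] dv]
      show ?thesis unfolding w_def[abs_def] by (simp add: algebra_simps)
    qed
    \<comment> \<open>Since \<open>Re lam\<close> is nonpositive, the integrating factor is largest
      at \<open>T\<close>; the resulting exponential cancels when \<open>w\<close> is converted back
      to \<open>v\<close>.\<close>
    define B where "B = exp (- Re lam * T) * (norm lam * err + exp (- real N) * (8 * norm gc * K))"
    have "norm (w T - w 0) \<le> B * T"
    proof (rule growth_bound[OF dw _ T])
      fix s assume s: "0 \<le> s" "s \<le> T"
      have "norm (exp (- lam * of_real s)) \<le> exp (- Re lam * T)"
        using Re_lam s by (simp add: norm_exp_eq_Re mult_left_mono_neg)
      moreover have "norm (lam * (u s 0 - v N s) + \<rho> s) \<le> norm lam * err + exp (- real N) * (8 * norm gc * K)"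
        using vu[OF s(1), of N] \<rho>[OF s]
        by (intro order_trans[OF norm_triangle_ineq] add_mono) (auto simp: norm_mult norm_minus_commute intro!: mult_left_mono)
      ultimately show "norm (exp (- lam * of_real s) * (lam * (u s 0 - v N s) + \<rho> s)) \<le> B"
        unfolding B_def norm_mult by (intro mult_mono) auto
    qed
    moreover have "w 0 = 1"
    proof -
      have "v N 0 = 1" by (simp add: v_def u_def mode_sol_0[OF gamma_nonneg])
      then show ?thesis by (simp add: w_def)
    qed
    moreover have "v N T - exp (lam * of_real T) = exp (lam * of_real T) * (w T - 1)"
      by (simp add: w_def algebra_simps exp_minus)
    ultimately have "norm (v N T - exp (lam * of_real T)) \<le> exp (Re lam * T) * (B * T)"
      by (simp add: norm_mult norm_exp_eq_Re)
    also have "\<dots> = T * (norm lam * err + exp (- real N) * (8 * norm gc * K))"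
      unfolding B_def by (simp add: exp_minus)
    finally show ?thesis
      using vu[OF T, of N] norm_triangle_ineq4[of "v N T - exp (lam * of_real T)" "v N T - u T 0"] by simp
  qed
  have "(\<lambda>N. err + T * (norm lam * err + exp (- real N) * (8 * norm gc * K)))
     \<longlonglongrightarrow> err + T * (norm lam * err + 0 * (8 * norm gc * K))"
  proof (intro tendsto_intros)
    show "(\<lambda>n. exp (- real n)) \<longlonglongrightarrow> 0"
      by real_asymp
  qed
  from LIMSEQ_le_const[OF this, of "norm (u T 0 - exp (lam * of_real T))"] step
  show ?thesis by (auto simp: u_def mult.assoc)
qed

end

section \<open>Transfer from the stationary process to the lattice flow\<close>

context stationary_chain
begin

text \<open>Centring at time \<open>t\<close> contributes \<open>1 / \<beta>\<close> times the mean
  of the centred energy at time 0, which is zero.\<close>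

lemma corr_energy_eq_pair_corr:
  assumes t: "t \<ge> 0"
  shows "(\<integral>w. ((X t w x)\<^sup>2 - 1 / \<beta>) * ((X 0 w y)\<^sup>2 - 1 / \<beta>) \<partial>M) = pair_corr (energy \<beta> y) x x t"
proof -
  have e: "square_integrable (gibbs \<beta>) (energy \<beta> z)" for z by (rule square_integrable_energy[OF beta_pos])
  interpret mu: prob_space "gibbs \<beta>" by (rule prob_\<mu>)
  have one: "square_integrable (gibbs \<beta>) (\<lambda>_. 1)" by (simp add: square_integrable_def)
  have "corr (energy \<beta> y) (\<lambda>_. 1) t = (\<integral>w. energy \<beta> y (X 0 w) \<partial>M)" by (simp add: corr_def)
  also have "\<dots> = (\<integral>\<xi>. energy \<beta> y \<xi> \<partial>distr M config_space (X 0))"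
    by (rule integral_distr[symmetric])
       (use e[of y] X_measurable[of 0] in \<open>auto simp: square_integrable_def measurable_cong_sets[OF sets_gibbs refl]\<close>)
  also have "\<dots> = (\<integral>\<xi>. energy \<beta> y \<xi> \<partial>gibbs \<beta>)" by (simp only: init)
  also have "\<dots> = 0"
    unfolding energy_def using gibbs_marginal[OF beta_pos gauss_moments(1)[OF beta_pos, of 2], of y] gauss_moments(3)[OF beta_pos]
    by (simp add: mu.prob_space)
  finally have z: "corr (energy \<beta> y) (\<lambda>_. 1) t = 0" .
  have "(\<integral>w. ((X t w x)\<^sup>2 - 1 / \<beta>) * ((X 0 w y)\<^sup>2 - 1 / \<beta>) \<partial>M) = corr (energy \<beta> y) (\<lambda>\<xi>. \<xi> x * \<xi> x - (1 / \<beta>) * 1) t"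
    unfolding corr_def energy_def by (simp add: power2_eq_square mult.commute)
  also have "\<dots> = pair_corr (energy \<beta> y) x x t - (1 / \<beta>) * corr (energy \<beta> y) (\<lambda>_. 1) t"
    unfolding pair_corr_def
    by (simp only: corr_diff[OF t e] corr_cmult square_integrable_coordinates[OF beta_pos] square_integrable_cmult[OF one])
  finally show ?thesis using z by simp
qed

text \<open>The factor \<open>\<beta>^2 / 2\<close> normalises the variance of the energy, so that
  the flow starts from a unit mass. The uniform bound is Cauchy-Schwarz with the variance and the
  fourth moment.\<close>

lemma lattice_flow_pair_corr:
  assumes g: "\<gamma> \<ge> 0"
  shows "lattice_flow \<gamma> (\<beta>\<^sup>2 / 2 * (sqrt (2 / \<beta>\<^sup>2) * sqrt (3 / \<beta>\<^sup>2))) (\<lambda>z x y t. \<beta>\<^sup>2 / 2 * pair_corr (energy \<beta> z) x y t)"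
proof
  have e: "square_integrable (gibbs \<beta>) (energy \<beta> z)" for z by (rule square_integrable_energy[OF beta_pos])
  fix t :: real and z x y :: int
  assume t: "t \<ge> 0"
  have "lattice_gen \<gamma> (\<lambda>x y. \<beta>\<^sup>2 / 2 * pair_corr (energy \<beta> z) x y t) x y = \<beta>\<^sup>2 / 2 * lattice_gen \<gamma> (\<lambda>x y. pair_corr (energy \<beta> z) x y t) x y"
    unfolding lattice_gen_def by (simp add: sum_distrib_left sum_subtractf algebra_simps)
  note eq = this
  show "((\<lambda>t. \<beta>\<^sup>2 / 2 * pair_corr (energy \<beta> z) x y t) has_real_derivative
      lattice_gen \<gamma> (\<lambda>x y. \<beta>\<^sup>2 / 2 * pair_corr (energy \<beta> z) x y t) x y) (at t within {0..})"
    unfolding eq by (rule DERIV_cmult[OF pair_corr_deriv[OF e[of z] t]])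
  show "\<bar>\<beta>\<^sup>2 / 2 * pair_corr (energy \<beta> z) x y t\<bar> \<le> \<beta>\<^sup>2 / 2 * (sqrt (2 / \<beta>\<^sup>2) * sqrt (3 / \<beta>\<^sup>2))"
    using mult_left_mono[OF pair_corr_le[OF t e[of z], of x y], of "\<beta>\<^sup>2 / 2"]
    by (simp add: abs_mult integral_energy_sq[OF beta_pos])
qed (use g beta_pos in \<open>auto simp: pair_corr_0\<close>)

end

lemma stationary_dynamics_flow:
  assumes \<beta>: "\<beta> > 0" and g: "\<gamma> \<ge> 0" and dyn: "stationary_dynamics \<gamma> 1 \<beta> M X"
  shows "\<exists>A c. lattice_flow \<gamma> A c \<and>
    (\<forall>t x y. t \<ge> 0 \<longrightarrow> (\<integral>w. ((X t w x)\<^sup>2 - 1 / \<beta>) * ((X 0 w y)\<^sup>2 - 1 / \<beta>) \<partial>M) = 2 / \<beta>\<^sup>2 * c y x x t)"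
proof -
  obtain K where K: "transition_semigroup config_space K" "markov_process M config_space K X"
    "distr M config_space (X 0) = gibbs \<beta>" "\<forall>t\<ge>0. gibbs \<beta> \<bind> K t = gibbs \<beta>"
    "has_L2_generator_on (gibbs \<beta>) K (generator \<gamma> 1) smooth_local_bounded"
    using dyn unfolding stationary_dynamics_def by blast
  interpret stationary_chain M X K \<beta> \<gamma>
    by (intro stationary_chain.intro stationary_markov.intro)
       (use K \<beta> in \<open>auto simp: transition_semigroup_def\<close>)
  show ?thesis
    by (rule exI[of _ "\<beta>\<^sup>2 / 2 * (sqrt (2 / \<beta>\<^sup>2) * sqrt (3 / \<beta>\<^sup>2))"],
        rule exI[of _ "\<lambda>z x y t. \<beta>\<^sup>2 / 2 * pair_corr (energy \<beta> z) x y t"])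
       (use lattice_flow_pair_corr[OF g] corr_energy_eq_pair_corr \<beta> in auto)
qed

text \<open>\<open>csqrt (- \<i> * k)\<close> is the limit of \<open>q\<close> times the square root
  of n, and the formula is the limit of \<open>\<sigma>^2 / q\<close> on the scale n^(-3/2).\<close>

definition limit_symbol :: "real \<Rightarrow> complex" where
  "limit_symbol k = of_real (k\<^sup>2) / csqrt (- \<i> * of_real k)"

text \<open>With \<open>q = S n / sqrt n\<close> the rescaled root \<open>S n\<close> has a nonzero
  limit. In these variables \<open>lam n * T n\<close> converges and \<open>err n\<close> tends to
  0, so the error of \<open>mode_sol_approx\<close> vanishes although \<open>T n\<close>
  diverges.\<close>

lemma mode_sol_limit:
  fixes b c k t :: real
  assumes c: "c > 0" and b: "b > 1" and t: "t \<ge> 0" and k: "k \<noteq> 0"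
  shows "(\<lambda>n. mode_sol (c * real n powr (- b)) (k / real n) (t * real n powr (3 / 2)) 0) \<longlonglongrightarrow> exp (- of_real t * limit_symbol k)"
proof -
  define \<gamma> where "\<gamma> n = c * real n powr (- b)" for n
  define Z where "Z n = of_nat n * (of_real ((1 + \<gamma> n)\<^sup>2) - cis (k / real n))" for n
  define S where "S n = csqrt (Z n)" for n
  define L where "L = csqrt (- \<i> * of_real k)"
  define s where "s n = sqrt (real n) * \<gamma> n" for n
  define \<sigma> where "\<sigma> n = 2 * sin (k / real n / 2)" for n
  have Z: "Z \<longlonglongrightarrow> - \<i> * of_real k"
  proof -
    \<comment> \<open>The real part of \<open>Z n\<close> contains
      \<open>2 * n * \<gamma> n\<close>, of order n^(1 - b), which vanishes because
      \<open>b > 1\<close>.\<close>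
    have "(\<lambda>n. real n * ((1 + c * real n powr (- b))\<^sup>2 - cos (k / real n))) \<longlonglongrightarrow> 0"
    proof -
      have "(\<lambda>n. real n * (c * real n powr (- b))) \<longlonglongrightarrow> 0" using b c by real_asymp
      moreover have "(\<lambda>n. c * real n powr (- b)) \<longlonglongrightarrow> 0" using b c by real_asymp
      moreover have "(\<lambda>n. real n * (1 - cos (k / real n))) \<longlonglongrightarrow> 0" by real_asymp
      ultimately have "(\<lambda>n. real n * (c * real n powr (- b)) * (2 + c * real n powr (- b)) + real n * (1 - cos (k / real n))) \<longlonglongrightarrow> 0 * (2 + 0) + 0"
        by (intro tendsto_intros)
      then show ?thesis by (simp add: power2_eq_square algebra_simps)
    qed
    moreover have "(\<lambda>n. - (real n * sin (k / real n))) \<longlonglongrightarrow> - k" by real_asymp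
    ultimately have "(\<lambda>n. Complex (real n * ((1 + c * real n powr (- b))\<^sup>2 - cos (k / real n))) (- (real n * sin (k / real n)))) \<longlonglongrightarrow> Complex 0 (- k)"
      by (rule tendsto_Complex)
    moreover have "Complex (real n * ((1 + c * real n powr (- b))\<^sup>2 - cos (k / real n))) (- (real n * sin (k / real n))) = Z n" for n
      by (simp add: Z_def \<gamma>_def complex_eq_iff del: of_real_power)
    moreover have "Complex 0 (- k) = - \<i> * of_real k" by (simp add: complex_eq_iff)
    ultimately show ?thesis by (simp only:)
  qed
  \<comment> \<open>For nonzero \<open>k\<close> the limit of \<open>Z\<close> is off the branch
    cut: \<open>csqrt\<close> is continuous there and its value has positive real part.\<close>
  have nonneg: "- \<i> * of_real k \<notin> \<real>\<^sub>\<le>\<^sub>0"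
    using k by (auto simp: complex_nonpos_Reals_iff)
  have S: "S \<longlonglongrightarrow> L"
    unfolding S_def[abs_def] L_def by (rule isCont_tendsto_compose[OF continuous_at_csqrt[OF nonneg] Z])
  have ReL: "Re L > 0"
    using k by (simp add: L_def csqrt.sel)
  have s0: "s \<longlonglongrightarrow> 0" unfolding s_def[abs_def] \<gamma>_def using b c by real_asymp
  have n\<sigma>: "(\<lambda>n. real n * \<sigma> n) \<longlonglongrightarrow> k" unfolding \<sigma>_def by real_asymp
  have pos: "\<forall>\<^sub>F n in sequentially. n > 0 \<and> Re (S n) > 0"
    using order_tendstoD(1)[OF tendsto_Re[OF S] ReL] eventually_gt_at_top[of 0] by eventually_elim simp
  define lam where "lam n = - of_real ((\<sigma> n)\<^sup>2) - of_real ((\<sigma> n)\<^sup>2) / (of_real (\<gamma> n) + S n / of_real (sqrt (real n)))" for n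
  define err where "err n = sqrt 2 * norm (\<i> * of_real (\<sigma> n) / (2 * (of_real (\<gamma> n) + S n / of_real (sqrt (real n)))))
     * sqrt ((1 + Re (S n / of_real (sqrt (real n)))) / Re (S n / of_real (sqrt (real n))))" for n
  define T where "T n = t * real n powr (3 / 2)" for n
  note defs = lam_def err_def \<sigma>_def
  have bound: "\<forall>\<^sub>F n in sequentially. norm (mode_sol (\<gamma> n) (k / real n) (T n) 0 - exp (lam n * of_real (T n))) \<le> err n + T n * norm (lam n) * err n"
    using pos
  proof eventually_elim
    case (elim n)
    interpret corrector "\<gamma> n" "k / real n" "S n / of_real (sqrt (real n))"
    proof
      show "\<gamma> n \<ge> 0" using c by (simp add: \<gamma>_def)
      have "(complex_of_real (sqrt (real n)))\<^sup>2 = of_nat n" by (simp flip: of_real_power)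
      then have "(S n / complex_of_real (sqrt (real n)))\<^sup>2 = Z n / of_nat n" by (simp add: power_divide S_def)
      then show "(S n / complex_of_real (sqrt (real n)))\<^sup>2 = of_real ((1 + \<gamma> n)\<^sup>2) - cis (k / real n)"
        using elim by (simp add: Z_def)
      show "Re (S n / complex_of_real (sqrt (real n))) > 0" using elim by simp
    qed
    have "T n \<ge> 0" using t by (simp add: T_def)
    from mode_sol_approx[OF this] show ?case
      unfolding defs corrector.lam_def[OF corrector_axioms] corrector.err_def[OF corrector_axioms]
        corrector.gc_def[OF corrector_axioms] corrector.\<sigma>_def[OF corrector_axioms] .
  qed
  have rn: "of_real (\<gamma> n) + S n / of_real (sqrt (real n)) = (of_real (s n) + S n) / of_real (sqrt (real n))" if "n > 0" for n
    using that by (simp add: s_def field_simps)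
  have L0: "L \<noteq> 0" using ReL by auto
  have p32: "real n powr (3 / 2) = real n * sqrt (real n)" if "n > 0" for n
  proof -
    have "real n powr (3 / 2) = real n powr (1 + 1 / 2)" by simp
    also have "\<dots> = real n * sqrt (real n)" using that by (subst powr_add) (simp add: powr_half_sqrt)
    finally show ?thesis .
  qed
  have lamT: "(\<lambda>n. lam n * of_real (T n)) \<longlonglongrightarrow> - of_real t * limit_symbol k"
  proof (rule Lim_transform_eventually)
    \<comment> \<open>The purely diffusive summand of \<open>lam\<close>; on this time scale it is
      of order n^(-1/2).\<close>
    have "(\<lambda>n. (real n * \<sigma> n)\<^sup>2 * (1 / sqrt (real n))) \<longlonglongrightarrow> k\<^sup>2 * 0"
      by (intro tendsto_mult tendsto_power n\<sigma>) real_asymp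
    then have a: "(\<lambda>n. complex_of_real ((real n * \<sigma> n)\<^sup>2 * (1 / sqrt (real n)))) \<longlonglongrightarrow> of_real (k\<^sup>2 * 0)" by (rule tendsto_of_real)
    have "(\<lambda>n. - of_real t * (of_real ((real n * \<sigma> n)\<^sup>2 * (1 / sqrt (real n))) + of_real ((real n * \<sigma> n)\<^sup>2) / (of_real (s n) + S n)))
      \<longlonglongrightarrow> - of_real t * (of_real (k\<^sup>2 * 0) + of_real (k\<^sup>2) / (of_real 0 + L))"
      by (intro tendsto_intros a n\<sigma> s0 S) (use L0 in auto)
    then show "(\<lambda>n. - of_real t * (of_real ((real n * \<sigma> n)\<^sup>2 * (1 / sqrt (real n))) + of_real ((real n * \<sigma> n)\<^sup>2) / (of_real (s n) + S n)))
      \<longlonglongrightarrow> - of_real t * limit_symbol k"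
      by (simp add: limit_symbol_def L_def)
    show "\<forall>\<^sub>F n in sequentially. - of_real t * (of_real ((real n * \<sigma> n)\<^sup>2 * (1 / sqrt (real n))) + of_real ((real n * \<sigma> n)\<^sup>2) / (of_real (s n) + S n)) = lam n * of_real (T n)"
      using pos
    proof eventually_elim
      case (elim n)
      define h where "h = complex_of_real (sqrt (real n))"
      have h: "h \<noteq> 0" "h * h = of_nat n" using elim by (auto simp: h_def simp flip: of_real_mult)
      have "complex_of_real (T n) = of_real t * (h * h * h)" using elim by (simp add: T_def p32 h(2)) (simp add: h_def)
      moreover have "complex_of_real ((real n * \<sigma> n)\<^sup>2) = h ^ 4 * of_real ((\<sigma> n)\<^sup>2)"
        using h(2) by (simp add: power_mult_distrib power4_eq_xxxx power2_eq_square mult_ac)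
      moreover have "complex_of_real ((real n * \<sigma> n)\<^sup>2 * (1 / sqrt (real n))) = of_real ((real n * \<sigma> n)\<^sup>2) / h"
        by (simp add: h_def)
      moreover have "- t' * (h ^ 4 * x / h + h ^ 4 * x / D) = (- x - x / (D / h)) * (t' * (h * h * h))" for t' x D
        using h(1) by (simp add: power4_eq_xxxx field_simps)
      ultimately show ?case
        unfolding lam_def using rn[OF conjunct1[OF elim], folded h_def] by (simp only: h_def[symmetric])
    qed
  qed
  have err: "err \<longlonglongrightarrow> 0"
  proof (rule Lim_transform_eventually)
    have "(\<lambda>n. 1 / real n + 1 / sqrt (real n) * (1 / Re (S n))) \<longlonglongrightarrow> 0 + 0 * (1 / Re L)"
      by (intro tendsto_add tendsto_mult tendsto_divide tendsto_const tendsto_Re S) (real_asymp | use ReL in simp)+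
    note r = this
    have "(\<lambda>n. sqrt 2 * (\<bar>real n * \<sigma> n\<bar> / (2 * norm (of_real (s n) + S n))) * sqrt (1 / real n + 1 / sqrt (real n) * (1 / Re (S n))))
      \<longlonglongrightarrow> sqrt 2 * (\<bar>k\<bar> / (2 * norm (of_real 0 + L))) * sqrt (0 + 0 * (1 / Re L))"
      by (intro tendsto_mult tendsto_const tendsto_divide tendsto_rabs tendsto_norm tendsto_add tendsto_of_real
          n\<sigma> s0 S tendsto_real_sqrt[OF r]) (use L0 in auto)
    then show "(\<lambda>n. sqrt 2 * (\<bar>real n * \<sigma> n\<bar> / (2 * norm (of_real (s n) + S n))) * sqrt (1 / real n + 1 / sqrt (real n) * (1 / Re (S n)))) \<longlonglongrightarrow> 0"
      by simp
    show "\<forall>\<^sub>F n in sequentially. sqrt 2 * (\<bar>real n * \<sigma> n\<bar> / (2 * norm (of_real (s n) + S n))) * sqrt (1 / real n + 1 / sqrt (real n) * (1 / Re (S n))) = err n"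
      using pos
    proof eventually_elim
      case (elim n)
      define h where "h = sqrt (real n)"
      have h: "h > 0" "real n = h * h" using elim by (auto simp: h_def)
      have e1: "norm (\<i> * of_real x / (2 * (D / of_real h))) = h * (\<bar>x\<bar> / (2 * norm D))" for x and D :: complex
        using h by (simp add: norm_mult norm_divide)
      have e2: "sqrt ((1 + Re (S n / of_real h)) / Re (S n / of_real h)) = h * sqrt (1 / (h * h) + 1 / h * (1 / Re (S n)))"
      proof -
        have "(1 + Re (S n / of_real h)) / Re (S n / of_real h) = h\<^sup>2 * (1 / (h * h) + 1 / h * (1 / Re (S n)))"
          using elim h by (simp add: field_simps power2_eq_square)
        then show ?thesis using h by (simp add: real_sqrt_mult)
      qed
      have e3: "\<bar>real n * \<sigma> n\<bar> = h * h * \<bar>\<sigma> n\<bar>" using h by (simp add: abs_mult)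
      have "err n = sqrt 2 * (h * (\<bar>\<sigma> n\<bar> / (2 * norm (of_real (s n) + S n)))) * (h * sqrt (1 / (h * h) + 1 / h * (1 / Re (S n))))"
        by (simp only: err_def h_def[symmetric] rn[OF conjunct1[OF elim], folded h_def] e1 e2)
      then show ?case unfolding e3 h_def[symmetric] h(2)[symmetric] by (simp add: h(2))
    qed
  qed
  have "(\<lambda>n. mode_sol (\<gamma> n) (k / real n) (T n) 0 - exp (lam n * of_real (T n))) \<longlonglongrightarrow> 0"
  proof (rule Lim_null_comparison[OF bound])
    have "(\<lambda>n. err n + norm (lam n * of_real (T n)) * err n) \<longlonglongrightarrow> 0 + norm (- of_real t * limit_symbol k) * 0"
      by (intro tendsto_intros err lamT)
    moreover have "norm (lam n * of_real (T n)) = T n * norm (lam n)" for n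
      using t by (simp add: norm_mult T_def mult.commute)
    ultimately show "(\<lambda>n. err n + T n * norm (lam n) * err n) \<longlonglongrightarrow> 0" by simp
  qed
  from tendsto_add[OF this tendsto_exp[OF lamT]] show ?thesis
    by (simp add: \<gamma>_def T_def)
qed

lemma limit_symbol_eq:
  "limit_symbol k = of_real (1 / sqrt 2) * (of_real (\<bar>k\<bar> powr (3 / 2)) + \<i> * of_real (k * \<bar>k\<bar> powr (1 / 2)))"
proof (cases "k = 0")
  case True
  then show ?thesis by (simp add: limit_symbol_def)
next
  case False
  \<comment> \<open>\<open>- \<i> * k\<close> is purely imaginary of modulus
    \<open>\<bar>k\<bar>\<close>, so the real and imaginary parts of its principal root have the
    same absolute value \<open>a\<close>.\<close>
  define a where "a = sqrt (\<bar>k\<bar> / 2)"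
  have a: "a > 0" "a\<^sup>2 = \<bar>k\<bar> / 2" using False by (auto simp: a_def)
  have cs: "csqrt (- \<i> * of_real k) = Complex a (- sgn k * a)"
    using False by (simp add: complex_eq_iff csqrt.sel a_def sgn_if norm_mult)
  have "of_real (k\<^sup>2) = Complex a (- sgn k * a) * (Complex (\<bar>k\<bar> * a) (k * a))"
  proof -
    have "sgn k * k = \<bar>k\<bar>" "sgn k * \<bar>k\<bar> = k" by (simp_all add: sgn_if)
    then have "a * (\<bar>k\<bar> * a) + (sgn k * k) * (a * a) = \<bar>k\<bar> * (2 * a\<^sup>2)" "a * (k * a) - (sgn k * \<bar>k\<bar>) * (a * a) = 0"
      by (simp_all only: power2_eq_square) (simp_all add: algebra_simps)
    moreover have "\<bar>k\<bar> * (2 * a\<^sup>2) = k\<^sup>2"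
    proof -
      have "2 * a\<^sup>2 = \<bar>k\<bar>" using a by simp
      then show ?thesis by (simp only: abs_mult_self_eq power2_eq_square)
    qed
    ultimately show ?thesis by (auto simp: complex_eq_iff algebra_simps simp flip: of_real_power)
  qed
  moreover have "Complex a (- sgn k * a) \<noteq> 0" using a by (auto simp: complex_eq_iff)
  ultimately have 1: "limit_symbol k = Complex (\<bar>k\<bar> * a) (k * a)"
    unfolding limit_symbol_def cs by (simp add: field_simps)
  have h: "\<bar>k\<bar> powr (1 / 2) = sqrt \<bar>k\<bar>" using False by (simp add: powr_half_sqrt)
  have "\<bar>k\<bar> powr (3 / 2) = \<bar>k\<bar> powr (1 + 1 / 2)" by simp
  also have "\<dots> = \<bar>k\<bar> * sqrt \<bar>k\<bar>" using False by (subst powr_add) (simp add: h)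
  finally have 2: "\<bar>k\<bar> powr (3 / 2) = \<bar>k\<bar> * sqrt \<bar>k\<bar>" .
  have "a = sqrt \<bar>k\<bar> / sqrt 2" by (simp add: a_def real_sqrt_divide)
  then show ?thesis unfolding 1 2 h by (simp add: complex_eq_iff)
qed

section \<open>Fourier inversion and Riemann sums\<close>

lemma integrable_quadratic_decay: "integrable lborel (\<lambda>x::real. C / (1 + x\<^sup>2))"
proof -
  have "integrable lborel (\<lambda>x::real. inverse (1 + x\<^sup>2))"
    using integrable_inverse_1_plus_square by (simp add: set_integrable_def einterval_eq_UNIV)
  from integrable_mult_right[OF this, of C] show ?thesis by (simp add: divide_inverse)
qed

lemma integrable_of_quadratic_decay:
  fixes f :: "real \<Rightarrow> 'a::{banach, second_countable_topology}"
  assumes "f \<in> borel_measurable borel" "\<And>x. norm (f x) \<le> C / (1 + x\<^sup>2)"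
  shows "integrable lborel f"
  by (rule Bochner_Integration.integrable_bound[OF integrable_quadratic_decay[of C]])
     (use assms in \<open>auto simp del: abs_divide intro!: AE_I2 order_trans[OF _ abs_ge_self]\<close>)

lemma integrable_pair_mult_cis:
  fixes g f :: "real \<Rightarrow> complex" and \<phi> :: "real \<Rightarrow> real \<Rightarrow> real"
  assumes g: "integrable lborel g" and f: "integrable lborel f"
    and [measurable]: "(\<lambda>(k, y). \<phi> k y) \<in> borel_measurable (lborel \<Otimes>\<^sub>M lborel)"
  shows "integrable (lborel \<Otimes>\<^sub>M lborel) (\<lambda>(k, y). g k * f y * cis (\<phi> k y))"
proof (rule lborel_pair.Fubini_integrable)
  note [measurable] = borel_measurable_integrable[OF g] borel_measurable_integrable[OF f]
  show "(\<lambda>(k, y). g k * f y * cis (\<phi> k y)) \<in> borel_measurable (lborel \<Otimes>\<^sub>M lborel)"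
    unfolding cis_conv_exp by measurable
  have "(\<lambda>k. \<integral>y. norm (case (k, y) of (k, y) \<Rightarrow> g k * f y * cis (\<phi> k y)) \<partial>lborel) = (\<lambda>k. norm (g k) * (\<integral>y. norm (f y) \<partial>lborel))"
    by (simp add: norm_mult)
  then show "integrable lborel (\<lambda>k. \<integral>y. norm (case (k, y) of (k, y) \<Rightarrow> g k * f y * cis (\<phi> k y)) \<partial>lborel)"
    using g by simp
  show "AE k in lborel. integrable lborel (\<lambda>y. case (k, y) of (k, y) \<Rightarrow> g k * f y * cis (\<phi> k y))"
  proof (rule AE_I2)
    fix k
    have [measurable]: "\<phi> k \<in> borel_measurable lborel" by measurable
    show "integrable lborel (\<lambda>y. case (k, y) of (k, y) \<Rightarrow> g k * f y * cis (\<phi> k y))"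
      by (rule Bochner_Integration.integrable_bound[OF integrable_mult_right[OF f, of "g k"]])
         (auto simp: norm_mult cis_conv_exp)
  qed
qed

lemma schwartz_has_derivative:
  "schwartz f \<Longrightarrow> ((nabla ^^ k) f has_vector_derivative (nabla ^^ Suc k) f x) (at x)"
  unfolding schwartz_def by (simp add: nabla_def vector_derivative_works)

lemma schwartz_decay:
  assumes f: "schwartz f"
  shows "\<exists>C. \<forall>x. norm ((nabla ^^ k) f x) \<le> C / (1 + x\<^sup>2)"
proof -
  have "bounded (range (\<lambda>x. complex_of_real (x ^ 0) * (nabla ^^ k) f x))"
    "bounded (range (\<lambda>x. complex_of_real (x ^ 2) * (nabla ^^ k) f x))"
    using f unfolding schwartz_def by blast+
  then obtain A B where A: "\<And>x. norm (complex_of_real (x ^ 0) * (nabla ^^ k) f x) \<le> A"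
    and B: "\<And>x. norm (complex_of_real (x ^ 2) * (nabla ^^ k) f x) \<le> B"
    unfolding bounded_iff by blast
  have "norm ((nabla ^^ k) f x) \<le> (A + B) / (1 + x\<^sup>2)" for x
  proof -
    have p: "1 + x\<^sup>2 > 0" by (simp add: add_pos_nonneg)
    have "norm ((nabla ^^ k) f x) * (1 + x\<^sup>2) \<le> A + B"
      using A[of x] B[of x] by (simp add: norm_mult norm_power algebra_simps)
    then show ?thesis using p by (simp add: pos_le_divide_eq)
  qed
  then show ?thesis by blast
qed

lemma schwartz_continuous: "schwartz f \<Longrightarrow> continuous_on S ((nabla ^^ k) f)"
  by (meson continuous_at_imp_continuous_on has_vector_derivative_continuous schwartz_has_derivative)

lemma schwartz_measurable: "schwartz f \<Longrightarrow> (nabla ^^ k) f \<in> borel_measurable borel"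
  by (rule borel_measurable_continuous_onI[OF schwartz_continuous])

lemma schwartz_integrable: "schwartz f \<Longrightarrow> integrable lborel ((nabla ^^ k) f)"
  using schwartz_decay[of f k] integrable_of_quadratic_decay[OF schwartz_measurable] by blast

lemma cis_measurable [measurable]: "(\<lambda>x. cis (g x)) \<in> borel_measurable M" if "g \<in> borel_measurable M" for g
  unfolding cis_conv_exp using that by measurable

lemma quadratic_decay_tendsto_0:
  fixes f :: "real \<Rightarrow> 'a::real_normed_vector"
  assumes "\<And>x. norm (f x) \<le> C / (1 + x\<^sup>2)"
  shows "(f \<longlongrightarrow> 0) at_top" "(f \<longlongrightarrow> 0) at_bot"
proof -
  have 1: "((\<lambda>x. C / (1 + x\<^sup>2)) \<longlongrightarrow> 0) at_top"
    by (rule real_tendsto_divide_at_top[OF tendsto_const filterlim_tendsto_add_at_top[OF tendsto_const filterlim_pow_at_top[OF _ filterlim_ident]]]) auto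
  have 2: "((\<lambda>x. C / (1 + x\<^sup>2)) \<longlongrightarrow> 0) at_bot"
    using 1 unfolding filterlim_at_bot_mirror by simp
  show "(f \<longlongrightarrow> 0) at_top" "(f \<longlongrightarrow> 0) at_bot"
    by (rule Lim_null_comparison[OF _ 1] Lim_null_comparison[OF _ 2], use assms in simp)+
qed

lemma integral_derivative_eq_0:
  fixes F :: "real \<Rightarrow> complex"
  assumes "\<And>x. (F has_vector_derivative g x) (at x)" "\<And>x. isCont g x" "integrable lborel g"
    and "(F \<longlongrightarrow> 0) at_top" "(F \<longlongrightarrow> 0) at_bot"
  shows "(\<integral>x. g x \<partial>lborel) = 0"
proof -
  have "(LBINT x=-\<infinity>..\<infinity>. g x) = 0 - 0"
    by (rule interval_integral_FTC_integrable[where F=F])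
       (use assms in \<open>auto simp: set_integrable_def einterval_eq_UNIV ereal_tendsto_simps\<close>)
  then show ?thesis by (simp add: interval_lebesgue_integral_def set_lebesgue_integral_def einterval_eq_UNIV)
qed

lemma integrable_mult_cis:
  fixes f :: "real \<Rightarrow> complex"
  assumes "integrable lborel f"
  shows "integrable lborel (\<lambda>x. f x * cis (k * x))"
  by (rule Bochner_Integration.integrable_bound[OF assms]) (use assms in \<open>auto simp: norm_mult\<close>)

text \<open>Integration by parts: the derivative of the function times the exponential integrates to
  zero, as the product decays at both ends.\<close>

lemma fourier_nabla:
  assumes f: "schwartz f"
  shows "fourier ((nabla ^^ Suc j) f) k = \<i> * of_real k * fourier ((nabla ^^ j) f) k"
proof -
  obtain C where C: "\<And>x. norm ((nabla ^^ j) f x) \<le> C / (1 + x\<^sup>2)" using schwartz_decay[OF f] by blast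
  have int: "integrable lborel (\<lambda>x. (nabla ^^ i) f x * cis (- k * x))" for i
    by (rule integrable_mult_cis[OF schwartz_integrable[OF f]])
  have "(\<integral>x. (nabla ^^ Suc j) f x * cis (- k * x) - \<i> * of_real k * ((nabla ^^ j) f x * cis (- k * x)) \<partial>lborel) = 0"
  proof (rule integral_derivative_eq_0)
    show "((\<lambda>x. (nabla ^^ j) f x * cis (- k * x)) has_vector_derivative
      (nabla ^^ Suc j) f x * cis (- k * x) - \<i> * of_real k * ((nabla ^^ j) f x * cis (- k * x))) (at x)" for x
    proof -
      have "((\<lambda>z. exp (\<i> * (- of_real k * z))) has_field_derivative exp (\<i> * (- of_real k * of_real x)) * (\<i> * - of_real k)) (at (of_real x))"
        by (auto intro!: derivative_eq_intros)
      from has_vector_derivative_real_field[OF this]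
      have "((\<lambda>x. cis (- k * x)) has_vector_derivative cis (- k * x) * (\<i> * - of_real k)) (at x)"
        by (simp add: cis_conv_exp)
      from has_vector_derivative_mult[OF schwartz_has_derivative[OF f] this] show ?thesis
        by (simp add: algebra_simps)
    qed
    show "isCont (\<lambda>x. (nabla ^^ Suc j) f x * cis (- k * x) - \<i> * of_real k * ((nabla ^^ j) f x * cis (- k * x))) x" for x
    proof -
      have "continuous_on UNIV (\<lambda>x. (nabla ^^ Suc j) f x * cis (- k * x) - \<i> * of_real k * ((nabla ^^ j) f x * cis (- k * x)))"
        unfolding cis_conv_exp by (intro continuous_intros schwartz_continuous f)
      then show ?thesis by (simp add: continuous_on_eq_continuous_at)
    qed
    show "integrable lborel (\<lambda>x. (nabla ^^ Suc j) f x * cis (- k * x) - \<i> * of_real k * ((nabla ^^ j) f x * cis (- k * x)))"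
      by (intro Bochner_Integration.integrable_diff integrable_mult_right int)
    have b: "norm ((nabla ^^ j) f x * cis (- k * x)) \<le> C / (1 + x\<^sup>2)" for x using C by (simp add: norm_mult)
    show "((\<lambda>x. (nabla ^^ j) f x * cis (- k * x)) \<longlongrightarrow> 0) at_top" "((\<lambda>x. (nabla ^^ j) f x * cis (- k * x)) \<longlongrightarrow> 0) at_bot"
      by (rule quadratic_decay_tendsto_0[OF b])+
  qed
  moreover have "(\<integral>x. (nabla ^^ Suc j) f x * cis (- k * x) - \<i> * of_real k * ((nabla ^^ j) f x * cis (- k * x)) \<partial>lborel)
     = fourier ((nabla ^^ Suc j) f) k - \<i> * of_real k * fourier ((nabla ^^ j) f) k"
    unfolding fourier_def by (subst Bochner_Integration.integral_diff[OF int integrable_mult_right[OF int]]) simp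
  ultimately show ?thesis by simp
qed

lemma fourier_norm_le:
  assumes "integrable lborel f"
  shows "norm (fourier f k) \<le> (\<integral>x. norm (f x) \<partial>lborel)"
proof -
  have "norm (fourier f k) \<le> (\<integral>x. norm (f x * cis (- k * x)) \<partial>lborel)"
    unfolding fourier_def by (rule integral_norm_bound)
  then show ?thesis by (simp add: norm_mult)
qed

lemma fourier_decay:
  assumes f: "schwartz f"
  shows "\<exists>C. \<forall>k. norm (fourier f k) \<le> C / (1 + k\<^sup>2)"
proof -
  have 2: "fourier ((nabla ^^ 2) f) k = - of_real (k\<^sup>2) * fourier f k" for k
    using fourier_nabla[OF f, of 0 k] fourier_nabla[OF f, of 1 k]
    by (simp add: numeral_2_eq_2 power2_eq_square algebra_simps)
  define C where "C = (\<integral>x. norm (f x) \<partial>lborel) + (\<integral>x. norm ((nabla ^^ 2) f x) \<partial>lborel)"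
  have "norm (fourier f k) \<le> C / (1 + k\<^sup>2)" for k
  proof -
    have p: "1 + k\<^sup>2 > 0" by (simp add: add_pos_nonneg)
    have "norm (fourier f k) * (1 + k\<^sup>2) = norm (fourier f k) + norm (fourier ((nabla ^^ 2) f) k)"
      unfolding 2 by (simp add: norm_mult norm_power algebra_simps)
    also have "\<dots> \<le> C"
      unfolding C_def using fourier_norm_le[OF schwartz_integrable[OF f, of 0]] fourier_norm_le[OF schwartz_integrable[OF f, of 2]]
      by (intro add_mono) auto
    finally show ?thesis using p by (simp add: pos_le_divide_eq)
  qed
  then show ?thesis by blast
qed

lemma fourier_measurable:
  assumes [measurable]: "f \<in> borel_measurable borel"
  shows "fourier f \<in> borel_measurable borel"
  unfolding fourier_def[abs_def] by measurable

lemma fourier_integrable: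
  assumes f: "schwartz f"
  shows "integrable lborel (fourier f)"
  using fourier_decay[OF f] integrable_of_quadratic_decay[OF fourier_measurable[OF schwartz_measurable[OF f, of 0, simplified]]] by blast

text \<open>A rescaling of the characteristic function of the standard normal law, written as a
  normal density of standard deviation \<open>\<epsilon>\<close> so that it serves as an approximate
  identity.\<close>

lemma gaussian_fourier:
  fixes \<epsilon> s :: real
  assumes e: "\<epsilon> > 0"
  shows "(\<integral>k. of_real (exp (- (\<epsilon> * k)\<^sup>2 / 2)) * cis (s * k) \<partial>lborel) = of_real (2 * pi * normal_density 0 \<epsilon> s)"
    and "integrable lborel (\<lambda>k. exp (- (\<epsilon> * k)\<^sup>2 / 2))"
proof -
  have n: "exp (- x\<^sup>2 / 2) = sqrt (2 * pi) * std_normal_density x" for x :: real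
    by (simp add: normal_density_def)
  have "integrable lborel (\<lambda>x. sqrt (2 * pi) * std_normal_density x)" by (intro integrable_mult_right) auto
  then have "integrable lborel (\<lambda>x::real. exp (- x\<^sup>2 / 2))" unfolding n .
  from lborel_integrable_real_affine[OF this, of \<epsilon> 0] e
  show "integrable lborel (\<lambda>k. exp (- (\<epsilon> * k)\<^sup>2 / 2))" by simp
  have "(\<integral>x. of_real (exp (- x\<^sup>2 / 2)) * cis (s / \<epsilon> * x) \<partial>lborel) = (\<integral>x. sqrt (2 * pi) *\<^sub>R (std_normal_density x *\<^sub>R cis (s / \<epsilon> * x)) \<partial>lborel)"
    unfolding n by (rule Bochner_Integration.integral_cong) (simp_all add: scaleR_conv_of_real mult.assoc)
  also have "\<dots> = sqrt (2 * pi) *\<^sub>R (\<integral>x. std_normal_density x *\<^sub>R cis (s / \<epsilon> * x) \<partial>lborel)" by (rule integral_scaleR_right)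
  also have "\<dots> = sqrt (2 * pi) *\<^sub>R char std_normal_distribution (s / \<epsilon>)"
    unfolding char_def by (subst integral_density) (auto simp: cis_conv_exp)
  also have "\<dots> = of_real (sqrt (2 * pi) * exp (- ((s / \<epsilon>)\<^sup>2) / 2))"
    unfolding char_std_normal_distribution by (simp add: scaleR_conv_of_real)
  finally have "(\<integral>x. of_real (exp (- x\<^sup>2 / 2)) * cis (s / \<epsilon> * x) \<partial>lborel) = of_real (sqrt (2 * pi) * exp (- ((s / \<epsilon>)\<^sup>2) / 2))" .
  moreover have "(\<integral>x. of_real (exp (- x\<^sup>2 / 2)) * cis (s / \<epsilon> * x) \<partial>lborel) = \<epsilon> *\<^sub>R (\<integral>k. of_real (exp (- (\<epsilon> * k)\<^sup>2 / 2)) * cis (s * k) \<partial>lborel)"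
    using lborel_integral_real_affine[of \<epsilon> "\<lambda>x. of_real (exp (- x\<^sup>2 / 2)) * cis (s / \<epsilon> * x)" 0] e by simp
  ultimately have "\<epsilon> *\<^sub>R (\<integral>k. of_real (exp (- (\<epsilon> * k)\<^sup>2 / 2)) * cis (s * k) \<partial>lborel) = complex_of_real (sqrt (2 * pi) * exp (- ((s / \<epsilon>)\<^sup>2) / 2))"
    by simp
  then have "(\<integral>k. of_real (exp (- (\<epsilon> * k)\<^sup>2 / 2)) * cis (s * k) \<partial>lborel) = complex_of_real (sqrt (2 * pi) * exp (- ((s / \<epsilon>)\<^sup>2) / 2) / \<epsilon>)"
    using e by (simp add: scaleR_conv_of_real field_simps)
  also have "sqrt (2 * pi) * exp (- ((s / \<epsilon>)\<^sup>2) / 2) / \<epsilon> = 2 * pi * normal_density 0 \<epsilon> s"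
  proof -
    have "sqrt (2 * pi) * sqrt (2 * pi) = 2 * pi" by simp
    then have "2 * pi / sqrt (2 * pi * \<epsilon>\<^sup>2) = sqrt (2 * pi) / \<epsilon>"
      using e by (simp add: real_sqrt_mult field_simps)
    moreover have "2 * pi * normal_density 0 \<epsilon> s = 2 * pi / sqrt (2 * pi * \<epsilon>\<^sup>2) * exp (- s\<^sup>2 / (2 * \<epsilon>\<^sup>2))"
      by (simp add: normal_density_def)
    moreover have "- ((s / \<epsilon>)\<^sup>2) / 2 = - s\<^sup>2 / (2 * \<epsilon>\<^sup>2)" by (simp add: power_divide)
    ultimately show ?thesis by simp
  qed
  finally show "(\<integral>k. of_real (exp (- (\<epsilon> * k)\<^sup>2 / 2)) * cis (s * k) \<partial>lborel) = of_real (2 * pi * normal_density 0 \<epsilon> s)" .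
qed

lemma normal_density_affine: "\<epsilon> > 0 \<Longrightarrow> \<epsilon> * normal_density m \<epsilon> (m + \<epsilon> * z) = std_normal_density z"
  by (simp add: normal_density_def real_sqrt_mult power_mult_distrib)

text \<open>A Gaussian cutoff in \<open>k\<close> makes the double integral absolutely convergent,
  so Fubini applies and the inner integral becomes an approximate identity. As the cutoff is
  removed, both sides converge by domination: one by integrability of the transform, the other by
  boundedness of \<open>f\<close>.\<close>

lemma fourier_inversion:
  assumes f: "schwartz f"
  shows "f x = 1 / (2 * of_real pi) * (\<integral>k. fourier f k * cis (k * x) \<partial>lborel)"
proof -
  define e where "e n = inverse (real (Suc n))" for n
  have e: "e n > 0" for n by (simp add: e_def)
  have e0: "e \<longlonglongrightarrow> 0" unfolding e_def[abs_def] by (rule LIMSEQ_inverse_real_of_nat)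
  have fm[measurable]: "f \<in> borel_measurable borel" using schwartz_measurable[OF f, of 0] by simp
  have fhm[measurable]: "fourier f \<in> borel_measurable borel" by (rule fourier_measurable) measurable
  have fi: "integrable lborel f" using schwartz_integrable[OF f, of 0] by simp
  have fc: "continuous_on UNIV f" using schwartz_continuous[OF f, of UNIV 0] by simp
  obtain C0 where C0: "\<And>x. norm (f x) \<le> C0 / (1 + x\<^sup>2)" using schwartz_decay[OF f, of 0] by auto
  have fb: "norm (f x) \<le> \<bar>C0\<bar>" for x
  proof -
    have p: "1 \<le> 1 + x\<^sup>2" by simp
    have "C0 / (1 + x\<^sup>2) \<le> \<bar>C0\<bar> / (1 + x\<^sup>2)" by (intro divide_right_mono) auto
    also have "\<dots> \<le> \<bar>C0\<bar> / 1" using p by (intro divide_left_mono) (auto simp: add_pos_nonneg)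
    finally show ?thesis using C0[of x] by simp
  qed
  have A: "(\<lambda>n. \<integral>k. of_real (exp (- (e n * k)\<^sup>2 / 2)) * (fourier f k * cis (k * x)) \<partial>lborel) \<longlonglongrightarrow> (\<integral>k. fourier f k * cis (k * x) \<partial>lborel)"
  proof (rule integral_dominated_convergence[where w="\<lambda>k. norm (fourier f k)"])
    show "integrable lborel (\<lambda>k. norm (fourier f k))" using fourier_integrable[OF f] by simp
    show "AE k in lborel. (\<lambda>n. of_real (exp (- (e n * k)\<^sup>2 / 2)) * (fourier f k * cis (k * x))) \<longlonglongrightarrow> fourier f k * cis (k * x)"
    proof (rule AE_I2)
      fix k
      have "(\<lambda>n. complex_of_real (exp (- (e n * k)\<^sup>2 / 2)) * (fourier f k * cis (k * x))) \<longlonglongrightarrow> of_real (exp (- (0 * k)\<^sup>2 / 2)) * (fourier f k * cis (k * x))"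
        by (intro tendsto_intros e0) auto
      then show "(\<lambda>n. of_real (exp (- (e n * k)\<^sup>2 / 2)) * (fourier f k * cis (k * x))) \<longlonglongrightarrow> fourier f k * cis (k * x)" by simp
    qed
    show "AE k in lborel. norm (of_real (exp (- (e n * k)\<^sup>2 / 2)) * (fourier f k * cis (k * x))) \<le> norm (fourier f k)" for n
      by (intro AE_I2) (simp add: norm_mult mult_left_le_one_le)
  qed measurable
  have B: "(\<integral>k. of_real (exp (- (e n * k)\<^sup>2 / 2)) * (fourier f k * cis (k * x)) \<partial>lborel)
     = of_real (2 * pi) * (\<integral>z. of_real (std_normal_density z) * f (x + e n * z) \<partial>lborel)" for n
  proof -
    define g where "g k = complex_of_real (exp (- (e n * k)\<^sup>2 / 2))" for k
    have gm[measurable]: "g \<in> borel_measurable borel" unfolding g_def[abs_def] by measurable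
    have gi: "integrable lborel g" unfolding g_def[abs_def] using gaussian_fourier(2)[OF e] by (rule integrable_of_real)
    have "(\<integral>k. g k * (fourier f k * cis (k * x)) \<partial>lborel) = (\<integral>k. (\<integral>y. g k * f y * cis (k * (x - y)) \<partial>lborel) \<partial>lborel)"
    proof (rule Bochner_Integration.integral_cong[OF refl])
      fix k
      have "(\<integral>y. g k * f y * cis (k * (x - y)) \<partial>lborel) = (\<integral>y. (g k * cis (k * x)) * (f y * cis (- k * y)) \<partial>lborel)"
        by (rule Bochner_Integration.integral_cong) (auto simp: cis_mult algebra_simps simp flip: cis_divide)
      then show "g k * (fourier f k * cis (k * x)) = (\<integral>y. g k * f y * cis (k * (x - y)) \<partial>lborel)"
        by (simp add: fourier_def)
    qed
    also have "\<dots> = (\<integral>y. (\<integral>k. g k * f y * cis (k * (x - y)) \<partial>lborel) \<partial>lborel)"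
      by (rule lborel_pair.Fubini_integral[symmetric]) (rule integrable_pair_mult_cis[OF gi fi], measurable)
    also have "\<dots> = (\<integral>y. f y * of_real (2 * pi * normal_density 0 (e n) (x - y)) \<partial>lborel)"
    proof (rule Bochner_Integration.integral_cong[OF refl])
      fix y
      have "(\<integral>k. g k * f y * cis (k * (x - y)) \<partial>lborel) = (\<integral>k. f y * (of_real (exp (- (e n * k)\<^sup>2 / 2)) * cis ((x - y) * k)) \<partial>lborel)"
        by (simp add: g_def mult_ac)
      then show "(\<integral>k. g k * f y * cis (k * (x - y)) \<partial>lborel) = f y * of_real (2 * pi * normal_density 0 (e n) (x - y))"
        by (simp only: integral_mult_right_zero gaussian_fourier(1)[OF e])
    qed
    also have "\<dots> = e n *\<^sub>R (\<integral>z. f (x + e n * z) * of_real (2 * pi * normal_density 0 (e n) (x - (x + e n * z))) \<partial>lborel)"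
      using lborel_integral_real_affine[of "e n" "\<lambda>y. f y * of_real (2 * pi * normal_density 0 (e n) (x - y))" x] e[of n] by simp
    also have "\<dots> = (\<integral>z. e n *\<^sub>R (f (x + e n * z) * of_real (2 * pi * normal_density 0 (e n) (x - (x + e n * z)))) \<partial>lborel)"
      by simp
    also have "\<dots> = (\<integral>z. of_real (2 * pi) * (of_real (std_normal_density z) * f (x + e n * z)) \<partial>lborel)"
    proof (rule Bochner_Integration.integral_cong[OF refl])
      fix z
      have "normal_density 0 (e n) (x - (x + e n * z)) = normal_density 0 (e n) (0 + e n * z)" by (simp add: normal_density_def)
      then show "e n *\<^sub>R (f (x + e n * z) * of_real (2 * pi * normal_density 0 (e n) (x - (x + e n * z))))
        = of_real (2 * pi) * (of_real (std_normal_density z) * f (x + e n * z))"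
        unfolding normal_density_affine[OF e[of n], of 0 z, symmetric] by (simp add: scaleR_conv_of_real mult_ac)
    qed
    finally show ?thesis unfolding g_def by simp
  qed
  have D: "(\<lambda>n. \<integral>z. of_real (std_normal_density z) * f (x + e n * z) \<partial>lborel) \<longlonglongrightarrow> (\<integral>z. of_real (std_normal_density z) * f x \<partial>lborel)"
  proof (rule integral_dominated_convergence[where w="\<lambda>z. std_normal_density z * \<bar>C0\<bar>"])
    show "integrable lborel (\<lambda>z. std_normal_density z * \<bar>C0\<bar>)" by (intro integrable_mult_left) auto
    show "AE z in lborel. (\<lambda>n. of_real (std_normal_density z) * f (x + e n * z)) \<longlonglongrightarrow> of_real (std_normal_density z) * f x"
    proof (intro AE_I2 tendsto_mult tendsto_const)
      fix z
      have l: "(\<lambda>n. x + e n * z) \<longlonglongrightarrow> x" using tendsto_add[OF tendsto_const tendsto_mult[OF e0 tendsto_const]] by fastforce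
      have "isCont f x" using fc by (simp add: continuous_on_eq_continuous_at)
      from isCont_tendsto_compose[OF this l]
      show "(\<lambda>n. f (x + e n * z)) \<longlonglongrightarrow> f x" .
    qed
    show "AE z in lborel. norm (of_real (std_normal_density z) * f (x + e n * z)) \<le> std_normal_density z * \<bar>C0\<bar>" for n
      by (intro AE_I2) (simp add: norm_mult mult_left_mono fb)
  qed measurable
  have "(\<integral>z. complex_of_real (std_normal_density z) * f x \<partial>lborel) = f x" by simp
  with tendsto_mult[OF tendsto_const D, of "of_real (2 * pi)"]
  have "(\<lambda>n. \<integral>k. of_real (exp (- (e n * k)\<^sup>2 / 2)) * (fourier f k * cis (k * x)) \<partial>lborel) \<longlonglongrightarrow> of_real (2 * pi) * f x"
    unfolding B by simp
  from LIMSEQ_unique[OF A this] show ?thesis by simp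
qed

text \<open>The cell of index \<open>a\<close> has length 1/n. Pushing Lebesgue measure forward to
  cell indices lets lattice sums be treated as integrals of step functions.\<close>

lemma distr_floor_scaled:
  assumes n: "n > 0"
  shows "distr lborel (count_space UNIV) (\<lambda>x. \<lfloor>real n * x\<rfloor>) = density (count_space UNIV) (\<lambda>_::int. ennreal (1 / real n))"
proof (rule measure_eqI_countable[where A=UNIV])
  fix a :: int
  have [measurable]: "(\<lambda>x. \<lfloor>real n * x\<rfloor>) \<in> borel \<rightarrow>\<^sub>M count_space UNIV" by measurable
  have v: "(\<lambda>x. \<lfloor>real n * x\<rfloor>) -` {a} \<inter> space lborel = {a / real n..<(a + 1) / real n}"
  proof -
    have "\<lfloor>real n * x\<rfloor> = a \<longleftrightarrow> a / real n \<le> x \<and> x < (a + 1) / real n" for x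
      using n by (simp add: floor_eq_iff pos_divide_le_eq pos_less_divide_eq mult.commute)
    then show ?thesis by (simp add: set_eq_iff)
  qed
  have "emeasure (distr lborel (count_space UNIV) (\<lambda>x. \<lfloor>real n * x\<rfloor>)) {a} = emeasure lborel {a / real n..<(a + 1) / real n}"
    using v by (simp add: emeasure_distr)
  also have "\<dots> = ennreal ((a + 1) / real n - a / real n)"
    by (rule emeasure_lborel_Ico) (use n in \<open>simp add: field_simps\<close>)
  also have "(a + 1) / real n - a / real n = 1 / real n" by (simp add: add_divide_distrib)
  also have "ennreal (1 / real n) = emeasure (density (count_space UNIV) (\<lambda>_::int. ennreal (1 / real n))) {a}"
    by (subst emeasure_density) (auto simp: nn_integral_count_space_indicator nn_integral_count_space_finite)
  finally show "emeasure (distr lborel (count_space UNIV) (\<lambda>x. \<lfloor>real n * x\<rfloor>)) {a} = \<dots>" .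
qed auto

text \<open>The point of the third claim is that its majorant does not depend on \<open>n\<close>,
  as dominated convergence requires.\<close>

lemma Riemann_sum_eq_integral:
  fixes F :: "real \<Rightarrow> complex"
  assumes n: "n > 0" and F: "continuous_on UNIV F" and C: "\<And>x. norm (F x) \<le> C / (1 + x\<^sup>2)"
  shows "(\<lambda>i::int. norm (F (of_int i / real n))) summable_on UNIV"
    and "1 / of_nat n * (\<Sum>\<^sub>\<infinity>i::int. F (of_int i / real n)) = (\<integral>x. F (of_int \<lfloor>real n * x\<rfloor> / real n) \<partial>lborel)"
    and "norm (F (of_int \<lfloor>real n * x\<rfloor> / real n)) \<le> 3 * \<bar>C\<bar> / (1 + x\<^sup>2)"
    and "(\<lambda>x. F (of_int \<lfloor>real n * x\<rfloor> / real n)) \<in> borel_measurable borel"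
proof -
  have [measurable]: "F \<in> borel_measurable borel" by (rule borel_measurable_continuous_onI[OF F])
  show m: "(\<lambda>x. F (of_int \<lfloor>real n * x\<rfloor> / real n)) \<in> borel_measurable borel" by measurable
  show bd: "norm (F (of_int \<lfloor>real n * x\<rfloor> / real n)) \<le> 3 * \<bar>C\<bar> / (1 + x\<^sup>2)" for x
  proof -
    \<comment> \<open>\<open>y\<close> is within distance 1 of \<open>x\<close>, which gives x^2 <=
      2 + 2 y^2 and hence the factor 3.\<close>
    define y where "y = of_int \<lfloor>real n * x\<rfloor> / real n"
    have "real n * y \<le> real n * x" "real n * x < real n * y + 1"
      using n by (auto simp: y_def)
    then have "y \<le> x" "real n * (x - y) < 1" using n by (auto simp: algebra_simps)
    moreover have "real n * (x - y) \<ge> 1 * (x - y)" using n \<open>y \<le> x\<close> by (intro mult_right_mono) auto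
    ultimately have "\<bar>x - y\<bar> \<le> 1" by simp
    then have "(x - y)\<^sup>2 \<le> 1" by (simp add: abs_square_le_1)
    moreover have "2 * (x - y)\<^sup>2 - (x - 2 * y)\<^sup>2 = x\<^sup>2 - 2 * y\<^sup>2" by (simp add: power2_eq_square algebra_simps)
    moreover have "0 \<le> (x - 2 * y)\<^sup>2" "0 \<le> y\<^sup>2" by simp_all
    ultimately have "1 + x\<^sup>2 \<le> 3 * (1 + y\<^sup>2)" by argo
    moreover have "0 < 1 + x\<^sup>2" "0 < 1 + y\<^sup>2" by (auto simp: add_pos_nonneg)
    ultimately have "\<bar>C\<bar> / (1 + y\<^sup>2) \<le> 3 * \<bar>C\<bar> / (1 + x\<^sup>2)"
      using mult_left_mono[of "1 + x\<^sup>2" "3 * (1 + y\<^sup>2)" "\<bar>C\<bar>"] by (simp add: field_simps)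
    moreover have "C / (1 + y\<^sup>2) \<le> \<bar>C\<bar> / (1 + y\<^sup>2)" by (intro divide_right_mono) auto
    ultimately show ?thesis using C[of y] unfolding y_def by linarith
  qed
  have int: "integrable lborel (\<lambda>x. F (of_int \<lfloor>real n * x\<rfloor> / real n))"
    by (rule integrable_of_quadratic_decay[OF m bd])
  have fl: "(\<lambda>x. \<lfloor>real n * x\<rfloor>) \<in> lborel \<rightarrow>\<^sub>M count_space UNIV" by measurable
  define f where "f i = F (of_int i / real n)" for i :: int
  have fm: "f \<in> borel_measurable (count_space UNIV)" by simp
  have "integrable (density (count_space UNIV) (\<lambda>_::int. ennreal (1 / real n))) f"
    unfolding distr_floor_scaled[OF n, symmetric] integrable_distr_eq[OF fl fm] using int by (simp add: f_def)
  then have "integrable (count_space UNIV) (\<lambda>i. (1 / real n) *\<^sub>R f i)"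
    by (subst (asm) integrable_density) auto
  from integrable_scaleR_right[OF this, of "real n"] have "integrable (count_space UNIV) f" using n by simp
  then have "Infinite_Set_Sum.abs_summable_on f UNIV" by (simp add: Infinite_Set_Sum.abs_summable_on_def)
  then have "(\<lambda>i. norm (f i)) summable_on UNIV" and s: "infsetsum f UNIV = infsum f UNIV"
    by (simp_all add: abs_summable_equivalent infsetsum_infsum)
  then show "(\<lambda>i::int. norm (F (of_int i / real n))) summable_on UNIV" by (simp add: f_def)
  have "(\<integral>x. f \<lfloor>real n * x\<rfloor> \<partial>lborel) = (\<integral>i. f i \<partial>density (count_space UNIV) (\<lambda>_::int. ennreal (1 / real n)))"
    unfolding distr_floor_scaled[OF n, symmetric] by (rule integral_distr[OF fl fm, symmetric])
  also have "\<dots> = (\<integral>i. (1 / real n) *\<^sub>R f i \<partial>count_space UNIV)"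
    by (subst integral_density) auto
  also have "\<dots> = (1 / real n) *\<^sub>R infsetsum f UNIV"
    unfolding infsetsum_def by (rule integral_scaleR_right)
  finally show "1 / of_nat n * (\<Sum>\<^sub>\<infinity>i::int. F (of_int i / real n)) = (\<integral>x. F (of_int \<lfloor>real n * x\<rfloor> / real n) \<partial>lborel)"
    unfolding s by (simp add: f_def[abs_def] scaleR_conv_of_real)
qed

lemma Riemann_sum_LIMSEQ:
  fixes F :: "real \<Rightarrow> complex"
  assumes F: "continuous_on UNIV F" and C: "\<And>x. norm (F x) \<le> C / (1 + x\<^sup>2)"
  shows "(\<lambda>n. 1 / of_nat n * (\<Sum>\<^sub>\<infinity>i::int. F (of_int i / real n))) \<longlonglongrightarrow> (\<integral>x. F x \<partial>lborel)"
proof (rule LIMSEQ_offset[where k=1])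
  have [measurable]: "F \<in> borel_measurable borel" by (rule borel_measurable_continuous_onI[OF F])
  \<comment> \<open>The index is shifted by one because there is no lattice of mesh 1/n at n =
    0.\<close>
  have p: "n + 1 > 0" for n :: nat by simp
  note R = Riemann_sum_eq_integral[OF p F C]
  have "(\<lambda>n. \<integral>x. F (of_int \<lfloor>real (n + 1) * x\<rfloor> / real (n + 1)) \<partial>lborel) \<longlonglongrightarrow> (\<integral>x. F x \<partial>lborel)"
  proof (rule integral_dominated_convergence[where w="\<lambda>x. 3 * \<bar>C\<bar> / (1 + x\<^sup>2)"])
    show "AE x in lborel. (\<lambda>n. F (of_int \<lfloor>real (n + 1) * x\<rfloor> / real (n + 1))) \<longlonglongrightarrow> F x"
    proof (rule AE_I2)
      fix x
      have "(\<lambda>n. of_int \<lfloor>real (n + 1) * x\<rfloor> / real (n + 1)) \<longlonglongrightarrow> x"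
      proof (rule tendsto_sandwich)
        show "\<forall>\<^sub>F n in sequentially. x - 1 / real (n + 1) \<le> of_int \<lfloor>real (n + 1) * x\<rfloor> / real (n + 1)"
        proof (intro always_eventually allI)
          fix n
          have "real (n + 1) * x - 1 \<le> of_int \<lfloor>real (n + 1) * x\<rfloor>" by linarith
          then have "(real (n + 1) * x - 1) / real (n + 1) \<le> of_int \<lfloor>real (n + 1) * x\<rfloor> / real (n + 1)"
            by (intro divide_right_mono) auto
          then show "x - 1 / real (n + 1) \<le> of_int \<lfloor>real (n + 1) * x\<rfloor> / real (n + 1)"
            by (simp add: diff_divide_distrib)
        qed
        show "\<forall>\<^sub>F n in sequentially. of_int \<lfloor>real (n + 1) * x\<rfloor> / real (n + 1) \<le> x"
        proof (intro always_eventually allI)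
          fix n
          have "of_int \<lfloor>real (n + 1) * x\<rfloor> \<le> x * real (n + 1)" by (metis mult.commute of_int_floor_le)
          then show "of_int \<lfloor>real (n + 1) * x\<rfloor> / real (n + 1) \<le> x"
            by (subst pos_divide_le_eq) auto
        qed
        have "(\<lambda>n. x - 1 / real (n + 1)) \<longlonglongrightarrow> x - 0"
          by (intro tendsto_intros LIMSEQ_Suc[OF lim_1_over_n, unfolded Suc_eq_plus1])
        then show "(\<lambda>n. x - 1 / real (n + 1)) \<longlonglongrightarrow> x" by simp
      qed simp
      moreover have "isCont F x" using F by (simp add: continuous_on_eq_continuous_at)
      ultimately show "(\<lambda>n. F (of_int \<lfloor>real (n + 1) * x\<rfloor> / real (n + 1))) \<longlonglongrightarrow> F x"
        by (rule isCont_tendsto_compose[rotated])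
    qed
    show "AE x in lborel. norm (F (of_int \<lfloor>real (n + 1) * x\<rfloor> / real (n + 1))) \<le> 3 * \<bar>C\<bar> / (1 + x\<^sup>2)" for n
      by (intro AE_I2 R(3))
    show "(\<lambda>x. F (of_int \<lfloor>real (n + 1) * x\<rfloor> / real (n + 1))) \<in> borel_measurable lborel" for n
      using R(4) by simp
  qed (use integrable_quadratic_decay in auto)
  then show "(\<lambda>n. 1 / of_nat (n + 1) * (\<Sum>\<^sub>\<infinity>i::int. F (of_int i / real (n + 1)))) \<longlonglongrightarrow> (\<integral>x. F x \<partial>lborel)"
    unfolding R(2) .
qed

section \<open>The characteristic function of the limiting kernel\<close>

text \<open>The Fourier symbol of \<open>- L_op\<close>.\<close>

definition symb :: "real \<Rightarrow> complex" where
  "symb \<xi> = of_real (1 / sqrt 2) * (of_real (\<bar>\<xi>\<bar> powr (3 / 2)) - \<i> * of_real (\<xi> * \<bar>\<xi>\<bar> powr (1 / 2)))"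

lemma symb_continuous: "continuous_on UNIV symb"
  unfolding symb_def[abs_def] by (intro continuous_intros continuous_on_powr') auto

lemma Re_symb: "Re (symb \<xi>) \<ge> 0"
  by (simp add: symb_def)

text \<open>One polynomial majorant for all powers that occur. The largest exponent is 5/2, from two
  factors \<open>\<xi>\<close> in the differentiation under the integral.\<close>

lemma abs_powr_le:
  fixes \<xi> p :: real
  assumes "0 \<le> p" "p \<le> 4"
  shows "\<bar>\<xi>\<bar> powr p \<le> 1 + \<xi> ^ 4"
proof (cases "\<bar>\<xi>\<bar> \<le> 1")
  case True
  then have "\<bar>\<xi>\<bar> powr p \<le> 1" using assms by (intro powr_le1) auto
  then show ?thesis by (simp add: add_increasing2)
next
  case False
  then have "\<bar>\<xi>\<bar> powr p \<le> \<bar>\<xi>\<bar> powr 4" using assms by (intro powr_mono) auto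
  also have "\<dots> = \<xi> ^ 4" using False by (simp add: powr_numeral)
  finally show ?thesis by simp
qed

lemma abs_mult_powr: "\<bar>\<xi>\<bar> ^ k * \<bar>\<xi>\<bar> powr p = \<bar>\<xi>\<bar> powr (real k + p)" for \<xi> :: real
  by (cases "\<xi> = 0") (auto simp: powr_add powr_realpow)

lemma symb_le: "norm (symb \<xi>) \<le> 2 * (1 + \<xi> ^ 4)"
proof -
  have "norm (symb \<xi>) \<le> (1 / sqrt 2) * (\<bar>\<xi>\<bar> powr (3 / 2) + \<bar>\<xi>\<bar> ^ 1 * \<bar>\<xi>\<bar> powr (1 / 2))"
  proof -
    have "norm (of_real (\<bar>\<xi>\<bar> powr (3 / 2)) - \<i> * of_real (\<xi> * \<bar>\<xi>\<bar> powr (1 / 2))) \<le> \<bar>\<xi>\<bar> powr (3 / 2) + \<bar>\<xi>\<bar> ^ 1 * \<bar>\<xi>\<bar> powr (1 / 2)"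
      by (rule order_trans[OF norm_triangle_ineq4]) (simp add: norm_mult)
    then show ?thesis unfolding symb_def norm_mult norm_of_real by (intro mult_mono) auto
  qed
  also have "\<dots> \<le> 1 * ((1 + \<xi> ^ 4) + (1 + \<xi> ^ 4))"
    unfolding abs_mult_powr by (intro mult_mono add_mono abs_powr_le) auto
  finally show ?thesis by simp
qed

lemma power4_add_le: "(a + b) ^ 4 \<le> 8 * (a ^ 4 + b ^ 4)" for a b :: real
proof -
  have "(a + b)\<^sup>2 \<le> 2 * (a\<^sup>2 + b\<^sup>2)" using zero_le_power2[of "a - b"] by (simp add: power2_eq_square algebra_simps)
  then have "((a + b)\<^sup>2)\<^sup>2 \<le> (2 * (a\<^sup>2 + b\<^sup>2))\<^sup>2" by (intro power_mono) auto
  also have "\<dots> \<le> 8 * ((a\<^sup>2)\<^sup>2 + (b\<^sup>2)\<^sup>2)"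
  proof -
    have "(2 * (A + B))\<^sup>2 \<le> 8 * (A\<^sup>2 + B\<^sup>2)" for A B :: real
      using zero_le_power2[of "A - B"] by (simp add: power2_eq_square algebra_simps)
    then show ?thesis .
  qed
  finally show ?thesis by (simp flip: power_mult)
qed

text \<open>Normal moments are centred at \<open>\<kappa>\<close>, so the fourth power is first
  split into powers of \<open>\<kappa>\<close> and of \<open>\<xi> - \<kappa>\<close>.\<close>

lemma integrable_normal_power4:
  fixes g :: "real \<Rightarrow> 'a::{banach, second_countable_topology}"
  assumes d: "\<delta> > 0" and [measurable]: "g \<in> borel_measurable borel" and g: "\<And>\<xi>. norm (g \<xi>) \<le> A * (1 + \<xi> ^ 4)"
  shows "integrable lborel (\<lambda>\<xi>. normal_density \<kappa> \<delta> \<xi> *\<^sub>R g \<xi>)"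
proof (rule Bochner_Integration.integrable_bound)
  have A: "A \<ge> 0" using order_trans[OF norm_ge_zero g[of 0]] by simp
  have "normal_density \<kappa> \<delta> \<xi> * (A * (1 + 8 * \<kappa> ^ 4 + 8 * (\<xi> - \<kappa>) ^ 4))
      = (A * (1 + 8 * \<kappa> ^ 4)) * normal_density \<kappa> \<delta> \<xi> + (8 * A) * (normal_density \<kappa> \<delta> \<xi> * (\<xi> - \<kappa>) ^ 4)" for \<xi>
    by (simp add: algebra_simps)
  moreover have "integrable lborel (\<lambda>\<xi>. (A * (1 + 8 * \<kappa> ^ 4)) * normal_density \<kappa> \<delta> \<xi> + (8 * A) * (normal_density \<kappa> \<delta> \<xi> * (\<xi> - \<kappa>) ^ 4))"
    using integrable_normal_density[OF d, of \<kappa>] integrable_normal_moment[OF d, of \<kappa> 4] by (intro Bochner_Integration.integrable_add integrable_mult_right)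
  ultimately show "integrable lborel (\<lambda>\<xi>. normal_density \<kappa> \<delta> \<xi> * (A * (1 + 8 * \<kappa> ^ 4 + 8 * (\<xi> - \<kappa>) ^ 4)))" by simp
  show "AE \<xi> in lborel. norm (normal_density \<kappa> \<delta> \<xi> *\<^sub>R g \<xi>) \<le> norm (normal_density \<kappa> \<delta> \<xi> * (A * (1 + 8 * \<kappa> ^ 4 + 8 * (\<xi> - \<kappa>) ^ 4)))"
  proof (rule AE_I2)
    fix \<xi>
    have "\<xi> ^ 4 \<le> 8 * (\<kappa> ^ 4 + (\<xi> - \<kappa>) ^ 4)" using power4_add_le[of \<kappa> "\<xi> - \<kappa>"] by simp
    then have "A * (1 + \<xi> ^ 4) \<le> A * (1 + 8 * \<kappa> ^ 4 + 8 * (\<xi> - \<kappa>) ^ 4)" using A by (intro mult_left_mono) auto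
    with g[of \<xi>] have "norm (g \<xi>) \<le> \<bar>A * (1 + 8 * \<kappa> ^ 4 + 8 * (\<xi> - \<kappa>) ^ 4)\<bar>" by linarith
    then show "norm (normal_density \<kappa> \<delta> \<xi> *\<^sub>R g \<xi>) \<le> norm (normal_density \<kappa> \<delta> \<xi> * (A * (1 + 8 * \<kappa> ^ 4 + 8 * (\<xi> - \<kappa>) ^ 4)))"
      unfolding norm_scaleR real_norm_def abs_mult[of "normal_density \<kappa> \<delta> \<xi>"] by (intro mult_left_mono) auto
  qed
qed measurable

text \<open>Approximate eigenfunctions of \<open>L_op\<close> in the supremum norm: the Fourier transform, divided by
  \<open>2 \<pi>\<close>, is the normal density of mean \<open>\<kappa>\<close> and standard deviation \<open>\<delta>\<close>.\<close>

definition packet :: "real \<Rightarrow> real \<Rightarrow> real \<Rightarrow> complex" where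
  "packet \<kappa> \<delta> x = of_real (exp (- (\<delta> * x)\<^sup>2 / 2)) * cis (\<kappa> * x)"

lemma norm_packet_le: "norm (packet \<kappa> \<delta> x) \<le> 1"
  by (simp add: packet_def norm_mult)

lemma packet_measurable [measurable]: "packet \<kappa> \<delta> \<in> borel_measurable borel"
  unfolding packet_def[abs_def] by measurable

lemma power_div_fact_le_exp: "y ^ m / fact m \<le> exp y" if "y \<ge> 0" for y :: real
proof -
  have "(\<Sum>n\<in>{m}. inverse (fact n) * y ^ n) \<le> (\<Sum>n. inverse (fact n) * y ^ n)"
    by (rule sum_le_suminf[OF summable_exp]) (use that in auto)
  then show ?thesis by (simp add: exp_def divide_inverse mult.commute scaleR_conv_of_real)
qed

text \<open>With \<open>y = (\<delta> * x)^2 / 2\<close> one has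
  \<open>\<bar>x\<bar> ^ m \<le> 1 + (2 / \<delta>^2) ^ m * y ^ m\<close>, and
  \<open>y ^ m / fact m\<close> is a single term of the series of \<open>exp y\<close>.\<close>

lemma bounded_monomial_gaussian:
  fixes \<delta> x :: real
  assumes d: "\<delta> > 0"
  shows "\<bar>x\<bar> ^ m * exp (- (\<delta> * x)\<^sup>2 / 2) \<le> 1 + fact m * (2 / \<delta>\<^sup>2) ^ m"
proof -
  define y where "y = (\<delta> * x)\<^sup>2 / 2"
  have y: "y \<ge> 0" by (simp add: y_def)
  have "\<bar>x\<bar> ^ m \<le> 1 + (x\<^sup>2) ^ m"
  proof (cases "\<bar>x\<bar> \<le> 1")
    case True
    then have "\<bar>x\<bar> ^ m \<le> 1" by (intro power_le_one) auto
    then show ?thesis by (simp add: add_increasing2)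
  next
    case False
    then have "\<bar>x\<bar> ^ m \<le> (\<bar>x\<bar> ^ m) ^ 2"
      using mult_right_mono[of 1 "\<bar>x\<bar> ^ m" "\<bar>x\<bar> ^ m"] one_le_power[of "\<bar>x\<bar>" m] by (simp add: power2_eq_square)
    also have "(\<bar>x\<bar> ^ m) ^ 2 = (x\<^sup>2) ^ m" unfolding power_mult[symmetric] mult.commute[of m] unfolding power_mult power2_abs ..
    finally show ?thesis by simp
  qed
  moreover have "(x\<^sup>2) ^ m = (2 / \<delta>\<^sup>2) ^ m * y ^ m"
    using d by (simp add: y_def power_mult_distrib flip: power_mult_distrib[of _ _ m])
  moreover have "y ^ m \<le> fact m * exp y" using power_div_fact_le_exp[OF y, of m] by (simp add: pos_divide_le_eq mult.commute)
  then have "(2 / \<delta>\<^sup>2) ^ m * y ^ m \<le> (2 / \<delta>\<^sup>2) ^ m * (fact m * exp y)" by (intro mult_left_mono) auto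
  moreover have "1 \<le> exp y" using y by simp
  moreover have "(2 / \<delta>\<^sup>2) ^ m * (fact m * exp y) = fact m * (2 / \<delta>\<^sup>2) ^ m * exp y" by simp
  ultimately have "\<bar>x\<bar> ^ m \<le> exp y + fact m * (2 / \<delta>\<^sup>2) ^ m * exp y" by linarith
  then have "\<bar>x\<bar> ^ m * exp (- y) \<le> (exp y + fact m * (2 / \<delta>\<^sup>2) ^ m * exp y) * exp (- y)"
    by (rule mult_right_mono) simp
  also have "\<dots> = 1 + fact m * (2 / \<delta>\<^sup>2) ^ m" by (simp add: algebra_simps flip: exp_add)
  finally show ?thesis by (simp add: y_def)
qed

text \<open>Induction on the polynomial for all monomials at once: after the constant coefficient is
  split off, the remaining factor \<open>x\<close> is moved into the monomial and raises
  \<open>m\<close> by one.\<close>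

lemma bounded_poly_packet:
  assumes d: "\<delta> > 0"
  shows "bounded (range (\<lambda>x. complex_of_real (x ^ m) * (poly p (of_real x) * packet \<kappa> \<delta> x)))"
proof (induction p arbitrary: m)
  case 0
  then show ?case by simp
next
  case (pCons a p)
  have "norm (a * (complex_of_real (x ^ m) * packet \<kappa> \<delta> x)) \<le> norm a * (1 + fact m * (2 / \<delta>\<^sup>2) ^ m)" for x
    unfolding norm_mult[of a] using bounded_monomial_gaussian[OF d, of x m]
    by (intro mult_left_mono) (auto simp: packet_def norm_mult norm_power power_abs)
  then have "bounded (range (\<lambda>x. a * (complex_of_real (x ^ m) * packet \<kappa> \<delta> x)))"
    unfolding bounded_iff by blast
  from bounded_plus_comp[OF this pCons.IH[of "Suc m"]] show ?case
    by (simp add: algebra_simps)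
qed

lemma packet_deriv: "(packet \<kappa> \<delta> has_vector_derivative (\<i> * of_real \<kappa> - of_real (\<delta>\<^sup>2) * of_real x) * packet \<kappa> \<delta> x) (at x)"
proof -
  have "((\<lambda>z. exp (- (of_real \<delta> * z)\<^sup>2 / 2 + \<i> * (of_real \<kappa> * z))) has_field_derivative
     exp (- (of_real \<delta> * of_real x)\<^sup>2 / 2 + \<i> * (of_real \<kappa> * of_real x)) * (\<i> * of_real \<kappa> - (of_real \<delta>)\<^sup>2 * of_real x)) (at (of_real x))"
    by (auto intro!: derivative_eq_intros simp: power2_eq_square algebra_simps)
  from has_vector_derivative_real_field[OF this]
  have d: "((\<lambda>x. exp (- (of_real \<delta> * of_real x)\<^sup>2 / 2 + \<i> * (of_real \<kappa> * of_real x))) has_vector_derivative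
     exp (- (of_real \<delta> * of_real x)\<^sup>2 / 2 + \<i> * (of_real \<kappa> * of_real x)) * (\<i> * of_real \<kappa> - (of_real \<delta>)\<^sup>2 * of_real x)) (at x)" .
  have pk: "packet \<kappa> \<delta> x = exp (- (of_real \<delta> * of_real x)\<^sup>2 / 2 + \<i> * (of_real \<kappa> * of_real x))" for x
    unfolding packet_def cis_conv_exp exp_add exp_of_real[symmetric] by simp
  have pk': "packet \<kappa> \<delta> = (\<lambda>x. exp (- (of_real \<delta> * of_real x)\<^sup>2 / 2 + \<i> * (of_real \<kappa> * of_real x)))"
    by (rule ext) (rule pk)
  show ?thesis using d unfolding pk[of x] pk' by (simp only: mult.commute of_real_power)
qed

lemma nabla_packet:
  "\<exists>p. (nabla ^^ k) (packet \<kappa> \<delta>) = (\<lambda>x. poly p (of_real x) * packet \<kappa> \<delta> x) \<and>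
     (\<forall>x. (nabla ^^ k) (packet \<kappa> \<delta>) differentiable (at x))"
proof -
  have d: "((\<lambda>x. poly p (of_real x) * packet \<kappa> \<delta> x) has_vector_derivative
      poly (pderiv p + [:\<i> * of_real \<kappa>, - of_real (\<delta>\<^sup>2):] * p) (of_real x) * packet \<kappa> \<delta> x) (at x)" for p x
    using has_vector_derivative_mult[OF has_vector_derivative_real_field[OF poly_DERIV[of p "of_real x"]] packet_deriv[of \<kappa> \<delta> x]]
    by (simp add: algebra_simps)
  have "\<exists>p. (nabla ^^ k) (packet \<kappa> \<delta>) = (\<lambda>x. poly p (of_real x) * packet \<kappa> \<delta> x)"
  proof (induction k)
    case 0
    show ?case by (intro exI[of _ 1]) simp
  next
    case (Suc k)
    then obtain p where p: "(nabla ^^ k) (packet \<kappa> \<delta>) = (\<lambda>x. poly p (of_real x) * packet \<kappa> \<delta> x)" by blast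
    have "(nabla ^^ Suc k) (packet \<kappa> \<delta>) = (\<lambda>x. poly (pderiv p + [:\<i> * of_real \<kappa>, - of_real (\<delta>\<^sup>2):] * p) (of_real x) * packet \<kappa> \<delta> x)"
      by (rule ext) (simp only: funpow.simps o_apply p nabla_def vector_derivative_at[OF d])
    then show ?case by blast
  qed
  then obtain p where p: "(nabla ^^ k) (packet \<kappa> \<delta>) = (\<lambda>x. poly p (of_real x) * packet \<kappa> \<delta> x)" by blast
  have "(nabla ^^ k) (packet \<kappa> \<delta>) differentiable (at x)" for x
    unfolding p using d[of p x] by (metis differentiableI_vector)
  with p show ?thesis by blast
qed

lemma schwartz_packet:
  assumes d: "\<delta> > 0"
  shows "schwartz (packet \<kappa> \<delta>)"
  unfolding schwartz_def
proof (intro conjI allI)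
  fix k m :: nat and x :: real
  obtain p where p: "(nabla ^^ k) (packet \<kappa> \<delta>) = (\<lambda>x. poly p (of_real x) * packet \<kappa> \<delta> x)"
    "\<And>x. (nabla ^^ k) (packet \<kappa> \<delta>) differentiable (at x)" using nabla_packet by blast
  show "(nabla ^^ k) (packet \<kappa> \<delta>) differentiable (at x)" by (rule p)
  show "bounded (range (\<lambda>x. complex_of_real (x ^ m) * (nabla ^^ k) (packet \<kappa> \<delta>) x))"
    unfolding p(1) by (rule bounded_poly_packet[OF d])
qed

lemma fourier_packet:
  assumes d: "\<delta> > 0"
  shows "fourier (packet \<kappa> \<delta>) \<xi> = of_real (2 * pi * normal_density \<kappa> \<delta> \<xi>)"
proof -
  have "fourier (packet \<kappa> \<delta>) \<xi> = (\<integral>x. of_real (exp (- (\<delta> * x)\<^sup>2 / 2)) * cis ((\<kappa> - \<xi>) * x) \<partial>lborel)"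
    unfolding fourier_def packet_def by (rule Bochner_Integration.integral_cong) (auto simp: cis_mult algebra_simps)
  also have "\<dots> = of_real (2 * pi * normal_density 0 \<delta> (\<kappa> - \<xi>))" by (rule gaussian_fourier(1)[OF d])
  also have "normal_density 0 \<delta> (\<kappa> - \<xi>) = normal_density \<kappa> \<delta> \<xi>" by (simp add: normal_density_def power2_commute)
  finally show ?thesis .
qed

text \<open>The first-order Taylor remainder of the exponential is at most
  \<open>(\<xi> * h)^2 / 2\<close>, so integrability of the second moment bounds the error of the
  difference by a multiple of \<open>h^2\<close>.\<close>

lemma derivative_of_fourier_integral:
  fixes g :: "real \<Rightarrow> complex"
  assumes g0: "integrable lborel g" and g1: "integrable lborel (\<lambda>\<xi>. of_real \<xi> * g \<xi>)" and g2: "integrable lborel (\<lambda>\<xi>. of_real (\<xi>\<^sup>2) * g \<xi>)"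
  shows "((\<lambda>x. \<integral>\<xi>. g \<xi> * cis (\<xi> * x) \<partial>lborel) has_vector_derivative (\<integral>\<xi>. \<i> * of_real \<xi> * g \<xi> * cis (\<xi> * x) \<partial>lborel)) (at x)"
proof -
  define F where "F x = (\<integral>\<xi>. g \<xi> * cis (\<xi> * x) \<partial>lborel)" for x
  define D where "D = (\<integral>\<xi>. \<i> * of_real \<xi> * g \<xi> * cis (\<xi> * x) \<partial>lborel)"
  define C where "C = (\<integral>\<xi>. norm (of_real (\<xi>\<^sup>2) * g \<xi>) \<partial>lborel)"
  have c: "integrable lborel (\<lambda>\<xi>. g' \<xi> * cis (\<xi> * y))" if "integrable lborel g'" for g' :: "real \<Rightarrow> complex" and y
    using integrable_mult_cis[OF that, of y] by (simp add: mult.commute)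
  have i1: "integrable lborel (\<lambda>\<xi>. \<i> * of_real \<xi> * g \<xi> * cis (\<xi> * x))"
    using c[OF integrable_mult_right[OF g1, of \<i>], of x] by (simp add: mult.assoc)
  have bd: "norm (F (x + h) - F x - h *\<^sub>R D) \<le> C * h\<^sup>2" for h
  proof -
    have eq: "F (x + h) - F x - h *\<^sub>R D = (\<integral>\<xi>. g \<xi> * cis (\<xi> * (x + h)) - g \<xi> * cis (\<xi> * x) - h *\<^sub>R (\<i> * of_real \<xi> * g \<xi> * cis (\<xi> * x)) \<partial>lborel)"
      unfolding F_def D_def using c[OF g0] i1 by simp
    have "norm (F (x + h) - F x - h *\<^sub>R D) \<le> (\<integral>\<xi>. norm (g \<xi> * cis (\<xi> * (x + h)) - g \<xi> * cis (\<xi> * x) - h *\<^sub>R (\<i> * of_real \<xi> * g \<xi> * cis (\<xi> * x))) \<partial>lborel)"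
      unfolding eq by (rule integral_norm_bound)
    also have "\<dots> \<le> (\<integral>\<xi>. norm (of_real (\<xi>\<^sup>2) * g \<xi>) * h\<^sup>2 \<partial>lborel)"
    proof (rule integral_mono)
      show "integrable lborel (\<lambda>\<xi>. norm (g \<xi> * cis (\<xi> * (x + h)) - g \<xi> * cis (\<xi> * x) - h *\<^sub>R (\<i> * of_real \<xi> * g \<xi> * cis (\<xi> * x))))"
        using c[OF g0] i1 by (intro integrable_norm Bochner_Integration.integrable_diff integrable_scaleR_right)
      show "integrable lborel (\<lambda>\<xi>. norm (of_real (\<xi>\<^sup>2) * g \<xi>) * h\<^sup>2)" using g2 by (intro integrable_mult_left integrable_norm)
      fix \<xi>
      have "g \<xi> * cis (\<xi> * (x + h)) - g \<xi> * cis (\<xi> * x) - h *\<^sub>R (\<i> * of_real \<xi> * g \<xi> * cis (\<xi> * x))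
        = g \<xi> * cis (\<xi> * x) * (cis (\<xi> * h) - (1 + \<i> * of_real (\<xi> * h)))"
        by (simp add: distrib_left scaleR_conv_of_real algebra_simps flip: cis_mult)
      also have "norm \<dots> \<le> norm (g \<xi>) * ((\<xi> * h)\<^sup>2 / 2)"
        using iexp_approx1[of "\<xi> * h" 1] unfolding norm_mult
        by (intro mult_mono) (auto simp: cis_conv_exp numeral_2_eq_2)
      also have "\<dots> \<le> norm (of_real (\<xi>\<^sup>2) * g \<xi>) * h\<^sup>2"
        by (simp add: norm_mult norm_power power_mult_distrib mult_ac mult_left_le)
      finally show "norm (g \<xi> * cis (\<xi> * (x + h)) - g \<xi> * cis (\<xi> * x) - h *\<^sub>R (\<i> * of_real \<xi> * g \<xi> * cis (\<xi> * x))) \<le> norm (of_real (\<xi>\<^sup>2) * g \<xi>) * h\<^sup>2" .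
    qed
    finally show ?thesis by (simp add: C_def)
  qed
  have "(F has_vector_derivative D) (at x)"
    unfolding has_vector_derivative_def has_derivative_at
  proof
    show "bounded_linear (\<lambda>h. h *\<^sub>R D)" by (rule bounded_linear_scaleR_left)
    show "(\<lambda>h. norm (F (x + h) - F x - h *\<^sub>R D) / norm h) \<midarrow>0\<rightarrow> 0"
    proof (rule Lim_null_comparison)
      show "\<forall>\<^sub>F h in at 0. norm (norm (F (x + h) - F x - h *\<^sub>R D) / norm h) \<le> C * \<bar>h\<bar>"
        unfolding eventually_at_filter
        by (intro always_eventually allI impI) (use bd in \<open>simp add: pos_divide_le_eq power2_eq_square mult.assoc\<close>)
      show "((\<lambda>h. C * \<bar>h\<bar>) \<longlongrightarrow> 0) (at 0)" by (auto intro!: tendsto_eq_intros)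
    qed
  qed
  then show ?thesis by (simp add: F_def[abs_def] D_def)
qed

lemma integral_two_pi_cancel:
  fixes g :: "real \<Rightarrow> complex"
  shows "1 / (2 * of_real pi) * (\<integral>\<xi>. (2 * of_real pi) * g \<xi> \<partial>lborel) = (\<integral>\<xi>. g \<xi> \<partial>lborel)"
  by (subst integral_mult_right_zero) simp

text \<open>The factor \<open>2 * pi\<close> of \<open>fourier_packet\<close> cancels the one in the
  multiplier, so each fractional power multiplies the normal density by its symbol; the gradient
  adds \<open>\<i> * \<xi>\<close>.\<close>

lemma L_op_packet:
  assumes d: "\<delta> > 0"
  shows "L_op (packet \<kappa> \<delta>) x = - (\<integral>\<xi>. normal_density \<kappa> \<delta> \<xi> *\<^sub>R symb \<xi> * cis (\<xi> * x) \<partial>lborel)"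
proof -
  define N where "N = normal_density \<kappa> \<delta>"
  have FL: "frac_laplacian s (packet \<kappa> \<delta>) = (\<lambda>x. \<integral>\<xi>. (N \<xi> *\<^sub>R of_real (\<bar>\<xi>\<bar> powr (2 * s))) * cis (\<xi> * x) \<partial>lborel)" for s
  proof
    fix x
    have "frac_laplacian s (packet \<kappa> \<delta>) x = 1 / (2 * of_real pi) * (\<integral>\<xi>. (2 * of_real pi) * ((N \<xi> *\<^sub>R of_real (\<bar>\<xi>\<bar> powr (2 * s))) * cis (\<xi> * x)) \<partial>lborel)"
    proof -
      have "complex_of_real (\<bar>\<xi>\<bar> powr (2 * s)) * of_real (2 * pi * N \<xi>) * cis (\<xi> * x) = (2 * of_real pi) * ((N \<xi> *\<^sub>R of_real (\<bar>\<xi>\<bar> powr (2 * s))) * cis (\<xi> * x))" for \<xi>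
        by (simp add: scaleR_conv_of_real)
      then show ?thesis unfolding frac_laplacian_def fourier_packet[OF d] N_def[symmetric] by (simp only:)
    qed
    then show "frac_laplacian s (packet \<kappa> \<delta>) x = (\<integral>\<xi>. (N \<xi> *\<^sub>R of_real (\<bar>\<xi>\<bar> powr (2 * s))) * cis (\<xi> * x) \<partial>lborel)"
      unfolding integral_two_pi_cancel .
  qed
  have pb: "norm (of_real (\<xi> ^ k) * complex_of_real (\<bar>\<xi>\<bar> powr p)) \<le> 1 * (1 + \<xi> ^ 4)" if "0 \<le> p" "real k + p \<le> 4" for p \<xi> :: real and k
  proof -
    have "norm (of_real (\<xi> ^ k) * complex_of_real (\<bar>\<xi>\<bar> powr p)) = \<bar>\<xi>\<bar> ^ k * \<bar>\<xi>\<bar> powr p"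
      unfolding norm_mult norm_of_real by (simp add: power_abs)
    moreover have "0 \<le> real k + p" using that by simp
    ultimately show ?thesis using abs_powr_le[OF _ that(2), of \<xi>] unfolding abs_mult_powr by simp
  qed
  have int: "integrable lborel (\<lambda>\<xi>. N \<xi> *\<^sub>R (of_real (\<xi> ^ k) * complex_of_real (\<bar>\<xi>\<bar> powr p)))" if "0 \<le> p" "real k + p \<le> 4" for p k
    unfolding N_def by (rule integrable_normal_power4[OF d _ pb[OF that]]) measurable
  have h: "2 * (1 / 4) = (1 / 2 :: real)" "2 * (3 / 4) = (3 / 2 :: real)" by simp_all
  have "(frac_laplacian (1 / 4) (packet \<kappa> \<delta>) has_vector_derivative
     (\<integral>\<xi>. \<i> * of_real \<xi> * (N \<xi> *\<^sub>R of_real (\<bar>\<xi>\<bar> powr (1 / 2))) * cis (\<xi> * x) \<partial>lborel)) (at x)"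
    unfolding FL h
  proof (rule derivative_of_fourier_integral)
    show "integrable lborel (\<lambda>\<xi>. N \<xi> *\<^sub>R complex_of_real (\<bar>\<xi>\<bar> powr (1 / 2)))" using int[of "1 / 2" 0] by simp
    show "integrable lborel (\<lambda>\<xi>. of_real \<xi> * (N \<xi> *\<^sub>R complex_of_real (\<bar>\<xi>\<bar> powr (1 / 2))))" using int[of "1 / 2" 1] by (simp add: mult_ac)
    show "integrable lborel (\<lambda>\<xi>. of_real (\<xi>\<^sup>2) * (N \<xi> *\<^sub>R complex_of_real (\<bar>\<xi>\<bar> powr (1 / 2))))" using int[of "1 / 2" 2] by (simp add: mult_ac)
  qed
  then have nb: "nabla (frac_laplacian (1 / 4) (packet \<kappa> \<delta>)) x = (\<integral>\<xi>. \<i> * of_real \<xi> * (N \<xi> *\<^sub>R of_real (\<bar>\<xi>\<bar> powr (1 / 2))) * cis (\<xi> * x) \<partial>lborel)"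
    unfolding nabla_def by (rule vector_derivative_at)
  have i1: "integrable lborel (\<lambda>\<xi>. \<i> * of_real \<xi> * (N \<xi> *\<^sub>R of_real (\<bar>\<xi>\<bar> powr (1 / 2))) * cis (\<xi> * x))"
    using integrable_mult_cis[OF integrable_mult_right[OF int[of "1 / 2" 1], of \<i>], of x] by (simp add: mult_ac)
  have i2: "integrable lborel (\<lambda>\<xi>. (N \<xi> *\<^sub>R complex_of_real (\<bar>\<xi>\<bar> powr (3 / 2))) * cis (\<xi> * x))"
    using integrable_mult_cis[OF int[of "3 / 2" 0], of x] by (simp add: mult_ac)
  have "L_op (packet \<kappa> \<delta>) x = - of_real (1 / sqrt 2) * (\<integral>\<xi>. (N \<xi> *\<^sub>R of_real (\<bar>\<xi>\<bar> powr (3 / 2))) * cis (\<xi> * x)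
      - \<i> * of_real \<xi> * (N \<xi> *\<^sub>R of_real (\<bar>\<xi>\<bar> powr (1 / 2))) * cis (\<xi> * x) \<partial>lborel)"
    unfolding L_op_def nb unfolding FL h Bochner_Integration.integral_diff[OF i2 i1] ..
  also have "\<dots> = - (\<integral>\<xi>. of_real (1 / sqrt 2) * ((N \<xi> *\<^sub>R of_real (\<bar>\<xi>\<bar> powr (3 / 2))) * cis (\<xi> * x)
      - \<i> * of_real \<xi> * (N \<xi> *\<^sub>R of_real (\<bar>\<xi>\<bar> powr (1 / 2))) * cis (\<xi> * x)) \<partial>lborel)"
    by (simp del: of_real_divide)
  also have "\<dots> = - (\<integral>\<xi>. N \<xi> *\<^sub>R symb \<xi> * cis (\<xi> * x) \<partial>lborel)"
    unfolding symb_def by (intro arg_cong[where f=uminus] Bochner_Integration.integral_cong refl) (simp add: scaleR_conv_of_real algebra_simps)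
  finally show ?thesis by (simp add: N_def)
qed

text \<open>The mean deviation of the symbol over the frequency window of a packet. It bounds,
  uniformly in space, the failure of the packet to be an eigenfunction.\<close>

definition spread :: "real \<Rightarrow> real \<Rightarrow> real" where
  "spread \<kappa> \<delta> = (\<integral>\<xi>. normal_density \<kappa> \<delta> \<xi> * norm (symb \<xi> - symb \<kappa>) \<partial>lborel)"

lemma symb_measurable [measurable]: "symb \<in> borel_measurable borel"
  by (rule borel_measurable_continuous_onI[OF symb_continuous])

lemma symb_diff_le: "norm (symb \<xi> - symb \<kappa>) \<le> (2 + norm (symb \<kappa>)) * (1 + \<xi> ^ 4)"
proof -
  have "norm (symb \<xi> - symb \<kappa>) \<le> 2 * (1 + \<xi> ^ 4) + norm (symb \<kappa>) * 1"
    using norm_triangle_ineq4[of "symb \<xi>" "symb \<kappa>"] symb_le[of \<xi>] by simp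
  also have "\<dots> \<le> 2 * (1 + \<xi> ^ 4) + norm (symb \<kappa>) * (1 + \<xi> ^ 4)" by (intro add_left_mono mult_left_mono) auto
  finally show ?thesis by (simp add: algebra_simps)
qed

lemma L_op_packet_approx:
  assumes d: "\<delta> > 0"
  shows "norm (L_op (packet \<kappa> \<delta>) x + symb \<kappa> * packet \<kappa> \<delta> x) \<le> spread \<kappa> \<delta>"
proof -
  define N where "N = normal_density \<kappa> \<delta>"
  have i0: "integrable lborel (\<lambda>\<xi>. N \<xi> *\<^sub>R (1 :: complex))"
    unfolding N_def by (rule integrable_normal_power4[OF d, of _ 1]) auto
  have i1: "integrable lborel (\<lambda>\<xi>. N \<xi> *\<^sub>R symb \<xi>)"
    unfolding N_def by (rule integrable_normal_power4[OF d symb_measurable symb_le])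
  have c: "integrable lborel (\<lambda>\<xi>. g \<xi> * cis (\<xi> * x))" if "integrable lborel g" for g :: "real \<Rightarrow> complex"
    using integrable_mult_cis[OF that, of x] by (simp add: mult.commute)
  have "packet \<kappa> \<delta> x = 1 / (2 * of_real pi) * (\<integral>\<xi>. (2 * of_real pi) * ((N \<xi> *\<^sub>R 1) * cis (\<xi> * x)) \<partial>lborel)"
  proof -
    have "of_real (2 * pi * N \<xi>) * cis (\<xi> * x) = (2 * of_real pi) * ((N \<xi> *\<^sub>R 1) * cis (\<xi> * x))" for \<xi>
      by (simp add: scaleR_conv_of_real)
    then show ?thesis
      unfolding fourier_inversion[OF schwartz_packet[OF d, of \<kappa>], of x] fourier_packet[OF d] N_def[symmetric] by (simp only:)
  qed
  then have p: "packet \<kappa> \<delta> x = (\<integral>\<xi>. (N \<xi> *\<^sub>R 1) * cis (\<xi> * x) \<partial>lborel)" unfolding integral_two_pi_cancel .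
  have "L_op (packet \<kappa> \<delta>) x + symb \<kappa> * packet \<kappa> \<delta> x = (\<integral>\<xi>. symb \<kappa> * ((N \<xi> *\<^sub>R 1) * cis (\<xi> * x)) - N \<xi> *\<^sub>R symb \<xi> * cis (\<xi> * x) \<partial>lborel)"
    unfolding L_op_packet[OF d] p N_def[symmetric]
    by (subst Bochner_Integration.integral_diff[OF integrable_mult_right[OF c[OF i0]] c[OF i1]])
       (simp only: integral_mult_right_zero add_uminus_conv_diff add.commute[of "- _"])
  then have "norm (L_op (packet \<kappa> \<delta>) x + symb \<kappa> * packet \<kappa> \<delta> x) \<le> (\<integral>\<xi>. norm (symb \<kappa> * ((N \<xi> *\<^sub>R 1) * cis (\<xi> * x)) - N \<xi> *\<^sub>R symb \<xi> * cis (\<xi> * x)) \<partial>lborel)"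
    by (simp only: integral_norm_bound)
  also have "\<dots> = spread \<kappa> \<delta>"
    unfolding spread_def
  proof (intro Bochner_Integration.integral_cong refl)
    fix \<xi>
    have "symb \<kappa> * ((N \<xi> *\<^sub>R 1) * cis (\<xi> * x)) - N \<xi> *\<^sub>R symb \<xi> * cis (\<xi> * x) = of_real (N \<xi>) * (symb \<kappa> - symb \<xi>) * cis (\<xi> * x)"
      by (simp add: scaleR_conv_of_real algebra_simps)
    then show "norm (symb \<kappa> * ((N \<xi> *\<^sub>R 1) * cis (\<xi> * x)) - N \<xi> *\<^sub>R symb \<xi> * cis (\<xi> * x)) = normal_density \<kappa> \<delta> \<xi> * norm (symb \<xi> - symb \<kappa>)"
      by (simp add: norm_mult N_def norm_minus_commute)
  qed
  finally show ?thesis .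
qed

text \<open>Substituting \<open>\<xi> = \<kappa> + e n * z\<close> fixes the Gaussian and moves the
  window into the symbol, which is continuous. As \<open>e n\<close> is at most 1, one polynomial
  majorant serves all \<open>n\<close>.\<close>

lemma spread_LIMSEQ: "(\<lambda>n. spread \<kappa> (inverse (real (Suc n)))) \<longlonglongrightarrow> 0"
proof -
  define e where "e n = inverse (real (Suc n))" for n
  have e: "e n > 0" "e n \<le> 1" for n by (auto simp: e_def inverse_le_1_iff)
  have e0: "e \<longlonglongrightarrow> 0" unfolding e_def[abs_def] by (rule LIMSEQ_inverse_real_of_nat)
  define A where "A = 2 + norm (symb \<kappa>)"
  have A: "A \<ge> 0" by (simp add: A_def)
  have sp: "spread \<kappa> (e n) = (\<integral>z. std_normal_density z * norm (symb (\<kappa> + e n * z) - symb \<kappa>) \<partial>lborel)" for n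
  proof -
    have "spread \<kappa> (e n) = (\<integral>z. e n * (normal_density \<kappa> (e n) (\<kappa> + e n * z) * norm (symb (\<kappa> + e n * z) - symb \<kappa>)) \<partial>lborel)"
      unfolding spread_def using lborel_integral_real_affine[of "e n" "\<lambda>\<xi>. normal_density \<kappa> (e n) \<xi> * norm (symb \<xi> - symb \<kappa>)" \<kappa>] e(1)[of n] by simp
    then show ?thesis unfolding mult.assoc[symmetric] normal_density_affine[OF e(1)] .
  qed
  have "(\<lambda>n. \<integral>z. std_normal_density z * norm (symb (\<kappa> + e n * z) - symb \<kappa>) \<partial>lborel) \<longlonglongrightarrow> integral\<^sup>L lborel (\<lambda>z::real. 0 :: real)"
  proof (rule integral_dominated_convergence[where w="\<lambda>z. std_normal_density z *\<^sub>R (A * (1 + 8 * \<kappa> ^ 4 + 8 * z ^ 4))"])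
    show "integrable lborel (\<lambda>z. std_normal_density z *\<^sub>R (A * (1 + 8 * \<kappa> ^ 4 + 8 * z ^ 4)))"
    proof (rule integrable_normal_power4[where A="A * (8 + 8 * \<kappa> ^ 4)"])
      fix z :: real
      have "1 + 8 * \<kappa> ^ 4 + 8 * z ^ 4 \<le> (8 + 8 * \<kappa> ^ 4) * (1 + z ^ 4)" by (simp add: algebra_simps)
      from mult_left_mono[OF this A] show "norm (A * (1 + 8 * \<kappa> ^ 4 + 8 * z ^ 4)) \<le> A * (8 + 8 * \<kappa> ^ 4) * (1 + z ^ 4)"
        using A by (simp add: abs_mult mult.assoc)
    qed auto
    show "AE z in lborel. (\<lambda>n. std_normal_density z * norm (symb (\<kappa> + e n * z) - symb \<kappa>)) \<longlonglongrightarrow> 0"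
    proof (rule AE_I2)
      fix z
      have l: "(\<lambda>n. \<kappa> + e n * z) \<longlonglongrightarrow> \<kappa>" using tendsto_add[OF tendsto_const tendsto_mult[OF e0 tendsto_const]] by fastforce
      have "isCont symb \<kappa>" using symb_continuous by (simp add: continuous_on_eq_continuous_at)
      from isCont_tendsto_compose[OF this l]
      have "(\<lambda>n. std_normal_density z * norm (symb (\<kappa> + e n * z) - symb \<kappa>)) \<longlonglongrightarrow> std_normal_density z * norm (symb \<kappa> - symb \<kappa>)"
        by (intro tendsto_intros)
      then show "(\<lambda>n. std_normal_density z * norm (symb (\<kappa> + e n * z) - symb \<kappa>)) \<longlonglongrightarrow> 0" by simp
    qed
    show "AE z in lborel. norm (std_normal_density z * norm (symb (\<kappa> + e n * z) - symb \<kappa>)) \<le> std_normal_density z *\<^sub>R (A * (1 + 8 * \<kappa> ^ 4 + 8 * z ^ 4))" for n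
    proof (rule AE_I2)
      fix z
      have "(e n * z) ^ 4 \<le> z ^ 4"
        unfolding power_mult_distrib using e[of n] by (intro mult_left_le_one_le power_le_one) auto
      then have "8 * (\<kappa> ^ 4 + (e n * z) ^ 4) \<le> 8 * (\<kappa> ^ 4 + z ^ 4)" by (intro mult_left_mono add_left_mono) auto
      with power4_add_le[of \<kappa> "e n * z"] have "(\<kappa> + e n * z) ^ 4 \<le> 8 * (\<kappa> ^ 4 + z ^ 4)" by (rule order_trans)
      then have "(\<kappa> + e n * z) ^ 4 \<le> 8 * \<kappa> ^ 4 + 8 * z ^ 4" by (simp only: distrib_left)
      then have "A * (1 + (\<kappa> + e n * z) ^ 4) \<le> A * (1 + 8 * \<kappa> ^ 4 + 8 * z ^ 4)" using A by (intro mult_left_mono) auto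
      then have "norm (symb (\<kappa> + e n * z) - symb \<kappa>) \<le> A * (1 + 8 * \<kappa> ^ 4 + 8 * z ^ 4)"
        using symb_diff_le[of "\<kappa> + e n * z" \<kappa>] unfolding A_def by linarith
      then show "norm (std_normal_density z * norm (symb (\<kappa> + e n * z) - symb \<kappa>)) \<le> std_normal_density z *\<^sub>R (A * (1 + 8 * \<kappa> ^ 4 + 8 * z ^ 4))"
        by (simp add: mult_left_mono)
    qed
  qed measurable
  then have "(\<lambda>n. spread \<kappa> (e n)) \<longlonglongrightarrow> 0" unfolding sp by simp
  then show ?thesis by (simp add: e_def)
qed

section \<open>The semigroup on wave packets\<close>

context
  fixes P :: "real \<Rightarrow> real \<Rightarrow> real"
  assumes P: "transition_density_generated_by P L_op"
begin

lemma
  assumes "t > 0"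
  shows P_measurable: "P t \<in> borel_measurable borel" and P_nonneg: "P t x \<ge> 0"
    and P_integrable: "integrable lborel (P t)" and P_total: "(\<integral>x. P t x \<partial>lborel) = 1"
  using P assms unfolding transition_density_generated_by_def by auto

lemma P_shift:
  assumes t: "t > 0"
  shows "integrable lborel (\<lambda>u. P t (u - v))" "(\<integral>u. P t (u - v) \<partial>lborel) = 1"
  using lborel_integrable_real_affine[OF P_integrable[OF t], of 1 "- v"] lborel_integral_real_affine[of 1 "P t" "- v"] P_total[OF t]
  by (simp_all add: add.commute)

lemma kernel_op_integrable:
  assumes t: "t > 0" and f: "f \<in> borel_measurable borel" "\<And>u. norm (f u) \<le> B"
  shows "integrable lborel (\<lambda>u. f u * complex_of_real (P t (u - v)))"
proof (rule Bochner_Integration.integrable_bound[where f="\<lambda>u. B * P t (u - v)"])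
  note [measurable] = P_measurable[OF t] f(1)
  show "(\<lambda>u. f u * complex_of_real (P t (u - v))) \<in> borel_measurable lborel" by measurable
  show "AE u in lborel. norm (f u * complex_of_real (P t (u - v))) \<le> norm (B * P t (u - v))"
    using f(2) P_nonneg[OF t]
    by (intro AE_I2) (auto simp: norm_mult abs_mult intro!: mult_right_mono abs_ge_self[THEN order_trans[rotated]])
qed (use P_shift[OF t] in simp)

lemma kernel_op_norm_le:
  assumes t: "t > 0" and f: "f \<in> borel_measurable borel" "\<And>u. norm (f u) \<le> B"
  shows "norm (kernel_op (P t) f v) \<le> B"
proof -
  have "norm (kernel_op (P t) f v) \<le> (\<integral>u. norm (f u * complex_of_real (P t (u - v))) \<partial>lborel)"
    unfolding kernel_op_def by (rule integral_norm_bound)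
  also have "\<dots> \<le> (\<integral>u. B * P t (u - v) \<partial>lborel)"
  proof (rule integral_mono)
    show "integrable lborel (\<lambda>u. norm (f u * complex_of_real (P t (u - v))))"
      by (rule integrable_norm[OF kernel_op_integrable[OF t f]])
    show "norm (f u * complex_of_real (P t (u - v))) \<le> B * P t (u - v)" for u
      using f(2) P_nonneg[OF t] by (simp add: norm_mult mult_right_mono)
  qed (use P_shift[OF t] in simp)
  also have "\<dots> = B" using P_shift[OF t] by simp
  finally show ?thesis .
qed

lemma kernel_op_measurable:
  assumes t: "t > 0" and [measurable]: "f \<in> borel_measurable borel"
  shows "kernel_op (P t) f \<in> borel_measurable borel"
  unfolding kernel_op_def[abs_def] using P_measurable[OF t] by measurable

text \<open>Only the derivative at \<open>0\<close> of the semigroup is given.  Time is cut into \<open>N\<close> pieces, and the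
  errors add up because each \<open>kernel_op (P s)\<close> is a contraction.\<close>

lemma kernel_op_packet:
  assumes t: "t > 0" and d: "\<delta> > 0"
  shows "norm (kernel_op (P t) (packet \<kappa> \<delta>) v - exp (- of_real t * symb \<kappa>) * packet \<kappa> \<delta> v) \<le> t * spread \<kappa> \<delta>"
proof (rule field_le_epsilon)
  fix \<epsilon> :: real assume eps: "\<epsilon> > 0"
  define f where "f = packet \<kappa> \<delta>"
  define \<psi> where "\<psi> = symb \<kappa>"
  \<comment> \<open>Two errors of size \<open>e\<close> per unit of time accumulate over time
    \<open>t\<close>, for a total of \<open>\<epsilon>\<close>.\<close>
  define e where "e = \<epsilon> / (2 * t)"
  have e: "e > 0" using eps t by (simp add: e_def)
  have fS: "schwartz f" unfolding f_def by (rule schwartz_packet[OF d])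
  have fm: "f \<in> borel_measurable borel" unfolding f_def by simp
  have fb: "norm (f u) \<le> 1" for u unfolding f_def by (rule norm_packet_le)
  have ul: "uniform_limit UNIV (\<lambda>t v. (kernel_op (P t) f v - f v) / complex_of_real t) (L_op f) (at_right 0)"
    using P fS unfolding transition_density_generated_by_def by blast
  have semi: "kernel_op (P (s + s')) f = kernel_op (P s) (kernel_op (P s') f)" if "s > 0" "s' > 0" for s s'
    using P fS that unfolding transition_density_generated_by_def by blast
  have ex: "((\<lambda>h. (exp (- of_real h * \<psi>) - 1) / of_real h) \<longlongrightarrow> - \<psi>) (at_right (0::real))"
  proof -
    have "((\<lambda>z. exp (- z * \<psi>)) has_field_derivative - \<psi>) (at 0)" by (auto intro!: derivative_eq_intros)
    then have "((\<lambda>z. (exp (- z * \<psi>) - 1) / z) \<longlongrightarrow> - \<psi>) (at 0)" by (simp add: has_field_derivative_iff)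
    moreover have "filterlim complex_of_real (at 0) (at_right 0)"
      by (rule filterlim_atI) (auto intro!: tendsto_eq_intros simp: eventually_at_filter)
    ultimately show ?thesis by (rule filterlim_compose)
  qed
  have "\<forall>\<^sub>F h in at_right 0. (\<forall>v\<in>UNIV. dist ((kernel_op (P h) f v - f v) / complex_of_real h) (L_op f v) < e) \<and> dist ((exp (- of_real h * \<psi>) - 1) / of_real h) (- \<psi>) < e"
    using uniform_limitD[OF ul e] tendstoD[OF ex e] by eventually_elim simp
  then obtain h0 where h0: "h0 > 0" "\<And>h v. h > 0 \<Longrightarrow> h < h0 \<Longrightarrow> dist ((kernel_op (P h) f v - f v) / complex_of_real h) (L_op f v) < e"
    "\<And>h. h > 0 \<Longrightarrow> h < h0 \<Longrightarrow> dist ((exp (- of_real h * \<psi>) - 1) / of_real h) (- \<psi>) < e"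
    unfolding eventually_at_right_field by auto
  obtain N :: nat where N: "t / h0 < real N" using reals_Archimedean2 by blast
  then have N0: "N > 0" using t h0 by (metis divide_pos_pos gr0I less_asym of_nat_0)
  define h where "h = t / real N"
  have h: "h > 0" "h < h0" using N N0 t h0(1) by (auto simp: h_def field_simps)
  define E where "E = exp (- of_real h * \<psi>)"
  have E1: "norm E \<le> 1" using h Re_symb[of \<kappa>] by (simp add: E_def norm_exp_eq_Re \<psi>_def)
  \<comment> \<open>The error of one step: \<open>e\<close> from the difference quotient of the
    semigroup, \<open>e\<close> from that of the exponential, and \<open>spread\<close> from the
    packet not being an eigenfunction.\<close>
  define B where "B = h * (2 * e + spread \<kappa> \<delta>)"
  have one: "norm (kernel_op (P h) f v - E * f v) \<le> B" for v
  proof -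
    have 1: "norm ((kernel_op (P h) f v - f v) / of_real h - L_op f v) \<le> e" using h0(2)[OF h, of v] by (simp add: dist_norm)
    have 2: "norm (L_op f v + \<psi> * f v) \<le> spread \<kappa> \<delta>" unfolding f_def \<psi>_def by (rule L_op_packet_approx[OF d])
    have 3: "norm (((E - 1) / of_real h + \<psi>) * f v) \<le> e * 1"
      unfolding norm_mult using h0(3)[OF h] fb[of v] e by (intro mult_mono) (auto simp: dist_norm E_def)
    have "norm (((kernel_op (P h) f v - f v) / of_real h - L_op f v) + (L_op f v + \<psi> * f v) - ((E - 1) / of_real h + \<psi>) * f v) \<le> (e + spread \<kappa> \<delta>) + e"
    proof -
      have "norm (a + b - c) \<le> norm a + norm b + norm c" for a b c :: complex
        using norm_triangle_ineq4[of "a + b" c] norm_triangle_ineq[of a b] by linarith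
      from order_trans[OF this] show ?thesis using 1 2 3 by (smt (verit))
    qed
    moreover have "((kernel_op (P h) f v - f v) / of_real h - L_op f v) + (L_op f v + \<psi> * f v) - ((E - 1) / of_real h + \<psi>) * f v
      = (kernel_op (P h) f v - E * f v) / of_real h"
      using h by (simp add: field_simps)
    ultimately have "norm (kernel_op (P h) f v - E * f v) / h \<le> 2 * e + spread \<kappa> \<delta>" using h by (simp add: norm_divide)
    then show ?thesis using h by (simp add: B_def pos_divide_le_eq mult.commute)
  qed
  have B: "B \<ge> 0" using order_trans[OF norm_ge_zero one] .
  have iter: "norm (kernel_op (P (real (Suc j) * h)) f v - E ^ Suc j * f v) \<le> real (Suc j) * B" for j v
  proof (induction j arbitrary: v)
    case 0
    then show ?case using one[of v] by simp
  next
    case (Suc j)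
    have s: "real (Suc j) * h > 0" using h by simp
    define r where "r u = kernel_op (P h) f u - E * f u" for u
    have rm: "r \<in> borel_measurable borel"
      unfolding r_def[abs_def] using kernel_op_measurable[OF h(1) fm] fm by measurable
    \<comment> \<open>The new step is applied first, to the packet itself, so the one-step estimate
      is always used for the same Schwartz function. Its remainder is then only transported by a
      contraction.\<close>
    have "real (Suc (Suc j)) * h = real (Suc j) * h + h" by (simp add: algebra_simps)
    then have "kernel_op (P (real (Suc (Suc j)) * h)) f v = kernel_op (P (real (Suc j) * h)) (kernel_op (P h) f) v"
      using semi[OF s h(1)] by simp
    also have "kernel_op (P h) f = (\<lambda>u. E * f u + r u)" by (auto simp: r_def)
    also have "kernel_op (P (real (Suc j) * h)) (\<lambda>u. E * f u + r u) v
       = E * kernel_op (P (real (Suc j) * h)) f v + kernel_op (P (real (Suc j) * h)) r v"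
    proof -
      have i1: "integrable lborel (\<lambda>u. f u * complex_of_real (P (real (Suc j) * h) (u - v)))"
        by (rule kernel_op_integrable[OF s fm fb])
      have i2: "integrable lborel (\<lambda>u. r u * complex_of_real (P (real (Suc j) * h) (u - v)))"
        by (rule kernel_op_integrable[OF s rm, of B]) (simp add: r_def one)
      show ?thesis unfolding kernel_op_def distrib_right mult.assoc
        by (subst Bochner_Integration.integral_add[OF integrable_mult_right[OF i1] i2]) simp
    qed
    finally have "kernel_op (P (real (Suc (Suc j)) * h)) f v - E ^ Suc (Suc j) * f v
       = E * (kernel_op (P (real (Suc j) * h)) f v - E ^ Suc j * f v) + kernel_op (P (real (Suc j) * h)) r v"
      by (simp add: algebra_simps)
    also have "norm \<dots> \<le> norm E * norm (kernel_op (P (real (Suc j) * h)) f v - E ^ Suc j * f v) + norm (kernel_op (P (real (Suc j) * h)) r v)"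
      by (rule order_trans[OF norm_triangle_ineq]) (simp only: norm_mult)
    also have "\<dots> \<le> 1 * (real (Suc j) * B) + B"
      by (intro add_mono mult_mono E1 Suc kernel_op_norm_le[OF s rm]) (use B one in \<open>auto simp: r_def\<close>)
    finally show ?case by (simp add: algebra_simps)
  qed
  obtain j where j: "N = Suc j" using N0 gr0_implies_Suc by blast
  have Nh: "real N * h = t" using N0 by (simp add: h_def)
  have "E ^ N = exp (- of_real t * \<psi>)"
    unfolding E_def Nh[symmetric] by (simp flip: exp_of_nat_mult add: mult_ac)
  moreover have "real N * B = t * (2 * e + spread \<kappa> \<delta>)" unfolding B_def mult.assoc[symmetric] Nh ..
  ultimately have "norm (kernel_op (P t) f v - exp (- of_real t * \<psi>) * f v) \<le> t * (2 * e + spread \<kappa> \<delta>)"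
    using iter[of j v] unfolding j[symmetric] Nh by simp
  also have "\<dots> = t * spread \<kappa> \<delta> + \<epsilon>" using t by (simp add: e_def field_simps)
  finally show "norm (kernel_op (P t) (packet \<kappa> \<delta>) v - exp (- of_real t * symb \<kappa>) * packet \<kappa> \<delta> v) \<le> t * spread \<kappa> \<delta> + \<epsilon>"
    by (simp add: f_def \<psi>_def)
qed

text \<open>At the origin every packet equals 1. Letting its frequency window shrink turns the
  packet into a plane wave, with \<open>P t\<close> itself as majorant, while the error
  \<open>t * spread\<close> vanishes.\<close>

theorem char_transition_density:
  assumes t: "t > 0"
  shows "(\<integral>x. complex_of_real (P t x) * cis (\<kappa> * x) \<partial>lborel) = exp (- of_real t * symb \<kappa>)"
proof -
  define e where "e n = inverse (real (Suc n))" for n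
  have e: "e n > 0" for n by (simp add: e_def)
  have e0: "e \<longlonglongrightarrow> 0" unfolding e_def[abs_def] by (rule LIMSEQ_inverse_real_of_nat)
  note [measurable] = P_measurable[OF t]
  have "(\<lambda>n. \<integral>u. packet \<kappa> (e n) u * of_real (P t (u - 0)) \<partial>lborel) \<longlonglongrightarrow> (\<integral>u. complex_of_real (P t u) * cis (\<kappa> * u) \<partial>lborel)"
  proof (rule integral_dominated_convergence[where w="P t"])
    show "AE u in lborel. (\<lambda>n. packet \<kappa> (e n) u * of_real (P t (u - 0))) \<longlonglongrightarrow> of_real (P t u) * cis (\<kappa> * u)"
    proof (rule AE_I2)
      fix u
      have "(\<lambda>n. of_real (exp (- (e n * u)\<^sup>2 / 2)) * cis (\<kappa> * u) * of_real (P t (u - 0))) \<longlonglongrightarrow> of_real (exp (- (0 * u)\<^sup>2 / 2)) * cis (\<kappa> * u) * of_real (P t (u - 0))"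
        by (intro tendsto_intros e0) auto
      then show "(\<lambda>n. packet \<kappa> (e n) u * of_real (P t (u - 0))) \<longlonglongrightarrow> of_real (P t u) * cis (\<kappa> * u)"
        by (simp add: packet_def mult.commute)
    qed
    show "AE u in lborel. norm (packet \<kappa> (e n) u * of_real (P t (u - 0))) \<le> P t u" for n
      using P_nonneg[OF t] by (intro AE_I2) (simp add: norm_mult mult_left_le_one_le norm_packet_le)
  qed (use P_integrable[OF t] in measurable)
  then have 1: "(\<lambda>n. kernel_op (P t) (packet \<kappa> (e n)) 0) \<longlonglongrightarrow> (\<integral>u. complex_of_real (P t u) * cis (\<kappa> * u) \<partial>lborel)"
    by (simp add: kernel_op_def)
  have "(\<lambda>n. kernel_op (P t) (packet \<kappa> (e n)) 0 - exp (- of_real t * symb \<kappa>)) \<longlonglongrightarrow> 0"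
  proof (rule Lim_null_comparison)
    show "\<forall>\<^sub>F n in sequentially. norm (kernel_op (P t) (packet \<kappa> (e n)) 0 - exp (- of_real t * symb \<kappa>)) \<le> t * spread \<kappa> (e n)"
      using kernel_op_packet[OF t e, of \<kappa> _ 0] by (simp add: packet_def)
    show "(\<lambda>n. t * spread \<kappa> (e n)) \<longlonglongrightarrow> 0"
      using tendsto_mult[OF tendsto_const[of t] spread_LIMSEQ[of \<kappa>]] by (simp add: e_def)
  qed
  from tendsto_add[OF this tendsto_const[of "exp (- of_real t * symb \<kappa>)"]]
  have "(\<lambda>n. kernel_op (P t) (packet \<kappa> (e n)) 0) \<longlonglongrightarrow> exp (- of_real t * symb \<kappa>)" by simp
  from LIMSEQ_unique[OF 1 this] show ?thesis .
qed

end

section \<open>The scaling limit\<close>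

lemma filterlim_int_intervals:
  "filterlim (\<lambda>N. {- int N..int N}) (finite_subsets_at_top UNIV) sequentially"
  unfolding filterlim_finite_subsets_at_top
proof (intro allI impI)
  fix Y :: "int set" assume "finite Y \<and> Y \<subseteq> UNIV"
  then have Y: "finite Y" by simp
  define m where "m = nat (Max (insert 0 (abs ` Y)))"
  have "Y \<subseteq> {- int N..int N}" if "N \<ge> m" for N
  proof
    fix y assume "y \<in> Y"
    then have "\<bar>y\<bar> \<le> Max (insert 0 (abs ` Y))" using Y by (intro Max_ge) auto
    then show "y \<in> {- int N..int N}" using that by (auto simp: m_def abs_le_iff)
  qed
  then show "\<forall>\<^sub>F N in sequentially. finite {- int N..int N} \<and> Y \<subseteq> {- int N..int N} \<and> {- int N..int N} \<subseteq> UNIV"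
    unfolding eventually_sequentially by auto
qed

lemma infsum_int_LIMSEQ:
  fixes g :: "int \<Rightarrow> complex"
  assumes "(\<lambda>y. norm (g y)) summable_on UNIV"
  shows "(\<lambda>N. \<Sum>y\<in>{- int N..int N}. g y) \<longlonglongrightarrow> infsum g UNIV"
proof -
  have "(g has_sum infsum g UNIV) UNIV" by (rule has_sum_infsum[OF abs_summable_summable[OF assms]])
  then show ?thesis unfolding has_sum_def by (rule filterlim_compose[OF _ filterlim_int_intervals])
qed

lemma infsum_diff_real_normed:
  fixes f g :: "'a \<Rightarrow> 'b::real_normed_vector"
  assumes "f summable_on A" "g summable_on A"
  shows "infsum (\<lambda>x. f x - g x) A = infsum f A - infsum g A"
proof -
  have "(\<lambda>x. - g x) summable_on A" using assms(2) by (simp add: summable_on_uminus)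
  from infsum_add[OF assms(1) this] show ?thesis by (simp add: infsum_uminus)
qed

text \<open>A Riemann sum of mesh one; the translation by \<open>x\<close> is a bijection of the
  integers.\<close>

lemma summable_exp_abs: "(\<lambda>y::int. exp (- 2 * of_int \<bar>x - y\<bar>) :: real) summable_on UNIV"
proof -
  define F where "F z = complex_of_real (exp (- 2 * \<bar>z\<bar>))" for z
  have "(\<lambda>i::int. norm (F (of_int i / real 1))) summable_on UNIV"
  proof (rule Riemann_sum_eq_integral(1))
    show "continuous_on UNIV F" unfolding F_def[abs_def] by (intro continuous_intros)
    show "norm (F z) \<le> 1 / (1 + z\<^sup>2)" for z
    proof -
      have "1 + 2 * \<bar>z\<bar> + (2 * \<bar>z\<bar>)\<^sup>2 / 2 \<le> exp (2 * \<bar>z\<bar>)" by (rule exp_lower_Taylor_quadratic) simp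
      then have "1 + 2 * \<bar>z\<bar> + 2 * z\<^sup>2 \<le> exp (2 * \<bar>z\<bar>)" by (simp add: power_mult_distrib)
      then have "1 + z\<^sup>2 \<le> exp (2 * \<bar>z\<bar>)" using zero_le_power2[of z] abs_ge_zero[of z] by linarith
      moreover have "0 < 1 + z\<^sup>2" by (simp add: add_pos_nonneg)
      ultimately have "1 / exp (2 * \<bar>z\<bar>) \<le> 1 / (1 + z\<^sup>2)" by (intro divide_left_mono) auto
      then show ?thesis unfolding F_def norm_of_real by (simp add: exp_minus divide_inverse)
    qed
  qed simp
  then have "(\<lambda>i::int. exp (- 2 * of_int \<bar>i\<bar>) :: real) summable_on UNIV" by (simp add: F_def)
  moreover have "bij_betw (\<lambda>y. x - y) UNIV (UNIV :: int set)" by (rule bij_betwI[where g="\<lambda>y. x - y"]) auto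
  ultimately show ?thesis using summable_on_reindex_bij_betw[of "\<lambda>y. x - y" UNIV UNIV "\<lambda>i. exp (- 2 * of_int \<bar>i\<bar>) :: real"] by simp
qed

text \<open>The reflection matches two conventions: the lattice side transports plane waves in the
  position of \<open>h\<close>, while \<open>P t\<close> is evaluated at \<open>u - v\<close>, so
  this frequency enters its characteristic function with the opposite sign.\<close>

lemma limit_symbol_symb: "limit_symbol k = symb (- k)"
  unfolding limit_symbol_eq symb_def by simp

lemma fourier_inversion_sum:
  assumes "schwartz h" "finite Y"
  shows "(\<Sum>y\<in>Y. h (s y) * a y) = 1 / (2 * of_real pi) * (\<integral>k. fourier h k * (\<Sum>y\<in>Y. cis (k * s y) * a y) \<partial>lborel)"
proof -
  have i: "integrable lborel (\<lambda>k. fourier h k * cis (k * s y) * a y)" for y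
    using integrable_mult_cis[OF fourier_integrable[OF assms(1)], of "s y"] by (simp add: mult.commute)
  have "(\<integral>k. fourier h k * (\<Sum>y\<in>Y. cis (k * s y) * a y) \<partial>lborel) = (\<integral>k. (\<Sum>y\<in>Y. fourier h k * cis (k * s y) * a y) \<partial>lborel)"
    by (simp add: sum_distrib_left mult.assoc)
  also have "\<dots> = (\<Sum>y\<in>Y. \<integral>k. fourier h k * cis (k * s y) * a y \<partial>lborel)"
    by (rule Bochner_Integration.integral_sum) (rule i)
  finally have e: "(\<integral>k. fourier h k * (\<Sum>y\<in>Y. cis (k * s y) * a y) \<partial>lborel) = (\<Sum>y\<in>Y. (\<integral>k. fourier h k * cis (k * s y) \<partial>lborel) * a y)"
    by simp
  show ?thesis unfolding e unfolding sum_distrib_left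
    by (rule sum.cong[OF refl]) (subst fourier_inversion[OF assms(1)], simp)
qed

lemma schwartz_bounded:
  assumes "schwartz h"
  shows "\<exists>H. \<forall>x. norm (h x) \<le> H"
proof -
  have "bounded (range (\<lambda>x. complex_of_real (x ^ 0) * (nabla ^^ 0) h x))" using assms unfolding schwartz_def by blast
  then show ?thesis by (auto simp: bounded_iff)
qed

text \<open>The Fourier multiplier \<open>m\<close> applied to \<open>h\<close>. The lattice
  evolution and its limit are both of this form, so they can be compared through their
  multipliers.\<close>

definition propagated :: "(real \<Rightarrow> complex) \<Rightarrow> (real \<Rightarrow> complex) \<Rightarrow> real \<Rightarrow> complex" where
  "propagated h m v = 1 / (2 * of_real pi) * (\<integral>k. fourier h k * (cis (k * v) * m k) \<partial>lborel)"

context lattice_flow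
begin

lemma mode_sol_norm_le_1: "t \<ge> 0 \<Longrightarrow> norm (mode_sol \<gamma> \<theta> t 0) \<le> 1"
  using mode_sol_energy_le[OF gamma_nonneg, of t \<theta> 0] by (simp add: power2_le_imp_le[of _ 1])

lemma flow_wave_LIMSEQ:
  assumes t: "t \<ge> 0"
  shows "(\<lambda>N. \<Sum>z\<in>{- int N..int N}. cis (\<theta> * of_int z) * of_real (c z x x t)) \<longlonglongrightarrow> cis (\<theta> * of_int x) * mode_sol \<gamma> \<theta> t 0"
proof -
  have "(\<lambda>N. (\<Sum>z\<in>{- int N..int N}. cis (\<theta> * of_int z) * of_real (c z x x t)) - cis (\<theta> * of_int x) * mode_sol \<gamma> \<theta> t 0) \<longlonglongrightarrow> 0"
  proof (rule Lim_null_comparison)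
    show "\<forall>\<^sub>F N in sequentially. norm ((\<Sum>z\<in>{- int N..int N}. cis (\<theta> * of_int z) * of_real (c z x x t)) - cis (\<theta> * of_int x) * mode_sol \<gamma> \<theta> t 0)
      \<le> exp (- 2 * real N) * exp (2 * of_int \<bar>x\<bar>) * exp ((52 + 4 * \<gamma>) * t)"
      using flow_wave_sum[OF t] by simp
    have "(\<lambda>N. exp (- 2 * real N)) \<longlonglongrightarrow> 0" by real_asymp
    from tendsto_mult_right[OF tendsto_mult_right[OF this, of "exp (2 * of_int \<bar>x\<bar>)"], of "exp ((52 + 4 * \<gamma>) * t)"]
    show "(\<lambda>N. exp (- 2 * real N) * exp (2 * of_int \<bar>x\<bar>) * exp ((52 + 4 * \<gamma>) * t)) \<longlonglongrightarrow> 0" by simp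
  qed
  from tendsto_add[OF this tendsto_const[of "cis (\<theta> * of_int x) * mode_sol \<gamma> \<theta> t 0"]] show ?thesis by simp
qed

text \<open>Measurability in the momentum is read off the flow: by \<open>flow_wave_LIMSEQ\<close>
  at the origin the mode is a pointwise limit of trigonometric sums.\<close>

lemma mode_sol_measurable:
  assumes t: "t \<ge> 0"
  shows "(\<lambda>k. mode_sol \<gamma> (k / r) t 0) \<in> borel_measurable borel"
proof (rule borel_measurable_LIMSEQ_metric)
  show "(\<lambda>k. \<Sum>z\<in>{- int N..int N}. cis (k / r * of_int z) * of_real (c z 0 0 t)) \<in> borel_measurable borel" for N
    by measurable
  show "(\<lambda>N. \<Sum>z\<in>{- int N..int N}. cis (k / r * of_int z) * of_real (c z 0 0 t)) \<longlonglongrightarrow> mode_sol \<gamma> (k / r) t 0" for k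
    using flow_wave_LIMSEQ[OF t, of "k / r" 0] by simp
qed

text \<open>Fourier inversion of \<open>h\<close> turns partial sums over \<open>y\<close> into
  integrals of plane-wave sums, which converge for each \<open>k\<close>. For fixed \<open>x\<close>
  the bound of \<open>flow_wave_sum\<close> is uniform in \<open>N\<close> and \<open>k\<close>, so
  the limit passes under the integral.\<close>

lemma flow_infsum:
  assumes t: "t \<ge> 0" and h: "schwartz h" and n: "n > 0"
  shows "(\<Sum>\<^sub>\<infinity>y. h (of_int y / real n) * of_real (c y x x t)) = propagated h (\<lambda>k. mode_sol \<gamma> (k / real n) t 0) (of_int x / real n)"
proof -
  define C where "C = exp ((52 + 4 * \<gamma>) * t)"
  obtain H where H: "\<And>x. norm (h x) \<le> H" using schwartz_bounded[OF h] by blast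
  have "(\<lambda>y. norm (h (of_int y / real n) * complex_of_real (c y x x t))) summable_on UNIV"
  proof (rule summable_on_comparison_test)
    show "(\<lambda>y. H * C * exp (- 2 * of_int \<bar>x - y\<bar>)) summable_on UNIV"
      by (rule summable_on_cmult_right[OF summable_exp_abs])
    show "norm (h (of_int y / real n) * complex_of_real (c y x x t)) \<le> H * C * exp (- 2 * of_int \<bar>x - y\<bar>)" for y
      using mult_mono[OF H[of "of_int y / real n"] flow_decay[OF t, of y x] order_trans[OF norm_ge_zero H] abs_ge_zero]
      by (simp add: norm_mult C_def mult_ac)
  qed auto
  from infsum_int_LIMSEQ[OF this]
  have 1: "(\<lambda>N. \<Sum>y\<in>{- int N..int N}. h (of_int y / real n) * of_real (c y x x t)) \<longlonglongrightarrow> (\<Sum>\<^sub>\<infinity>y. h (of_int y / real n) * of_real (c y x x t))" .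
  have [measurable]: "fourier h \<in> borel_measurable borel" using borel_measurable_integrable[OF fourier_integrable[OF h]] by simp
  note [measurable] = mode_sol_measurable[OF t]
  have "(\<lambda>N. \<integral>k. fourier h k * (\<Sum>y\<in>{- int N..int N}. cis (k * (of_int y / real n)) * of_real (c y x x t)) \<partial>lborel)
    \<longlonglongrightarrow> (\<integral>k. fourier h k * (cis (k * (of_int x / real n)) * mode_sol \<gamma> (k / real n) t 0) \<partial>lborel)"
  proof (rule integral_dominated_convergence[where w="\<lambda>k. norm (fourier h k) * (1 + exp (2 * of_int \<bar>x\<bar>) * C)"])
    show "integrable lborel (\<lambda>k. norm (fourier h k) * (1 + exp (2 * of_int \<bar>x\<bar>) * C))"
      using fourier_integrable[OF h] by (intro integrable_mult_left integrable_norm)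
    have ck: "k * (of_int y / real n) = k / real n * of_int y" for k y by simp
    show "AE k in lborel. (\<lambda>N. fourier h k * (\<Sum>y\<in>{- int N..int N}. cis (k * (of_int y / real n)) * of_real (c y x x t)))
       \<longlonglongrightarrow> fourier h k * (cis (k * (of_int x / real n)) * mode_sol \<gamma> (k / real n) t 0)"
      unfolding ck by (intro AE_I2 tendsto_mult_left flow_wave_LIMSEQ t)
    show "AE k in lborel. norm (fourier h k * (\<Sum>y\<in>{- int N..int N}. cis (k * (of_int y / real n)) * of_real (c y x x t)))
       \<le> norm (fourier h k) * (1 + exp (2 * of_int \<bar>x\<bar>) * C)" for N
      unfolding ck norm_mult[of "fourier h _"]
    proof (intro AE_I2 mult_left_mono norm_ge_zero)
      fix k
      let ?s = "\<Sum>y\<in>{- int N..int N}. cis (k / real n * of_int y) * of_real (c y x x t)"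
      let ?l = "cis (k / real n * of_int x) * mode_sol \<gamma> (k / real n) t 0"
      have "norm (?s - ?l) \<le> exp (- 2 * real N) * (exp (2 * of_int \<bar>x\<bar>) * C)"
        using flow_wave_sum[OF t, where N=N and x=x and \<theta>="k / real n"] by (simp add: C_def mult.assoc)
      also have "\<dots> \<le> 1 * (exp (2 * of_int \<bar>x\<bar>) * C)" by (intro mult_right_mono) (auto simp: C_def)
      finally have "norm (?s - ?l) \<le> exp (2 * of_int \<bar>x\<bar>) * C" by simp
      moreover have "norm ?l \<le> 1" using mode_sol_norm_le_1[OF t] by (simp add: norm_mult)
      moreover have "norm ?s \<le> norm (?s - ?l) + norm ?l" using norm_triangle_ineq[of "?s - ?l" ?l] by simp
      ultimately show "norm ?s \<le> 1 + exp (2 * of_int \<bar>x\<bar>) * C" by linarith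
    qed
  qed measurable
  from tendsto_mult_left[OF this, of "1 / (2 * of_real pi)"]
  have "(\<lambda>N. \<Sum>y\<in>{- int N..int N}. h (of_int y / real n) * of_real (c y x x t)) \<longlonglongrightarrow> propagated h (\<lambda>k. mode_sol \<gamma> (k / real n) t 0) (of_int x / real n)"
    unfolding propagated_def by (simp only: fourier_inversion_sum[OF h finite_atLeastAtMost_int])
  from LIMSEQ_unique[OF 1 this] show ?thesis .
qed

text \<open>The flow decays in the distance of the two sites and \<open>f\<close> is summable, hence
  the family of pairs is absolutely summable and \<open>y\<close> may be summed first.\<close>

lemma flow_double_sum:
  assumes t: "t \<ge> 0" and h: "schwartz h" and n: "n > 0"
    and f: "(\<lambda>x::int. norm (f x)) summable_on UNIV"
  shows "(\<Sum>\<^sub>\<infinity>(x, y)\<in>(UNIV :: (int \<times> int) set). f x * h (of_int y / real n) * of_real (c y x x t))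
     = (\<Sum>\<^sub>\<infinity>x. f x * propagated h (\<lambda>k. mode_sol \<gamma> (k / real n) t 0) (of_int x / real n))"
proof -
  define C where "C = exp ((52 + 4 * \<gamma>) * t)"
  obtain H where H: "\<And>x. norm (h x) \<le> H" using schwartz_bounded[OF h] by blast
  define S where "S = (\<Sum>\<^sub>\<infinity>y::int. exp (- 2 * of_int \<bar>y\<bar>) :: real)"
  define F where "F = (\<lambda>(x, y). f x * h (of_int y / real n) * complex_of_real (c y x x t))"
  have bd: "norm (F (x, y)) \<le> norm (f x) * (H * C) * exp (- 2 * of_int \<bar>x - y\<bar>)" for x y
  proof -
    have "norm (h (of_int y / real n)) * \<bar>c y x x t\<bar> \<le> H * (exp (- 2 * of_int \<bar>x - y\<bar>) * C)"
      unfolding C_def by (rule mult_mono[OF H flow_decay[OF t] order_trans[OF norm_ge_zero H] abs_ge_zero])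
    from mult_left_mono[OF this norm_ge_zero[of "f x"]] show ?thesis by (simp add: F_def norm_mult mult_ac)
  qed
  have s1: "(\<lambda>y. norm (F (x, y))) summable_on UNIV" for x
    by (rule summable_on_comparison_test[OF summable_on_cmult_right[OF summable_exp_abs]]) (use bd in auto)
  have S: "(\<Sum>\<^sub>\<infinity>y. exp (- 2 * of_int \<bar>x - y\<bar>) :: real) = S" for x :: int
  proof -
    have "bij_betw (\<lambda>y. x - y) UNIV (UNIV :: int set)" by (rule bij_betwI[where g="\<lambda>y. x - y"]) auto
    from infsum_reindex_bij_betw[OF this, of "\<lambda>i. exp (- 2 * of_int \<bar>i\<bar>) :: real"] show ?thesis by (simp add: S_def)
  qed
  have s2: "(\<Sum>\<^sub>\<infinity>y. norm (F (x, y))) \<le> norm (f x) * (H * C) * S" for x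
  proof -
    have "(\<Sum>\<^sub>\<infinity>y. norm (F (x, y))) \<le> (\<Sum>\<^sub>\<infinity>y. norm (f x) * (H * C) * exp (- 2 * of_int \<bar>x - y\<bar>))"
      by (rule infsum_mono[OF s1 summable_on_cmult_right[OF summable_exp_abs]]) (rule bd)
    also have "\<dots> = norm (f x) * (H * C) * S" unfolding S[of x, symmetric] by (rule infsum_cmult_right) (rule summable_exp_abs)
    finally show ?thesis .
  qed
  have "(\<lambda>x. norm (\<Sum>\<^sub>\<infinity>y. norm (F (x, y)))) summable_on UNIV"
  proof (rule summable_on_comparison_test)
    show "(\<lambda>x. norm (f x) * (H * C * S)) summable_on UNIV" by (rule summable_on_cmult_left[OF f])
    show "norm (\<Sum>\<^sub>\<infinity>y. norm (F (x, y))) \<le> norm (f x) * (H * C * S)" for x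
      using s2[of x] infsum_nonneg[of UNIV "\<lambda>y. norm (F (x, y))"] by (simp add: mult.assoc)
  qed auto
  then have "(\<lambda>p. norm (F p)) summable_on Sigma UNIV (\<lambda>_. UNIV)"
    using s1 by (subst Infinite_Sum.abs_summable_on_Sigma_iff) auto
  then have "F summable_on Sigma UNIV (\<lambda>_. UNIV)" by (rule abs_summable_summable)
  from infsum_Sigma'_banach[OF this[unfolded F_def]]
  have "(\<Sum>\<^sub>\<infinity>(x, y)\<in>Sigma UNIV (\<lambda>_. UNIV). f x * h (of_int y / real n) * of_real (c y x x t))
     = (\<Sum>\<^sub>\<infinity>x. \<Sum>\<^sub>\<infinity>y. f x * h (of_int y / real n) * of_real (c y x x t))" by simp
  also have "\<dots> = (\<Sum>\<^sub>\<infinity>x. f x * propagated h (\<lambda>k. mode_sol \<gamma> (k / real n) t 0) (of_int x / real n))"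
    unfolding mult.assoc flow_infsum[OF t h n, symmetric] by (intro infsum_cong infsum_cmult_right')
  finally show ?thesis by simp
qed

end

text \<open>The bound does not depend on \<open>v\<close>, so convergence of the multipliers in mean
  becomes uniform convergence in space. The prefactor \<open>1 / (2 * pi)\<close> is estimated by
  1.\<close>

lemma propagated_diff_le:
  assumes h: "schwartz h" and m: "m \<in> borel_measurable borel" "m' \<in> borel_measurable borel"
    and b: "\<And>k. norm (m k) \<le> 1" "\<And>k. norm (m' k) \<le> 1"
  shows "norm (propagated h m v - propagated h m' v) \<le> (\<integral>k. norm (fourier h k) * norm (m k - m' k) \<partial>lborel)"
proof -
  note [measurable] = m
  have [measurable]: "fourier h \<in> borel_measurable borel" using borel_measurable_integrable[OF fourier_integrable[OF h]] by simp
  have i: "integrable lborel (\<lambda>k. fourier h k * (cis (k * v) * m k))" if [measurable]: "m \<in> borel_measurable borel" and "\<And>k. norm (m k) \<le> 1" for m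
    by (rule Bochner_Integration.integrable_bound[OF fourier_integrable[OF h]]) (use that in \<open>auto simp: norm_mult mult_left_le\<close>)
  have "propagated h m v - propagated h m' v = 1 / (2 * of_real pi) * (\<integral>k. fourier h k * (cis (k * v) * m k) - fourier h k * (cis (k * v) * m' k) \<partial>lborel)"
    unfolding propagated_def Bochner_Integration.integral_diff[OF i[OF m(1) b(1)] i[OF m(2) b(2)]] by (simp add: right_diff_distrib)
  also have "norm \<dots> \<le> 1 * (\<integral>k. norm (fourier h k * (cis (k * v) * m k) - fourier h k * (cis (k * v) * m' k)) \<partial>lborel)"
    unfolding norm_mult
  proof (rule mult_mono[OF _ integral_norm_bound])
    have "1 \<le> 2 * pi" using pi_ge_two by simp
    then show "norm (1 / (2 * complex_of_real pi)) \<le> 1" by (simp add: norm_divide norm_mult)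
  qed auto
  also have "\<dots> = (\<integral>k. norm (fourier h k) * norm (m k - m' k) \<partial>lborel)"
  proof -
    have "norm (fourier h k * (cis (k * v) * m k) - fourier h k * (cis (k * v) * m' k)) = norm (fourier h k) * norm (m k - m' k)" for k
    proof -
      have "fourier h k * (cis (k * v) * m k) - fourier h k * (cis (k * v) * m' k) = fourier h k * (cis (k * v) * (m k - m' k))"
        by (simp add: algebra_simps)
      then show ?thesis by (simp add: norm_mult)
    qed
    then show ?thesis by (simp only: mult_1_left)
  qed
  finally show ?thesis .
qed

lemma propagated_bounded:
  assumes h: "schwartz h" and b: "\<And>k. norm (m k) \<le> 1"
  shows "norm (propagated h m v) \<le> (\<integral>k. norm (fourier h k) \<partial>lborel)"
proof -
  have "norm (propagated h m v) \<le> 1 * (\<integral>k. norm (fourier h k * (cis (k * v) * m k)) \<partial>lborel)"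
    unfolding propagated_def norm_mult[of "1 / _"]
  proof (rule mult_mono[OF _ integral_norm_bound])
    have "1 \<le> 2 * pi" using pi_ge_two by simp
    then show "norm (1 / (2 * complex_of_real pi)) \<le> 1" by (simp add: norm_divide norm_mult)
  qed auto
  also have "1 * (\<integral>k. norm (fourier h k * (cis (k * v) * m k)) \<partial>lborel) \<le> (\<integral>k. norm (fourier h k) \<partial>lborel)"
    unfolding mult_1_left
    by (rule integral_mono') (use fourier_integrable[OF h] b in \<open>auto simp: norm_mult mult_left_le\<close>)
  finally show ?thesis .
qed

lemma propagated_continuous:
  assumes h: "schwartz h" and m[measurable]: "m \<in> borel_measurable borel" and b: "\<And>k. norm (m k) \<le> 1"
  shows "continuous_on UNIV (propagated h m)"
proof -
  have [measurable]: "fourier h \<in> borel_measurable borel" using borel_measurable_integrable[OF fourier_integrable[OF h]] by simp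
  have "continuous_on UNIV (\<lambda>v. \<integral>k. fourier h k * (cis (k * v) * m k) \<partial>lborel)"
    unfolding continuous_on_sequentially comp_def
  proof (intro allI ballI impI)
    fix s :: "nat \<Rightarrow> real" and v assume "(\<forall>n. s n \<in> UNIV) \<and> s \<longlonglongrightarrow> v"
    then have s: "s \<longlonglongrightarrow> v" by simp
    show "(\<lambda>n. \<integral>k. fourier h k * (cis (k * s n) * m k) \<partial>lborel) \<longlonglongrightarrow> (\<integral>k. fourier h k * (cis (k * v) * m k) \<partial>lborel)"
    proof (rule integral_dominated_convergence[where w="\<lambda>k. norm (fourier h k)"])
      show "AE k in lborel. (\<lambda>n. fourier h k * (cis (k * s n) * m k)) \<longlonglongrightarrow> fourier h k * (cis (k * v) * m k)"
        unfolding cis_conv_exp by (intro AE_I2 tendsto_intros s)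
      show "AE k in lborel. norm (fourier h k * (cis (k * s n) * m k)) \<le> norm (fourier h k)" for n
        using b by (intro AE_I2) (simp add: norm_mult mult_left_le)
      show "integrable lborel (\<lambda>k. norm (fourier h k))" using fourier_integrable[OF h] by (rule integrable_norm)
    qed measurable
  qed
  then show ?thesis unfolding propagated_def[abs_def] by (intro continuous_intros)
qed

text \<open>After inversion of \<open>h\<close>, integrating over \<open>v\<close> first replaces
  the kernel by its characteristic function, and the inner integral becomes the multiplier that also
  arises from the lattice.\<close>

lemma kernel_pairing:
  assumes P: "transition_density_generated_by P L_op" and f: "schwartz f" and h: "schwartz h" and t: "t > 0"
  shows "(\<integral>(u, v). f u * h v * complex_of_real (P t (u - v)) \<partial>(lborel \<Otimes>\<^sub>M lborel))
    = (\<integral>u. f u * propagated h (\<lambda>k. exp (- of_real t * limit_symbol k)) u \<partial>lborel)"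
proof -
  have Pm[measurable]: "P t \<in> borel_measurable borel" by (rule P_measurable[OF P t])
  have Pi: "integrable lborel (\<lambda>v. P t (u - v))" for u
    using lborel_integrable_real_affine[OF P_integrable[OF P t], of "-1" u] by simp
  have Pt: "(\<integral>v. P t (u - v) \<partial>lborel) = 1" for u
    using lborel_integral_real_affine[of "-1" "P t" u] P_total[OF P t] by simp
  have fm[measurable]: "f \<in> borel_measurable borel" using schwartz_measurable[OF f, of 0] by simp
  have hm[measurable]: "h \<in> borel_measurable borel" using schwartz_measurable[OF h, of 0] by simp
  obtain H where H: "\<And>x. norm (h x) \<le> H" using schwartz_bounded[OF h] by blast
  have H0: "H \<ge> 0" using order_trans[OF norm_ge_zero H] .
  have ii: "integrable lborel (\<lambda>v. h v * complex_of_real (P t (u - v)))" for u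
    by (rule Bochner_Integration.integrable_bound[where f="\<lambda>v. H * P t (u - v)"])
       (use Pi H H0 P_nonneg[OF P t] in \<open>auto simp: norm_mult abs_mult intro!: mult_right_mono\<close>)
  have int: "integrable (lborel \<Otimes>\<^sub>M lborel) (\<lambda>(u, v). f u * h v * complex_of_real (P t (u - v)))"
  proof (rule lborel_pair.Fubini_integrable)
    have nb: "norm (\<integral>v. norm (case (u, v) of (u, v) \<Rightarrow> f u * h v * complex_of_real (P t (u - v))) \<partial>lborel) \<le> norm (H * norm (f u))" for u
    proof -
      have "(\<integral>v. norm (case (u, v) of (u, v) \<Rightarrow> f u * h v * complex_of_real (P t (u - v))) \<partial>lborel) = norm (f u) * (\<integral>v. norm (h v * complex_of_real (P t (u - v))) \<partial>lborel)"
        by (simp add: norm_mult mult.assoc)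
      moreover have "(\<integral>v. norm (h v * complex_of_real (P t (u - v))) \<partial>lborel) \<le> (\<integral>v. H * P t (u - v) \<partial>lborel)"
      proof (rule integral_mono)
        show "norm (h v * complex_of_real (P t (u - v))) \<le> H * P t (u - v)" for v
          using H P_nonneg[OF P t] by (simp add: norm_mult mult_right_mono)
      qed (use ii Pi in auto)
      moreover have "0 \<le> (\<integral>v. norm (h v * complex_of_real (P t (u - v))) \<partial>lborel)" by simp
      ultimately show ?thesis using Pt H0 by (simp add: abs_mult mult.commute[of H] mult_left_mono)
    qed
    show "integrable lborel (\<lambda>u. \<integral>v. norm (case (u, v) of (u, v) \<Rightarrow> f u * h v * complex_of_real (P t (u - v))) \<partial>lborel)"
    proof (rule Bochner_Integration.integrable_bound[OF _ _ AE_I2[OF nb]])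
      show "integrable lborel (\<lambda>u. H * norm (f u))" using schwartz_integrable[OF f, of 0] by simp
    qed measurable
    show "AE u in lborel. integrable lborel (\<lambda>v. case (u, v) of (u, v) \<Rightarrow> f u * h v * complex_of_real (P t (u - v)))"
      using ii by (simp add: mult.assoc)
  qed measurable
  have inner: "(\<integral>v. h v * complex_of_real (P t (u - v)) \<partial>lborel) = propagated h (\<lambda>k. exp (- of_real t * limit_symbol k)) u" for u
  proof -
    have Pc: "integrable lborel (\<lambda>v. complex_of_real (P t (u - v)))" using Pi by simp
    have "(\<integral>v. h v * complex_of_real (P t (u - v)) \<partial>lborel)
       = (\<integral>v. 1 / (2 * of_real pi) * (\<integral>k. fourier h k * complex_of_real (P t (u - v)) * cis (k * v) \<partial>lborel) \<partial>lborel)"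
    proof (rule Bochner_Integration.integral_cong[OF refl])
      fix v
      have "(\<integral>k. fourier h k * complex_of_real (P t (u - v)) * cis (k * v) \<partial>lborel) = (\<integral>k. complex_of_real (P t (u - v)) * (fourier h k * cis (k * v)) \<partial>lborel)"
        by (rule Bochner_Integration.integral_cong[OF refl]) simp
      also have "\<dots> = complex_of_real (P t (u - v)) * (\<integral>k. fourier h k * cis (k * v) \<partial>lborel)"
        by (rule integral_mult_right_zero)
      finally show "h v * complex_of_real (P t (u - v)) = 1 / (2 * of_real pi) * (\<integral>k. fourier h k * complex_of_real (P t (u - v)) * cis (k * v) \<partial>lborel)"
        unfolding fourier_inversion[OF h, of v] by (simp only: mult_ac)
    qed
    also have "\<dots> = 1 / (2 * of_real pi) * (\<integral>v. (\<integral>k. fourier h k * complex_of_real (P t (u - v)) * cis (k * v) \<partial>lborel) \<partial>lborel)"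
      by (rule integral_mult_right_zero)
    also have "(\<integral>v. (\<integral>k. fourier h k * complex_of_real (P t (u - v)) * cis (k * v) \<partial>lborel) \<partial>lborel)
       = (\<integral>k. (\<integral>v. fourier h k * complex_of_real (P t (u - v)) * cis (k * v) \<partial>lborel) \<partial>lborel)"
      by (rule lborel_pair.Fubini_integral) (rule integrable_pair_mult_cis[OF fourier_integrable[OF h] Pc], measurable)
    also have "\<dots> = (\<integral>k. fourier h k * (cis (k * u) * exp (- of_real t * limit_symbol k)) \<partial>lborel)"
    proof (rule Bochner_Integration.integral_cong[OF refl])
      fix k
      have cis_u: "cis (k * (u - w)) = cis (k * u) * cis (- k * w)" for w by (simp add: cis_mult algebra_simps)
      have "(\<integral>v. complex_of_real (P t (u - v)) * cis (k * v) \<partial>lborel) = (\<integral>w. complex_of_real (P t w) * cis (k * (u - w)) \<partial>lborel)"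
        using lborel_integral_real_affine[of "-1" "\<lambda>v. complex_of_real (P t (u - v)) * cis (k * v)" u] by simp
      also have "\<dots> = (\<integral>w. cis (k * u) * (complex_of_real (P t w) * cis (- k * w)) \<partial>lborel)"
        by (rule Bochner_Integration.integral_cong[OF refl]) (simp add: cis_u)
      also have "\<dots> = cis (k * u) * exp (- of_real t * symb (- k))"
        unfolding integral_mult_right_zero char_transition_density[OF P t] ..
      finally have "(\<integral>v. complex_of_real (P t (u - v)) * cis (k * v) \<partial>lborel) = cis (k * u) * exp (- of_real t * limit_symbol k)"
        by (simp add: limit_symbol_symb)
      then show "(\<integral>v. fourier h k * complex_of_real (P t (u - v)) * cis (k * v) \<partial>lborel) = fourier h k * (cis (k * u) * exp (- of_real t * limit_symbol k))"
        unfolding mult.assoc integral_mult_right_zero by simp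
    qed
    finally show ?thesis by (simp add: propagated_def)
  qed
  have "(\<integral>(u, v). f u * h v * complex_of_real (P t (u - v)) \<partial>(lborel \<Otimes>\<^sub>M lborel))
     = (\<integral>u. (\<integral>v. f u * h v * complex_of_real (P t (u - v)) \<partial>lborel) \<partial>lborel)"
    using lborel_pair.integral_fst'[OF int] by simp
  also have "\<dots> = (\<integral>u. f u * propagated h (\<lambda>k. exp (- of_real t * limit_symbol k)) u \<partial>lborel)"
    unfolding mult.assoc integral_mult_right_zero inner ..
  finally show ?thesis .
qed

theorem theorem3p2:
  fixes \<beta> b c t :: real
    and M :: "nat \<Rightarrow> 'm measure"
    and X :: "nat \<Rightarrow> real \<Rightarrow> 'm \<Rightarrow> int \<Rightarrow> real"
    and P :: "real \<Rightarrow> real \<Rightarrow> real"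
    and f h :: "real \<Rightarrow> complex"
  assumes "\<beta> > 0" and "c > 0" and "b > 1"
    and "\<And>n. n \<ge> 1 \<Longrightarrow> stationary_dynamics (c * real n powr (- b)) 1 \<beta> (M n) (X n)"
    and "transition_density_generated_by P L_op"
    and "schwartz f" and "schwartz h" and "t > 0"
  shows "(\<lambda>n. correlation (M n) (X n) \<beta> (3 / 2) n t f h) \<longlonglongrightarrow>
           2 / (complex_of_real \<beta>)\<^sup>2 *
           (\<integral>(u, v). f u * h v * complex_of_real (P t (u - v)) \<partial>(lborel \<Otimes>\<^sub>M lborel))"
proof -
  define m where "m n k = mode_sol (c * real n powr (- b)) (k / real n) (t * real n powr (3 / 2)) 0" for n k
  define m0 where "m0 k = exp (- of_real t * limit_symbol k)" for k
  obtain C where C: "\<And>x. norm (f x) \<le> C / (1 + x\<^sup>2)" using schwartz_decay[OF \<open>schwartz f\<close>, of 0] by auto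
  have fc: "continuous_on UNIV f" using schwartz_continuous[OF \<open>schwartz f\<close>, of UNIV 0] by simp
  \<comment> \<open>For each fixed \<open>n\<close> the process is eliminated here; the multiplier
    \<open>m n\<close> is all that remains of it.\<close>
  have flow: "m n \<in> borel_measurable borel \<and> (\<forall>k. norm (m n k) \<le> 1) \<and>
      correlation (M n) (X n) \<beta> (3 / 2) n t f h = 2 / (complex_of_real \<beta>)\<^sup>2 * (1 / of_nat n * (\<Sum>\<^sub>\<infinity>x::int. f (of_int x / real n) * propagated h (m n) (of_int x / real n)))"
    if n: "n > 0" for n
  proof -
    define T where "T = t * real n powr (3 / 2)"
    have T: "T \<ge> 0" using \<open>t > 0\<close> by (simp add: T_def)
    have "c * real n powr (- b) \<ge> 0" using \<open>c > 0\<close> by simp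
    from stationary_dynamics_flow[OF \<open>\<beta> > 0\<close> this assms(4)] n
    obtain A c' where fl: "lattice_flow (c * real n powr (- b)) A c'"
      and cor: "\<And>s x y. s \<ge> 0 \<Longrightarrow> (\<integral>w. ((X n s w x)\<^sup>2 - 1 / \<beta>) * ((X n 0 w y)\<^sup>2 - 1 / \<beta>) \<partial>M n) = 2 / \<beta>\<^sup>2 * c' y x x s"
      by auto
    interpret lattice_flow "c * real n powr (- b)" A c' by (rule fl)
    have fs: "(\<lambda>x::int. norm (f (of_int x / real n))) summable_on UNIV"
      by (rule Riemann_sum_eq_integral(1)[OF n fc C])
    have "correlation (M n) (X n) \<beta> (3 / 2) n t f h = 1 / of_nat n * (\<Sum>\<^sub>\<infinity>p\<in>(UNIV :: (int \<times> int) set).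
        2 / (complex_of_real \<beta>)\<^sup>2 * (case p of (x, y) \<Rightarrow> f (of_int x / real n) * h (of_int y / real n) * of_real (c' y x x T)))"
      unfolding correlation_def T_def[symmetric] cor[OF T]
      by (intro arg_cong[where f="\<lambda>z. 1 / of_nat n * z"] infsum_cong) (auto split: prod.split)
    also have "\<dots> = 2 / (complex_of_real \<beta>)\<^sup>2 * (1 / of_nat n * (\<Sum>\<^sub>\<infinity>(x, y)\<in>(UNIV :: (int \<times> int) set).
        f (of_int x / real n) * h (of_int y / real n) * of_real (c' y x x T)))"
      unfolding infsum_cmult_right' by simp
    also have "\<dots> = 2 / (complex_of_real \<beta>)\<^sup>2 * (1 / of_nat n * (\<Sum>\<^sub>\<infinity>x::int. f (of_int x / real n) * propagated h (m n) (of_int x / real n)))"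
      unfolding flow_double_sum[OF T \<open>schwartz h\<close> n fs] by (simp add: m_def[abs_def] T_def)
    finally show ?thesis
      using mode_sol_measurable[OF T, of "real n"] mode_sol_norm_le_1[OF T] by (simp add: m_def[abs_def] T_def)
  qed
  have m0b: "norm (m0 k) \<le> 1" for k
    using \<open>t > 0\<close> Re_symb[of "- k"] by (simp add: m0_def norm_exp_eq_Re limit_symbol_symb)
  have m0m: "m0 \<in> borel_measurable borel"
    unfolding m0_def[abs_def] limit_symbol_symb by measurable
  define J where "J = propagated h m0"
  define B where "B = (\<integral>k. norm (fourier h k) \<partial>lborel)"
  have Jb: "norm (J v) \<le> B" for v unfolding J_def B_def by (rule propagated_bounded[OF \<open>schwartz h\<close> m0b])
  have Jc: "continuous_on UNIV J" unfolding J_def by (rule propagated_continuous[OF \<open>schwartz h\<close> m0m m0b])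
  have fJ: "norm (f x * J x) \<le> (C * B) / (1 + x\<^sup>2)" for x
    using mult_mono[OF C[of x] Jb[of x] order_trans[OF norm_ge_zero C] norm_ge_zero] by (simp add: norm_mult)
  \<comment> \<open>The limit is taken in two parts. Here the multiplier already has its limiting
    value and only the mesh varies; replacing \<open>m n\<close> by \<open>m0\<close> is estimated
    below.\<close>
  have main: "(\<lambda>n. 1 / of_nat n * (\<Sum>\<^sub>\<infinity>x::int. f (of_int x / real n) * J (of_int x / real n))) \<longlonglongrightarrow> (\<integral>x. f x * J x \<partial>lborel)"
    by (rule Riemann_sum_LIMSEQ[where C="C * B"]) (use fc Jc fJ in \<open>auto intro!: continuous_intros\<close>)
  \<comment> \<open>These sums converge, hence are bounded; they multiply
    \<open>\<epsilon> n\<close> in the comparison below.\<close>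
  have absf: "(\<lambda>n. 1 / of_nat n * (\<Sum>\<^sub>\<infinity>x::int. complex_of_real (norm (f (of_int x / real n))))) \<longlonglongrightarrow> (\<integral>x. complex_of_real (norm (f x)) \<partial>lborel)"
    by (rule Riemann_sum_LIMSEQ[where C=C]) (use fc C in \<open>auto intro!: continuous_intros\<close>)
  have [measurable]: "fourier h \<in> borel_measurable borel" using borel_measurable_integrable[OF fourier_integrable[OF \<open>schwartz h\<close>]] by simp
  define \<epsilon> where "\<epsilon> n = (\<integral>k. norm (fourier h k) * norm (m n k - m0 k) \<partial>lborel)" for n
  have eps: "\<epsilon> \<longlonglongrightarrow> 0"
  proof (rule LIMSEQ_offset[where k=1])
    have "(\<lambda>n. \<epsilon> (n + 1)) \<longlonglongrightarrow> integral\<^sup>L lborel (\<lambda>k::real. 0 :: real)"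
      unfolding \<epsilon>_def
    proof (rule integral_dominated_convergence[where w="\<lambda>k. norm (fourier h k) * 2"])
      show "integrable lborel (\<lambda>k. norm (fourier h k) * 2)" using fourier_integrable[OF \<open>schwartz h\<close>] by simp
      show "(\<lambda>k. norm (fourier h k) * norm (m (n + 1) k - m0 k)) \<in> borel_measurable lborel" for n
      proof -
        have [measurable]: "m (n + 1) \<in> borel_measurable borel" using flow[of "n + 1"] by simp
        show ?thesis using m0m by measurable
      qed
      \<comment> \<open>\<open>mode_sol_limit\<close> excludes \<open>k = 0\<close>, a null
        set.\<close>
      show "AE k in lborel. (\<lambda>n. norm (fourier h k) * norm (m (n + 1) k - m0 k)) \<longlonglongrightarrow> 0"
      proof (rule AE_mp[OF AE_lborel_singleton[of 0]], intro AE_I2 impI)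
        fix k :: real assume k: "k \<noteq> 0"
        have "(\<lambda>n. m n k) \<longlonglongrightarrow> m0 k" unfolding m_def m0_def by (rule mode_sol_limit) (use \<open>c > 0\<close> \<open>b > 1\<close> \<open>t > 0\<close> k in auto)
        then have "(\<lambda>n. m (n + 1) k) \<longlonglongrightarrow> m0 k" by (rule LIMSEQ_ignore_initial_segment)
        then have "(\<lambda>n. norm (fourier h k) * norm (m (n + 1) k - m0 k)) \<longlonglongrightarrow> norm (fourier h k) * norm (m0 k - m0 k)"
          by (intro tendsto_intros)
        then show "(\<lambda>n. norm (fourier h k) * norm (m (n + 1) k - m0 k)) \<longlonglongrightarrow> 0" by simp
      qed
      show "AE k in lborel. norm (norm (fourier h k) * norm (m (n + 1) k - m0 k)) \<le> norm (fourier h k) * 2" for n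
      proof (rule AE_I2)
        fix k
        have "norm (m (n + 1) k) \<le> 1" using flow[of "n + 1"] by simp
        then have "norm (m (n + 1) k - m0 k) \<le> 2" using m0b[of k] norm_triangle_ineq4[of "m (n + 1) k" "m0 k"] by linarith
        then show "norm (norm (fourier h k) * norm (m (n + 1) k - m0 k)) \<le> norm (fourier h k) * 2" by (simp add: mult_left_mono)
      qed
    qed simp
    then show "(\<lambda>n. \<epsilon> (n + 1)) \<longlonglongrightarrow> 0" by simp
  qed
  have "(\<lambda>n. 1 / of_nat n * (\<Sum>\<^sub>\<infinity>x::int. f (of_int x / real n) * propagated h (m n) (of_int x / real n))
     - 1 / of_nat n * (\<Sum>\<^sub>\<infinity>x::int. f (of_int x / real n) * J (of_int x / real n))) \<longlonglongrightarrow> 0"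
  proof (rule Lim_null_comparison)
    from tendsto_mult[OF eps tendsto_norm[OF absf]]
    show "(\<lambda>n. \<epsilon> n * norm (1 / of_nat n * (\<Sum>\<^sub>\<infinity>x::int. complex_of_real (norm (f (of_int x / real n)))))) \<longlonglongrightarrow> 0" by simp
    show "\<forall>\<^sub>F n in sequentially. norm (1 / of_nat n * (\<Sum>\<^sub>\<infinity>x::int. f (of_int x / real n) * propagated h (m n) (of_int x / real n))
     - 1 / of_nat n * (\<Sum>\<^sub>\<infinity>x::int. f (of_int x / real n) * J (of_int x / real n)))
      \<le> \<epsilon> n * norm (1 / of_nat n * (\<Sum>\<^sub>\<infinity>x::int. complex_of_real (norm (f (of_int x / real n)))))"
      using eventually_gt_at_top[of 0]
    proof eventually_elim
      case (elim n)
      have mm: "m n \<in> borel_measurable borel" and mb: "\<And>k. norm (m n k) \<le> 1" using flow[OF elim] by auto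
      have fs: "(\<lambda>x::int. norm (f (of_int x / real n))) summable_on UNIV"
        by (rule Riemann_sum_eq_integral(1)[OF elim fc C])
      have sm: "(\<lambda>x::int. f (of_int x / real n) * g x) summable_on UNIV" if "\<And>x. norm (g x) \<le> K" for g :: "int \<Rightarrow> complex" and K
      proof (rule abs_summable_summable, rule summable_on_comparison_test[OF summable_on_cmult_left[OF fs, of K]])
        show "norm (f (of_int x / real n) * g x) \<le> norm (f (of_int x / real n)) * K" for x
          unfolding norm_mult using that by (intro mult_left_mono) auto
      qed auto
      have d: "norm (propagated h (m n) v - J v) \<le> \<epsilon> n" for v
        unfolding J_def \<epsilon>_def by (rule propagated_diff_le[OF \<open>schwartz h\<close> mm m0m mb m0b])
      have "(\<Sum>\<^sub>\<infinity>x::int. f (of_int x / real n) * propagated h (m n) (of_int x / real n)) - (\<Sum>\<^sub>\<infinity>x::int. f (of_int x / real n) * J (of_int x / real n))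
        = (\<Sum>\<^sub>\<infinity>x::int. f (of_int x / real n) * (propagated h (m n) (of_int x / real n) - J (of_int x / real n)))"
        unfolding right_diff_distrib
        by (rule infsum_diff_real_normed[symmetric]) (rule sm[where K=B], use propagated_bounded[OF \<open>schwartz h\<close> mb] Jb B_def in simp)+
      also have "norm \<dots> \<le> (\<Sum>\<^sub>\<infinity>x::int. norm (f (of_int x / real n)) * \<epsilon> n)"
      proof (rule norm_infsum_le[OF has_sum_infsum has_sum_infsum])
        show "(\<lambda>x::int. f (of_int x / real n) * (propagated h (m n) (of_int x / real n) - J (of_int x / real n))) summable_on UNIV"
          by (rule sm[OF d])
        show "(\<lambda>x::int. norm (f (of_int x / real n)) * \<epsilon> n) summable_on UNIV" by (rule summable_on_cmult_left[OF fs])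
        show "norm (f (of_int x / real n) * (propagated h (m n) (of_int x / real n) - J (of_int x / real n))) \<le> norm (f (of_int x / real n)) * \<epsilon> n" for x :: int
          unfolding norm_mult by (intro mult_left_mono d) simp
      qed
      also have "\<dots> = \<epsilon> n * (\<Sum>\<^sub>\<infinity>x::int. norm (f (of_int x / real n)))"
        by (subst infsum_cmult_left') (simp add: mult.commute)
      finally have le: "norm ((\<Sum>\<^sub>\<infinity>x::int. f (of_int x / real n) * propagated h (m n) (of_int x / real n)) - (\<Sum>\<^sub>\<infinity>x::int. f (of_int x / real n) * J (of_int x / real n)))
         \<le> \<epsilon> n * (\<Sum>\<^sub>\<infinity>x::int. norm (f (of_int x / real n)))" .
      have "(\<Sum>\<^sub>\<infinity>x::int. complex_of_real (norm (f (of_int x / real n)))) = of_real (\<Sum>\<^sub>\<infinity>x::int. norm (f (of_int x / real n)))"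
        by (rule infsumI[OF has_sum_of_real_iff[THEN iffD2, OF has_sum_infsum[OF fs]]])
      moreover have "(\<Sum>\<^sub>\<infinity>x::int. norm (f (of_int x / real n))) \<ge> 0" by (rule infsum_nonneg) simp
      ultimately have "norm (1 / of_nat n * (\<Sum>\<^sub>\<infinity>x::int. complex_of_real (norm (f (of_int x / real n))))) = (\<Sum>\<^sub>\<infinity>x::int. norm (f (of_int x / real n))) / real n"
        by (simp add: norm_divide)
      moreover have "norm (1 / of_nat n * x - 1 / of_nat n * y) = norm (x - y) / real n" for x y :: complex
        by (simp add: norm_divide flip: diff_divide_distrib)
      ultimately show ?case using divide_right_mono[OF le, of "real n"] by (simp only: times_divide_eq_right of_nat_0_le_iff)
    qed
  qed
  from tendsto_add[OF this main]
  have "(\<lambda>n. 1 / of_nat n * (\<Sum>\<^sub>\<infinity>x::int. f (of_int x / real n) * propagated h (m n) (of_int x / real n))) \<longlonglongrightarrow> (\<integral>x. f x * J x \<partial>lborel)"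
    by simp
  from tendsto_mult_left[OF this, of "2 / (complex_of_real \<beta>)\<^sup>2"]
  have "(\<lambda>n. 2 / (complex_of_real \<beta>)\<^sup>2 * (1 / of_nat n * (\<Sum>\<^sub>\<infinity>x::int. f (of_int x / real n) * propagated h (m n) (of_int x / real n)))) \<longlonglongrightarrow>
     2 / (complex_of_real \<beta>)\<^sup>2 * (\<integral>(u, v). f u * h v * complex_of_real (P t (u - v)) \<partial>(lborel \<Otimes>\<^sub>M lborel))"
    unfolding kernel_pairing[OF assms(5-8)] J_def m0_def[abs_def] .
  then show ?thesis
  proof (rule Lim_transform_eventually)
    show "\<forall>\<^sub>F n in sequentially. 2 / (complex_of_real \<beta>)\<^sup>2 * (1 / of_nat n * (\<Sum>\<^sub>\<infinity>x::int. f (of_int x / real n) * propagated h (m n) (of_int x / real n)))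
       = correlation (M n) (X n) \<beta> (3 / 2) n t f h"
      using eventually_gt_at_top[of 0] by eventually_elim (use flow in auto)
  qed
qed

end
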